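(* Let $T>0$, $\chi\in\mathbb{R}$, $\zeta\in\mathcal{C}^{\alpha_0}(\mathbb{T})$ and $Z\in C_T\mathcal{C}^\alpha_0$. Let $\mathfrak R\ge1$ be such that $\|Z\|^3_{C_T\mathcal{C}^\alpha}+\|\zeta\|_{\mathcal{C}^{\alpha_0}}<\mathfrak R$. Then there exists $C>0$, independent of $\mathfrak R$, $\zeta$ and $Z$, such that the remainder equation has a unique mild solution $w\in C_{\eta;T_*}\mathcal{C}^\alpha$, where $$T_*=\Big(\frac{1}{C\mathfrak R}\Big)^{1/\theta}\wedge T,\qquad \theta:=\Big(\eta-\frac{\alpha-\alpha_0}{2}\Big)\wedge\Big(\frac12-2\eta\Big).$$ Furthermore $\sup_{t\in(0,T_*]}t^\eta\|w_t\|_{\mathcal{C}^\alpha}\le1$ and $\lim_{t\to0}\|w_t-\zeta\|_{\mathcal{C}^{\alpha_0}}=0$.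
   Context: $\mathbb{T}=\mathbb{R}/\mathbb{Z}$; $\bar f=\langle f,1\rangle$; $\mathcal{C}^\beta=\mathcal{B}^\beta_{\infty,\infty}(\mathbb{T})$ (Hölder–Besov space, completion of $C^\infty$), subscript $0$ meaning mean zero. $C_TE=C([0,T];E)$ with sup norm; $C_{\eta;S}E$ is the space of continuous $f:(0,S]\to E$ with $\|f\|_{C_{\eta;S}E}=\sup_{t\in(0,S]}(t^\eta\wedge1)\|f_t\|_E<\infty$. Fixed parameters: $\alpha_0\in(-\tfrac12,0)$, $\alpha\in(0,\alpha_0+\tfrac12)$, $\frac{\alpha-\alpha_0}2<\eta<\frac14$. For $f$, $\rho_f$ is the mean-zero solution of $-\partial_{xx}\rho_f=f-\bar f$. A mild solution on $[0,S]$ of the remainder equation (started from $\zeta$, driven by $Z$) is $w\in C_{\eta;S}\mathcal{C}^\alpha$ with, for every $t\in(0,S]$, $w_t=e^{t\Delta}\zeta+\int_0^te^{(t-s)\Delta}\chi\partial_x\big((w_s+Z_s)^2\partial_x\rho_{w_s+Z_s}\big)ds$, where $e^{t\Delta}$ is the periodic heat semigroup. *)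

theory Defs
  imports "HOL-Analysis.Analysis"
begin

text \<open>Distributions on the torus T = R/Z are represented by their Fourier
coefficients: f k is the coefficient of e_k(x) = exp(2 pi i k x).\<close>

type_synonym tdist = "int \<Rightarrow> complex"

definition real_dist :: "tdist \<Rightarrow> bool" where
  "real_dist f \<longleftrightarrow> (\<forall>k. f (-k) = cnj (f k))"

definition smooth_dist :: "tdist \<Rightarrow> bool" where
  "smooth_dist f \<longleftrightarrow> (\<forall>N::nat. \<exists>C. \<forall>k. cmod (f k) \<le> C / (1 + \<bar>real_of_int k\<bar>) ^ N)"

definition dadd :: "tdist \<Rightarrow> tdist \<Rightarrow> tdist" where
  "dadd f g = (\<lambda>k. f k + g k)"

definition dsub :: "tdist \<Rightarrow> tdist \<Rightarrow> tdist" where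
  "dsub f g = (\<lambda>k. f k - g k)"

definition smooth_real :: "(real \<Rightarrow> real) \<Rightarrow> bool" where
  "smooth_real f \<longleftrightarrow> (\<exists>D. D 0 = f \<and> (\<forall>n x. (D n has_real_derivative D (Suc n) x) (at x)))"

text \<open>Dyadic partition of unity (chi = rho0, rho), Bahouri-Chemin-Danchin conventions.\<close>
definition dyadic_partition :: "(real \<Rightarrow> real) \<Rightarrow> (real \<Rightarrow> real) \<Rightarrow> bool" where
  "dyadic_partition \<rho>0 \<rho> \<longleftrightarrow>
     smooth_real \<rho>0 \<and> smooth_real \<rho> \<and>
     (\<forall>x. \<rho>0 x \<ge> 0 \<and> \<rho> x \<ge> 0 \<and> \<rho>0 (-x) = \<rho>0 x \<and> \<rho> (-x) = \<rho> x) \<and>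
     (\<forall>x. \<rho>0 x \<noteq> 0 \<longrightarrow> \<bar>x\<bar> \<le> 4/3) \<and>
     (\<forall>x. \<rho> x \<noteq> 0 \<longrightarrow> 3/4 \<le> \<bar>x\<bar> \<and> \<bar>x\<bar> \<le> 8/3) \<and>
     (\<forall>x. \<rho>0 x + (\<Sum>j. \<rho> (x / 2 ^ j)) = 1)"

text \<open>Littlewood-Paley block number j (j = 0 is the block Delta_{-1},
 j = m+1 is Delta_m for m >= 0).\<close>
definition lp_w :: "(real \<Rightarrow> real) \<Rightarrow> (real \<Rightarrow> real) \<Rightarrow> nat \<Rightarrow> int \<Rightarrow> real" where
  "lp_w \<rho>0 \<rho> j k = (if j = 0 then \<rho>0 (real_of_int k) else \<rho> (real_of_int k / 2 ^ (j - 1)))"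

definition lp_block :: "(real \<Rightarrow> real) \<Rightarrow> (real \<Rightarrow> real) \<Rightarrow> nat \<Rightarrow> tdist \<Rightarrow> real \<Rightarrow> complex" where
  "lp_block \<rho>0 \<rho> j f x =
     (\<Sum>k\<in>{-(2 ^ (j+1))..2 ^ (j+1)}. complex_of_real (lp_w \<rho>0 \<rho> j k) * f k
         * cis (2 * pi * real_of_int k * x))"

definition besov_seq :: "(real \<Rightarrow> real) \<Rightarrow> (real \<Rightarrow> real) \<Rightarrow> real \<Rightarrow> tdist \<Rightarrow> nat \<Rightarrow> real" where
  "besov_seq \<rho>0 \<rho> \<beta> f j =
     2 powr ((real j - 1) * \<beta>) * (SUP x\<in>{0..1}. cmod (lp_block \<rho>0 \<rho> j f x))"

definition besov_norm :: "(real \<Rightarrow> real) \<Rightarrow> (real \<Rightarrow> real) \<Rightarrow> real \<Rightarrow> tdist \<Rightarrow> real" where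
  "besov_norm \<rho>0 \<rho> \<beta> f = (SUP j. besov_seq \<rho>0 \<rho> \<beta> f j)"

definition besov_bdd :: "(real \<Rightarrow> real) \<Rightarrow> (real \<Rightarrow> real) \<Rightarrow> real \<Rightarrow> tdist \<Rightarrow> bool" where
  "besov_bdd \<rho>0 \<rho> \<beta> f \<longleftrightarrow> bdd_above (range (besov_seq \<rho>0 \<rho> \<beta> f))"

definition in_C :: "(real \<Rightarrow> real) \<Rightarrow> (real \<Rightarrow> real) \<Rightarrow> real \<Rightarrow> tdist \<Rightarrow> bool" where
  "in_C \<rho>0 \<rho> \<beta> f \<longleftrightarrow> real_dist f \<and> besov_bdd \<rho>0 \<rho> \<beta> f \<and>
     (\<forall>\<epsilon>>0. \<exists>g. smooth_dist g \<and> real_dist g \<and> besov_bdd \<rho>0 \<rho> \<beta> (dsub f g) \<and>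
                 besov_norm \<rho>0 \<rho> \<beta> (dsub f g) < \<epsilon>)"

definition cont_C :: "(real \<Rightarrow> real) \<Rightarrow> (real \<Rightarrow> real) \<Rightarrow> real \<Rightarrow> real set \<Rightarrow> (real \<Rightarrow> tdist) \<Rightarrow> bool" where
  "cont_C \<rho>0 \<rho> \<beta> A w \<longleftrightarrow> (\<forall>t\<in>A. in_C \<rho>0 \<rho> \<beta> (w t)) \<and>
     (\<forall>t\<in>A. \<forall>\<epsilon>>0. \<exists>\<delta>>0. \<forall>s\<in>A. \<bar>s - t\<bar> < \<delta> \<longrightarrow> besov_norm \<rho>0 \<rho> \<beta> (dsub (w s) (w t)) < \<epsilon>)"

definition in_Ceta :: "(real \<Rightarrow> real) \<Rightarrow> (real \<Rightarrow> real) \<Rightarrow> real \<Rightarrow> real \<Rightarrow> real \<Rightarrow> (real \<Rightarrow> tdist) \<Rightarrow> bool" where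
  "in_Ceta \<rho>0 \<rho> \<alpha> \<eta> S w \<longleftrightarrow> cont_C \<rho>0 \<rho> \<alpha> {0<..S} w \<and>
     bdd_above ((\<lambda>t. min (t powr \<eta>) 1 * besov_norm \<rho>0 \<rho> \<alpha> (w t)) ` {0<..S})"

text \<open>Periodic heat semigroup e^{t Delta}, Delta e_k = -4 pi^2 k^2 e_k.\<close>
definition heat :: "real \<Rightarrow> tdist \<Rightarrow> tdist" where
  "heat t f = (\<lambda>k. complex_of_real (exp (- 4 * pi^2 * (real_of_int k)^2 * t)) * f k)"

text \<open>Fourier coefficients of a 1-periodic function, and the continuous
 representative of a distribution (when it exists).\<close>
definition fc :: "(real \<Rightarrow> real) \<Rightarrow> tdist" where
  "fc g = (\<lambda>k. integral {0..1} (\<lambda>x. complex_of_real (g x) * cis (- 2 * pi * real_of_int k * x)))"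

definition fun_of :: "tdist \<Rightarrow> real \<Rightarrow> real" where
  "fun_of f = (THE g. continuous_on UNIV g \<and> (\<forall>x. g (x + 1) = g x) \<and> fc g = f)"

text \<open>d/dx rho_f, where -rho_f'' = f - mean f, rho_f of mean zero.\<close>
definition dx_rho :: "tdist \<Rightarrow> tdist" where
  "dx_rho f = (\<lambda>k. if k = 0 then 0 else \<i> * f k / complex_of_real (2 * pi * real_of_int k))"

text \<open>Nonlinearity u^2 * d/dx rho_u (for u of positive regularity, a function).\<close>
definition nonlin :: "tdist \<Rightarrow> tdist" where
  "nonlin u = fc (\<lambda>x. (fun_of u x)^2 * fun_of (dx_rho u) x)"

definition mild_sol :: "(real \<Rightarrow> real) \<Rightarrow> (real \<Rightarrow> real) \<Rightarrow> real \<Rightarrow> real \<Rightarrow> real \<Rightarrow>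
    tdist \<Rightarrow> (real \<Rightarrow> tdist) \<Rightarrow> real \<Rightarrow> (real \<Rightarrow> tdist) \<Rightarrow> bool" where
  "mild_sol \<rho>0 \<rho> \<alpha> \<eta> chi \<zeta> Z S w \<longleftrightarrow> in_Ceta \<rho>0 \<rho> \<alpha> \<eta> S w \<and>
     (\<forall>t\<in>{0<..S}. \<forall>k.
        (\<lambda>s. heat (t - s) (\<lambda>k. complex_of_real chi * (2 * pi * \<i> * of_int k) * nonlin (dadd (w s) (Z s)) k) k)
           integrable_on {0..t} \<and>
        w t k = heat t \<zeta> k +
          integral {0..t} (\<lambda>s. heat (t - s)
              (\<lambda>k. complex_of_real chi * (2 * pi * \<i> * of_int k) * nonlin (dadd (w s) (Z s)) k) k))"

end

theory Submission
  imports Defs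
begin

text \<open>
  A discrete Bernstein multiplier theorem (a kernel whose symbol is bounded and slowly varying has
  bounded \<open>L\<^sup>1\<close> norm, by Parseval against the weight \<open>1 + n\<^sup>2 \<bar>1 - e\<^sub>1\<bar>\<^sup>2\<close>) gives all heat-flow estimates
  block by block, and uniqueness of Fourier coefficients.

  No product estimate in \<open>C\<^sup>\<alpha>\<close> is needed, only the bound of \<open>u\<^sup>2 \<partial>\<^sub>x\<rho>\<^sub>u\<close> in \<open>L\<^sup>\<infinity>\<close>. The fixed point is
  sought in \<open>t\<^sup>\<gamma> \<parallel>w\<^sub>t\<parallel>\<^sub>\<beta> \<le> 1\<close> with a small \<open>0 < \<beta> < \<alpha>\<close> and \<open>\<gamma> = \<eta> - (\<alpha> - \<beta>) / 2\<close>: the smoothing loss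
  \<open>(t - s) powr (- (1 + \<alpha>) / 2)\<close> from \<open>L\<^sup>\<infinity>\<close> to \<open>C\<^sup>\<alpha>\<close> is paid for by the weaker singularity \<open>s powr (- 3 \<gamma>)\<close>,
  and the exponent \<open>\<theta>\<close> of the statement results. The Picard iterates stay in this ball on \<open>(0, T\<^sub>*]\<close>;
  contraction and uniqueness hold for the weight \<open>exp (- \<lambda> t) t\<^sup>\<eta>\<close> with \<open>\<lambda>\<close> large. For the limit
  at \<open>t = 0\<close> the iterates are in addition bounded by \<open>K t powr (- (\<beta> - \<alpha>0) / 2)\<close>, the rate of the
  linear flow, near \<open>0\<close>; that rate makes the Duhamel term vanish in \<open>C\<^sup>\<alpha>\<^sup>0\<close>.
\<close>

section \<open>Fourier multipliers on the circle\<close>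

text \<open>With \<open>\<beta> = \<alpha>\<close> the weight would be
  \<open>\<gamma> = \<eta>\<close>, and the Duhamel term would gain only the power
  \<open>1/2 - 2 * \<eta> - \<alpha> / 2\<close>, which can be less than \<open>\<theta>\<close>.
  For \<open>\<beta> < \<alpha>\<close> the gain is
  \<open>1/2 - 2 * \<eta> + \<alpha> - 3 * \<beta> / 2\<close>, whatever the target regularity.
  Positivity of \<open>\<beta>\<close> is kept because only then do the blocks sum to a continuous
  function, on which \<open>fun_of\<close> is meaningful. The length of the time interval is spent
  entirely on the invariance of the ball. A contraction obtained from short time would enlarge the
  constant, and on sets of arbitrary size \<open>M\<close>, as uniqueness requires, it would force a
  time depending on \<open>M\<close>. The exponential weight avoids both. All estimates concern
  single blocks, which are finite sums of modes. They therefore pass through coefficientwise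
  integrals and limits, and the Picard limit is taken coefficient by coefficient. Membership in the
  closure of the smooth functions comes from regularity above \<open>\<alpha>\<close> at positive
  times; at time 0 convergence rests on the density built into \<open>in_C\<close> for the initial
  datum.\<close>

abbreviation modes :: "nat \<Rightarrow> int set" where
  "modes n \<equiv> {-int n..int n}"

abbreviation ek :: "int \<Rightarrow> real \<Rightarrow> complex" where
  "ek k x \<equiv> cis (2 * pi * real_of_int k * x)"

text \<open>Complex-valued counterpart of \<open>fc\<close>: blocks and kernels are complex
  functions, whereas \<open>fc\<close> takes real ones.\<close>

definition cfc :: "(real \<Rightarrow> complex) \<Rightarrow> tdist" where
  "cfc g k = integral {0..1} (\<lambda>x. g x * cis (- 2 * pi * real_of_int k * x))"

lemma fc_cfc: "fc g = cfc (\<lambda>x. complex_of_real (g x))"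
  by (simp add: fc_def cfc_def fun_eq_iff)

lemma ek_mult: "ek k x * ek l x = ek (k + l) x"
  by (simp add: cis_mult algebra_simps)

lemma ek_add: "ek k (x + y) = ek k x * ek k y"
  by (simp add: cis_mult algebra_simps)

lemma cis_2pi_int: "cis (2 * pi * real_of_int k) = 1"
  by (metis cis_multiple_2pi Ints_of_int)

lemma ek_periodic: "ek k (x + 1) = ek k x"
  unfolding ek_add using cis_2pi_int[of k] by simp

lemma continuous_on_ek [continuous_intros]: "continuous_on S (ek k)"
  by (intro continuous_intros)

lemma integral_ek: "(ek k has_integral (if k = 0 then 1 else 0)) {0..1}"
proof (cases "k = 0")
  case True
  then show ?thesis using has_integral_const_real[of "1::complex" 0 1] by simp
next
  case False
  define c where "c = 2 * pi * \<i> * complex_of_int k"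
  have c0: "c \<noteq> 0" using False by (simp add: c_def)
  have ex: "ek k x = exp (c * complex_of_real x)" for x
    by (simp add: cis_conv_exp c_def mult_ac)
  have "((\<lambda>x. exp (c * complex_of_real x)) has_integral
      (exp (c * complex_of_real 1) / c - exp (c * complex_of_real 0) / c)) {0..1}"
  proof (rule fundamental_theorem_of_calculus)
    fix x :: real assume "x \<in> {0..1}"
    have "((\<lambda>z. exp (c * z) / c) has_field_derivative exp (c * of_real x)) (at (of_real x))"
      using c0 by (auto intro!: derivative_eq_intros)
    then have "((\<lambda>x. exp (c * complex_of_real x) / c) has_vector_derivative exp (c * of_real x)) (at x)"
      using has_vector_derivative_real_field by blast
    then show "((\<lambda>x. exp (c * complex_of_real x) / c) has_vector_derivative exp (c * complex_of_real x)) (at x within {0..1})"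
      by (rule has_vector_derivative_at_within)
  qed simp
  moreover have "exp (c * complex_of_real 1) = 1"
    using ex[of 1] cis_2pi_int[of k] by simp
  ultimately show ?thesis using False by (simp add: ex)
qed

lemma cnj_ek: "cnj (ek k x) = ek (- k) x"
  by (simp add: cis_cnj)

text \<open>The squared modulus is expanded into a finite double sum, of which orthogonality of the
  modes leaves the diagonal.\<close>

lemma parseval_trig:
  fixes m :: tdist
  assumes "finite A"
  shows "((\<lambda>x. (cmod (\<Sum>k\<in>A. m k * ek k x))\<^sup>2) has_integral (\<Sum>k\<in>A. (cmod (m k))\<^sup>2)) {0..1}"
proof -
  have eq: "complex_of_real ((cmod (\<Sum>k\<in>A. m k * ek k x))\<^sup>2)
      = (\<Sum>k\<in>A. \<Sum>l\<in>A. m k * cnj (m l) * ek (k - l) x)" for x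
  proof -
    have "complex_of_real ((cmod (\<Sum>k\<in>A. m k * ek k x))\<^sup>2)
      = (\<Sum>k\<in>A. m k * ek k x) * (\<Sum>l\<in>A. cnj (m l) * ek (- l) x)"
      by (subst complex_norm_square) (simp add: cnj_ek)
    also have "\<dots> = (\<Sum>k\<in>A. \<Sum>l\<in>A. m k * cnj (m l) * (ek k x * ek (- l) x))"
      by (simp add: sum_product mult_ac)
    finally show ?thesis unfolding ek_mult by simp
  qed
  have "((\<lambda>x. \<Sum>k\<in>A. \<Sum>l\<in>A. m k * cnj (m l) * ek (k - l) x) has_integral
      (\<Sum>k\<in>A. \<Sum>l\<in>A. m k * cnj (m l) * (if k - l = 0 then 1 else 0))) {0..1}"
    by (intro has_integral_sum assms has_integral_mult_right integral_ek)
  also have "(\<Sum>k\<in>A. \<Sum>l\<in>A. m k * cnj (m l) * (if k - l = 0 then 1 else 0))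
      = complex_of_real (\<Sum>k\<in>A. (cmod (m k))\<^sup>2)"
  proof -
    have "(\<Sum>l\<in>A. m k * cnj (m l) * (if k - l = 0 then 1 else 0)) = complex_of_real ((cmod (m k))\<^sup>2)" if "k \<in> A" for k
    proof -
      have "(\<Sum>l\<in>A. m k * cnj (m l) * (if k - l = 0 then 1 else 0)) = (\<Sum>l\<in>A. if k = l then m k * cnj (m l) else 0)"
        by (intro sum.cong) auto
      also have "\<dots> = m k * cnj (m k)" using assms that by simp
      also have "\<dots> = complex_of_real ((cmod (m k))\<^sup>2)" by (rule complex_norm_square[symmetric])
      finally show ?thesis .
    qed
    then show ?thesis by (simp del: of_real_power)
  qed
  finally have "((\<lambda>x. complex_of_real ((cmod (\<Sum>k\<in>A. m k * ek k x))\<^sup>2)) has_integral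
      complex_of_real (\<Sum>k\<in>A. (cmod (m k))\<^sup>2)) {0..1}"
    unfolding eq .
  from has_integral_Re[OF this] show ?thesis
    unfolding Re_complex_of_real .
qed

section \<open>Integral of the reciprocal weight\<close>

text \<open>Weaker than Jordan's inequality, but the factor 2 in \<open>norm_one_minus_ek\<close>
  and \<open>pi > 3\<close> leave ample room.\<close>

lemma sin_ge_half:
  assumes "0 \<le> x" "x \<le> pi / 2"
  shows "x / 2 \<le> sin x"
proof -
  have "\<bar>sin x - x\<bar> \<le> x ^ 3 / 6"
    using Maclaurin_sin_bound[of x 3] assms
    by (simp add: sin_coeff_def numeral_3_eq_3 fact_reduce field_simps)
  moreover have "x ^ 3 / 6 \<le> x / 2"
  proof -
    have "x < 1.6" using assms pi_approx by simp
    then have "x\<^sup>2 \<le> 1.6\<^sup>2" using assms by (intro power_mono) auto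
    then have "x * x\<^sup>2 \<le> x * 3" using assms by (intro mult_left_mono) (auto simp: power2_eq_square)
    then show ?thesis by (simp add: power3_eq_cube power2_eq_square)
  qed
  ultimately show ?thesis by linarith
qed

lemma norm_one_minus_ek: "cmod (1 - ek 1 y) = 2 * \<bar>sin (pi * y)\<bar>"
proof -
  have "(cmod (1 - ek 1 y))\<^sup>2 = (1 - cos (2 * (pi * y)))\<^sup>2 + (sin (2 * (pi * y)))\<^sup>2"
    by (simp add: cmod_def mult.assoc)
  also have "\<dots> = (2 * \<bar>sin (pi * y)\<bar>)\<^sup>2"
    unfolding cos_double sin_double
    by (simp add: cos_squared_eq power_mult_distrib) (simp add: power2_eq_square power4_eq_xxxx algebra_simps)
  finally show ?thesis
    by (rule power2_eq_imp_eq) simp_all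
qed

lemma norm_one_minus_ek_ge:
  assumes "0 \<le> y" "y \<le> 1/2"
  shows "y \<le> cmod (1 - ek 1 y)"
proof -
  have "pi * y / 2 \<le> sin (pi * y)"
    using assms by (intro sin_ge_half) auto
  moreover have "3 * y \<le> pi * y" using assms pi_approx by (intro mult_right_mono) auto
  ultimately show ?thesis using assms unfolding norm_one_minus_ek by linarith
qed

lemma norm_one_minus_ek_ge':
  assumes "1/2 \<le> y" "y \<le> 1"
  shows "1 - y \<le> cmod (1 - ek 1 y)"
proof -
  have "cmod (1 - ek 1 y) = cmod (1 - ek 1 (1 - y))"
    unfolding norm_one_minus_ek by (simp add: algebra_simps sin_diff)
  then show ?thesis using norm_one_minus_ek_ge[of "1 - y"] assms by simp
qed

text \<open>\<open>cmod (1 - ek 1 y)\<close> dominates the distance of \<open>y\<close> to the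
  nearer of 0 and 1. So the integrand lies below the sum of two Cauchy profiles, centred at 0 and at
  1, each of integral \<open>arctan n / n\<close>.\<close>

lemma integral_weight:
  assumes n: "n > (0::real)"
  shows "integral {0..1} (\<lambda>y. 1 / (1 + n\<^sup>2 * (cmod (1 - ek 1 y))\<^sup>2)) \<le> 4 / n"
proof -
  have pos: "1 + n\<^sup>2 * z\<^sup>2 > 0" for z by (smt (verit) zero_le_power2 mult_nonneg_nonneg)
  have I1: "((\<lambda>y. 1 / (1 + n\<^sup>2 * y\<^sup>2)) has_integral (arctan n / n)) {0..1}"
  proof -
    have "((\<lambda>y. 1 / (1 + n\<^sup>2 * y\<^sup>2)) has_integral (arctan (n * 1) / n - arctan (n * 0) / n)) {0..1}"
    proof (rule fundamental_theorem_of_calculus)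
      fix x :: real
      have "((\<lambda>x. arctan (n * x) / n) has_real_derivative (1 / (1 + n\<^sup>2 * x\<^sup>2))) (at x within {0..1})"
        using n by (auto intro!: derivative_eq_intros simp: power_mult_distrib inverse_eq_divide)
      then show "((\<lambda>x. arctan (n * x) / n) has_vector_derivative (1 / (1 + n\<^sup>2 * x\<^sup>2))) (at x within {0..1})"
        by (simp add: has_real_derivative_iff_has_vector_derivative)
    qed simp
    then show ?thesis by simp
  qed
  have I2: "((\<lambda>y. 1 / (1 + n\<^sup>2 * (1 - y)\<^sup>2)) has_integral (arctan n / n)) {0..1}"
  proof -
    have "((\<lambda>y. 1 / (1 + n\<^sup>2 * (1 - y)\<^sup>2)) has_integral ((- arctan (n * (1 - 1)) / n) - (- arctan (n * (1 - 0)) / n))) {0..1}"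
    proof (rule fundamental_theorem_of_calculus)
      fix x :: real
      have "((\<lambda>x. - arctan (n * (1 - x)) / n) has_real_derivative (1 / (1 + n\<^sup>2 * (1 - x)\<^sup>2))) (at x within {0..1})"
        using n by (auto intro!: derivative_eq_intros simp: power_mult_distrib inverse_eq_divide)
      then show "((\<lambda>x. - arctan (n * (1 - x)) / n) has_vector_derivative (1 / (1 + n\<^sup>2 * (1 - x)\<^sup>2))) (at x within {0..1})"
        by (simp add: has_real_derivative_iff_has_vector_derivative)
    qed simp
    then show ?thesis by simp
  qed
  have "integral {0..1} (\<lambda>y. 1 / (1 + n\<^sup>2 * (cmod (1 - ek 1 y))\<^sup>2)) \<le>
        integral {0..1} (\<lambda>y. 1 / (1 + n\<^sup>2 * y\<^sup>2) + 1 / (1 + n\<^sup>2 * (1 - y)\<^sup>2))"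
  proof (rule integral_le)
    show "(\<lambda>y. 1 / (1 + n\<^sup>2 * (cmod (1 - ek 1 y))\<^sup>2)) integrable_on {0..1}"
      using pos by (intro integrable_continuous_real continuous_intros) (auto simp: less_imp_neq[symmetric])
    show "(\<lambda>y. 1 / (1 + n\<^sup>2 * y\<^sup>2) + 1 / (1 + n\<^sup>2 * (1 - y)\<^sup>2)) integrable_on {0..1}"
      by (intro integrable_add has_integral_integrable[OF I1] has_integral_integrable[OF I2])
    fix y :: real assume y: "y \<in> {0..1}"
    have le: "1 / (1 + n\<^sup>2 * (cmod (1 - ek 1 y))\<^sup>2) \<le> 1 / (1 + n\<^sup>2 * z\<^sup>2)"
      if "0 \<le> z" "z \<le> cmod (1 - ek 1 y)" for z
      using that pos[of z] by (intro divide_left_mono add_left_mono mult_left_mono power_mono mult_pos_pos pos) auto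
    show "1 / (1 + n\<^sup>2 * (cmod (1 - ek 1 y))\<^sup>2) \<le> 1 / (1 + n\<^sup>2 * y\<^sup>2) + 1 / (1 + n\<^sup>2 * (1 - y)\<^sup>2)"
    proof (cases "y \<le> 1/2")
      case True
      then show ?thesis using le[of y] norm_one_minus_ek_ge[of y] y pos[of "1 - y"]
        by (smt (verit) atLeastAtMost_iff divide_nonneg_pos)
    next
      case False
      then show ?thesis using le[of "1 - y"] norm_one_minus_ek_ge'[of y] y pos[of y]
        by (smt (verit) atLeastAtMost_iff divide_nonneg_pos)
    qed
  qed
  also have "\<dots> = arctan n / n + arctan n / n"
    using I1 I2 by (intro integral_unique has_integral_add)
  also have "\<dots> \<le> 4 / n"
  proof -
    have "arctan n \<le> 2" using arctan_ubound[of n] pi_less_4 by linarith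
    then show ?thesis using n by (simp add: field_simps)
  qed
  finally show ?thesis .
qed

section \<open>Kernels with slowly varying symbol and their integrals\<close>

definition tker :: "nat \<Rightarrow> tdist \<Rightarrow> real \<Rightarrow> complex" where
  "tker L m x = (\<Sum>k\<in>modes L. m k * ek k x)"

lemma continuous_on_tker [continuous_intros]: "continuous_on S (tker L m)"
  unfolding tker_def by (intro continuous_intros)

lemma tker_periodic: "tker L m (x + 1) = tker L m x"
  unfolding tker_def ek_periodic ..

text \<open>Multiplication by \<open>1 - ek 1\<close> is a backward difference of the symbol: slow
  variation of the symbol becomes decay of the kernel away from the integers. The shift adds one
  mode on the right.\<close>

lemma tker_diff:
  assumes "\<And>k. \<bar>k\<bar> > int L \<Longrightarrow> m k = 0"
  shows "(1 - ek 1 x) * tker L m x = (\<Sum>k\<in>{-int L..int L + 1}. (m k - m (k - 1)) * ek k x)"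
proof -
  have 1: "tker L m x = (\<Sum>k\<in>{-int L..int L + 1}. m k * ek k x)"
    unfolding tker_def by (intro sum.mono_neutral_left) (auto simp: assms)
  have "ek 1 x * tker L m x = (\<Sum>k\<in>modes L. m k * ek (k + 1) x)"
    unfolding tker_def sum_distrib_left
  proof (intro sum.cong refl)
    fix k
    have "a * (b * c) = b * (c * a)" for a b c :: complex by (simp add: mult_ac)
    then show "ek 1 x * (m k * ek k x) = m k * ek (k + 1) x"
      using ek_mult[of k x 1] by metis
  qed
  also have "\<dots> = (\<Sum>k\<in>{-int L + 1..int L + 1}. m (k - 1) * ek k x)"
    by (rule sum.reindex_bij_witness[of _ "\<lambda>k. k - 1" "\<lambda>k. k + 1"]) auto
  also have "\<dots> = (\<Sum>k\<in>{-int L..int L + 1}. m (k - 1) * ek k x)"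
    by (intro sum.mono_neutral_left) (auto intro!: assms)
  finally have 2: "ek 1 x * tker L m x = (\<Sum>k\<in>{-int L..int L + 1}. m (k - 1) * ek k x)" .
  have "(1 - ek 1 x) * tker L m x = tker L m x - ek 1 x * tker L m x"
    by (simp only: left_diff_distrib mult_1)
  also have "\<dots> = (\<Sum>k\<in>{-int L..int L + 1}. m k * ek k x) - (\<Sum>k\<in>{-int L..int L + 1}. m (k - 1) * ek k x)"
    unfolding 2 unfolding 1 ..
  also have "\<dots> = (\<Sum>k\<in>{-int L..int L + 1}. (m k - m (k - 1)) * ek k x)"
    by (simp only: sum_subtractf[symmetric] left_diff_distrib)
  finally show ?thesis .
qed

text \<open>\<open>n\<close> is the frequency scale, later \<open>2 ^ j\<close> for block
  \<open>j\<close>. Blocks live on \<open>modes (2 * n)\<close>; support up to \<open>4 * n\<close>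
  leaves room for the cutoff \<open>trap\<close>.\<close>

locale kernel =
  fixes n :: nat and m :: tdist and A :: real
  assumes n: "n \<ge> 1" and A: "A > 0"
    and supp: "\<And>k. \<bar>k\<bar> > 4 * int n \<Longrightarrow> m k = 0"
    and bound: "\<And>k. cmod (m k) \<le> A"
    and lip: "\<And>k. cmod (m k - m (k - 1)) \<le> A / n"
begin

lemma l2: "integral {0..1} (\<lambda>x. (cmod (tker (4*n) m x))\<^sup>2) \<le> 9 * n * A\<^sup>2"
proof -
  have "integral {0..1} (\<lambda>x. (cmod (tker (4*n) m x))\<^sup>2) = (\<Sum>k\<in>modes (4*n). (cmod (m k))\<^sup>2)"
    unfolding tker_def by (intro integral_unique parseval_trig) simp
  also have "\<dots> \<le> (\<Sum>k\<in>modes (4*n). A\<^sup>2)"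
    by (intro sum_mono power_mono bound) auto
  also have "\<dots> = (8 * real n + 1) * A\<^sup>2"
  proof -
    have "card (modes (4*n)) = 8 * n + 1" unfolding card_atLeastAtMost_int by linarith
    then show ?thesis unfolding sum_constant by simp
  qed
  also have "\<dots> \<le> 9 * n * A\<^sup>2"
    using n by (intro mult_right_mono) auto
  finally show ?thesis .
qed

lemma l2_diff: "integral {0..1} (\<lambda>x. (cmod ((1 - ek 1 x) * tker (4*n) m x))\<^sup>2) \<le> 10 * A\<^sup>2 / n"
proof -
  have "integral {0..1} (\<lambda>x. (cmod ((1 - ek 1 x) * tker (4*n) m x))\<^sup>2)
     = (\<Sum>k\<in>{-int (4*n)..int (4*n) + 1}. (cmod (m k - m (k - 1)))\<^sup>2)"
  proof (rule integral_unique)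
    have eq: "(1 - ek 1 x) * tker (4*n) m x = (\<Sum>k\<in>{-int (4*n)..int (4*n) + 1}. (m k - m (k - 1)) * ek k x)" for x
      by (rule tker_diff) (simp add: supp)
    show "((\<lambda>x. (cmod ((1 - ek 1 x) * tker (4*n) m x))\<^sup>2) has_integral
        (\<Sum>k\<in>{-int (4*n)..int (4*n) + 1}. (cmod (m k - m (k - 1)))\<^sup>2)) {0..1}"
      unfolding eq by (rule parseval_trig) simp
  qed
  also have "\<dots> \<le> (\<Sum>k\<in>{-int (4*n)..int (4*n) + 1}. (A / n)\<^sup>2)"
    by (intro sum_mono power_mono lip) auto
  also have "\<dots> = (8 * real n + 2) * (A / n)\<^sup>2"
  proof -
    have "card {-int (4*n)..int (4*n) + 1} = 8 * n + 2" unfolding card_atLeastAtMost_int by linarith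
    then show ?thesis unfolding sum_constant by simp
  qed
  also have "\<dots> \<le> (10 * n) * (A / n)\<^sup>2"
    using n by (intro mult_right_mono) auto
  also have "\<dots> = 10 * A\<^sup>2 / n"
    using n by (simp add: power2_eq_square)
  finally show ?thesis .
qed

text \<open>Cauchy-Schwarz against the weight \<open>w\<close>, in the linearised form of a
  completed square. The bound does not depend on \<open>n\<close>, and this is what makes all block
  estimates uniform in the scale.\<close>

lemma l1: "integral {0..1} (\<lambda>x. cmod (tker (4*n) m x)) \<le> 12 * A"
proof -
  let ?K = "tker (4*n) m"
  define w where "w = (\<lambda>x. 1 + (real n)\<^sup>2 * (cmod (1 - ek 1 x))\<^sup>2)"
  \<comment> \<open>Balances the two terms: the weighted square has integral at most
    \<open>19 * n * A\<^sup>2\<close>, and \<open>1 / w\<close> has integral at most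
    \<open>4 / n\<close>.\<close>
  define l where "l = 1 / (n * A)"
  have l: "l > 0" using n A by (simp add: l_def)
  have w: "w x > 0" for x unfolding w_def by (smt (verit) zero_le_power2 mult_nonneg_nonneg)
  have cw: "continuous_on {0..1} w" unfolding w_def by (intro continuous_intros)
  have "integral {0..1} (\<lambda>x. cmod (?K x)) \<le> integral {0..1} (\<lambda>x. l / 2 * ((cmod (?K x))\<^sup>2
     + (real n)\<^sup>2 * (cmod ((1 - ek 1 x) * ?K x))\<^sup>2) + 1 / (2 * l) * (1 / w x))"
  proof (rule integral_le)
    show "(\<lambda>x. cmod (?K x)) integrable_on {0..1}"
      by (intro integrable_continuous_real continuous_intros)
    show "(\<lambda>x. l / 2 * ((cmod (?K x))\<^sup>2
     + (real n)\<^sup>2 * (cmod ((1 - ek 1 x) * ?K x))\<^sup>2) + 1 / (2 * l) * (1 / w x)) integrable_on {0..1}"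
      using w l by (intro integrable_continuous_real continuous_intros cw) (auto simp: less_imp_neq[symmetric])
    fix x :: real
    have "(cmod (?K x))\<^sup>2 + (real n)\<^sup>2 * (cmod ((1 - ek 1 x) * ?K x))\<^sup>2 = w x * (cmod (?K x))\<^sup>2"
      by (simp only: w_def norm_mult power_mult_distrib distrib_right mult_1 mult.assoc)
    moreover have "cmod (?K x) \<le> l / 2 * (w x * (cmod (?K x))\<^sup>2) + 1 / (2 * l) * (1 / w x)"
    proof -
      have "0 \<le> (l * w x * cmod (?K x) - 1)\<^sup>2" by simp
      then have "2 * (l * w x * cmod (?K x)) \<le> (l * w x * cmod (?K x))\<^sup>2 + 1"
        by (simp add: power2_diff)
      then have "2 * (l * w x * cmod (?K x)) / (2 * l * w x) \<le> ((l * w x * cmod (?K x))\<^sup>2 + 1) / (2 * l * w x)"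
        using l w[of x] by (intro divide_right_mono) auto
      then show ?thesis using l w[of x] by (simp add: field_simps power2_eq_square)
    qed
    ultimately show "cmod (?K x) \<le> l / 2 * ((cmod (?K x))\<^sup>2
     + (real n)\<^sup>2 * (cmod ((1 - ek 1 x) * ?K x))\<^sup>2) + 1 / (2 * l) * (1 / w x)"
      by simp
  qed
  also have "\<dots> = l / 2 * (integral {0..1} (\<lambda>x. (cmod (?K x))\<^sup>2)
     + (real n)\<^sup>2 * integral {0..1} (\<lambda>x. (cmod ((1 - ek 1 x) * ?K x))\<^sup>2))
     + 1 / (2 * l) * integral {0..1} (\<lambda>x. 1 / w x)"
    using w
    by (intro integral_unique has_integral_add has_integral_mult_right integrable_integral
        integrable_continuous_real continuous_intros cw) (auto simp: less_imp_neq[symmetric])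
  also have "\<dots> \<le> l / 2 * (9 * n * A\<^sup>2 + (real n)\<^sup>2 * (10 * A\<^sup>2 / n)) + 1 / (2 * l) * (4 / n)"
    using l n l2 l2_diff integral_weight[of n] unfolding w_def
    by (intro add_mono mult_left_mono) auto
  also have "\<dots> = 23 / 2 * A"
    using n A by (simp add: l_def field_simps power2_eq_square)
  also have "\<dots> \<le> 12 * A" using A by simp
  finally show ?thesis .
qed

text \<open>A first-moment estimate: the kernels concentrate at the integers as \<open>n\<close>
  grows, which is what an approximate identity requires.\<close>

lemma l1_diff: "integral {0..1} (\<lambda>x. cmod (1 - ek 1 x) * cmod (tker (4*n) m x)) \<le> 6 * A / sqrt n"
proof -
  let ?K = "tker (4*n) m"
  \<comment> \<open>Balances \<open>10 * A\<^sup>2 / n\<close> from \<open>l2_diff\<close> against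
    the unit length of the interval.\<close>
  define l where "l = sqrt n / A"
  have l: "l > 0" using n A by (simp add: l_def)
  have "integral {0..1} (\<lambda>x. cmod (1 - ek 1 x) * cmod (?K x)) \<le>
     integral {0..1} (\<lambda>x. l / 2 * (cmod ((1 - ek 1 x) * ?K x))\<^sup>2 + 1 / (2 * l))"
  proof (rule integral_le)
    show "(\<lambda>x. cmod (1 - ek 1 x) * cmod (?K x)) integrable_on {0..1}"
      by (intro integrable_continuous_real continuous_intros)
    show "(\<lambda>x. l / 2 * (cmod ((1 - ek 1 x) * ?K x))\<^sup>2 + 1 / (2 * l)) integrable_on {0..1}"
      by (intro integrable_continuous_real continuous_intros)
    fix x :: real
    let ?z = "cmod ((1 - ek 1 x) * ?K x)"
    have "0 \<le> (l * ?z - 1)\<^sup>2" by simp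
    then have "2 * (l * ?z) \<le> (l * ?z)\<^sup>2 + 1" by (simp add: power2_diff)
    then have "2 * (l * ?z) / (2 * l) \<le> ((l * ?z)\<^sup>2 + 1) / (2 * l)"
      using l by (intro divide_right_mono) auto
    then have "?z \<le> l / 2 * ?z\<^sup>2 + 1 / (2 * l)" using l by (simp add: field_simps power2_eq_square)
    then show "cmod (1 - ek 1 x) * cmod (?K x) \<le> l / 2 * (cmod ((1 - ek 1 x) * ?K x))\<^sup>2 + 1 / (2 * l)"
      by (simp add: norm_mult)
  qed
  also have "\<dots> = l / 2 * integral {0..1} (\<lambda>x. (cmod ((1 - ek 1 x) * ?K x))\<^sup>2) + 1 / (2 * l)"
    using has_integral_const_real[of "1 / (2 * l)" 0 1]
    by (intro integral_unique has_integral_add has_integral_mult_right integrable_integral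
        integrable_continuous_real continuous_intros) auto
  also have "\<dots> \<le> l / 2 * (10 * A\<^sup>2 / n) + 1 / (2 * l)"
    using l l2_diff by (intro add_mono mult_left_mono) auto
  also have "\<dots> = 11 / 2 * A / sqrt n"
  proof -
    have "sqrt n > 0" "real n = sqrt n * sqrt n" using n by auto
    then show ?thesis using A by (simp only: l_def) (simp add: field_simps power2_eq_square)
  qed
  also have "\<dots> \<le> 6 * A / sqrt n" using A by (intro divide_right_mono mult_right_mono) auto
  finally show ?thesis .
qed

end

section \<open>Convolution and the multiplier theorem\<close>

lemma periodic_add_int:
  fixes h :: "real \<Rightarrow> 'a"
  assumes "\<And>x. h (x + 1) = h x"
  shows "h (y + real_of_int k) = h y"
proof (induction k rule: int_induct[where k = 0])
  case base
  then show ?case by simp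
next
  case (step1 i)
  then show ?case using assms[of "y + real_of_int i"] by (simp add: algebra_simps)
next
  case (step2 i)
  then show ?case using assms[of "y + real_of_int i - 1"] by (simp add: algebra_simps)
qed

lemma integral_periodic_reflect:
  fixes h :: "real \<Rightarrow> real"
  assumes h: "continuous_on UNIV h" and per: "\<And>x. h (x + 1) = h x"
  shows "integral {0..1} (\<lambda>y. h (x - y)) = integral {0..1} h"
proof -
  have ci: "h integrable_on {a..b}" for a b
    by (intro integrable_continuous_real continuous_on_subset[OF h]) auto
  note per_int = periodic_add_int[of h, OF per]
  have "integral {0..1} (\<lambda>y. h (x - y)) = integral {-1..0} (\<lambda>y. h (x + y))"
    using Henstock_Kurzweil_Integration.integral_reflect_real[where a = "-1" and b = 0 and f = "\<lambda>y. h (x + y)"]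
    by simp
  also have "\<dots> = integral {x - 1..x} h"
    using integral_shift_Icc_real[where a = "-1" and b = 0 and f = h and c = x] by (simp add: algebra_simps o_def)
  also have "\<dots> = integral {0..1} h"
  proof -
    \<comment> \<open>The window from \<open>x - 1\<close> to \<open>x\<close> is cut at the integer
      \<open>k\<close>; its left piece, moved by one period, completes the right piece to a full
      cell.\<close>
    define k where "k = real_of_int \<lfloor>x\<rfloor>"
    have k: "k \<le> x" "x \<le> k + 1" unfolding k_def by linarith+
    have "integral {x - 1..x} h = integral {x - 1..k} h + integral {k..x} h"
      using k ci by (intro Henstock_Kurzweil_Integration.integral_combine[symmetric]) auto
    also have "integral {x - 1..k} h = integral {x - 1..k} (\<lambda>y. h (y + 1))"
      by (simp add: per)
    also have "\<dots> = integral {x..k + 1} h"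
      using integral_shift_Icc_real[where a = "x - 1" and b = k and f = h and c = 1] by (simp add: algebra_simps o_def)
    also have "integral {x..k + 1} h + integral {k..x} h = integral {k..k + 1} h"
      using k ci Henstock_Kurzweil_Integration.integral_combine[of k x "k + 1" h] by auto
    also have "\<dots> = integral {0..1} (\<lambda>y. h (k + y))"
      using integral_shift_Icc_real[where a = 0 and b = 1 and f = h and c = k] by (simp add: algebra_simps o_def)
    also have "\<dots> = integral {0..1} h"
      unfolding k_def by (simp add: add.commute per_int)
    finally show ?thesis .
  qed
  finally show ?thesis .
qed

lemma cfc_conv:
  assumes g: "continuous_on {0..1} g"
  shows "(\<Sum>k\<in>modes L. m k * cfc g k * ek k x) = integral {0..1} (\<lambda>y. g y * tker L m (x - y))"
proof -
  have "integral {0..1} (\<lambda>y. g y * tker L m (x - y)) =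
     integral {0..1} (\<lambda>y. \<Sum>k\<in>modes L. m k * ek k x * (g y * cis (- 2 * pi * real_of_int k * y)))"
  proof (rule integral_cong)
    fix y
    have "ek k (x - y) = ek k x * cis (- 2 * pi * real_of_int k * y)" for k
      by (simp add: cis_mult algebra_simps)
    then show "g y * tker L m (x - y) = (\<Sum>k\<in>modes L. m k * ek k x * (g y * cis (- 2 * pi * real_of_int k * y)))"
      unfolding tker_def sum_distrib_left by (simp add: mult_ac)
  qed
  also have "\<dots> = (\<Sum>k\<in>modes L. integral {0..1} (\<lambda>y. m k * ek k x * (g y * cis (- 2 * pi * real_of_int k * y))))"
    by (intro integral_sum integrable_continuous_real continuous_intros g) auto
  also have "\<dots> = (\<Sum>k\<in>modes L. m k * cfc g k * ek k x)"
    unfolding cfc_def integral_mult_right by (intro sum.cong refl) (simp only: mult_ac)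
  finally show ?thesis ..
qed

text \<open>Young's inequality: the multiplier acts as convolution with \<open>tker\<close>, whose
  integral norm is controlled by \<open>l1\<close>.\<close>

lemma (in kernel) multiplier:
  assumes g: "continuous_on {0..1} g" and G: "\<And>y. y \<in> {0..1} \<Longrightarrow> cmod (g y) \<le> G"
  shows "cmod (\<Sum>k\<in>modes (4*n). m k * cfc g k * ek k x) \<le> 12 * A * G"
proof -
  let ?K = "tker (4*n) m"
  have G0: "G \<ge> 0" using G[of 0] order_trans[OF norm_ge_zero[of "g 0"], of G] by simp
  have cK: "continuous_on S (\<lambda>y. ?K (x - y))" for S
    by (rule continuous_on_compose2[OF continuous_on_tker[of UNIV]]) (auto intro!: continuous_intros)
  have "cmod (integral {0..1} (\<lambda>y. g y * ?K (x - y))) \<le> integral {0..1} (\<lambda>y. G * cmod (?K (x - y)))"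
    by (intro integral_norm_bound_integral integrable_continuous_real continuous_intros g cK)
       (auto simp: norm_mult intro!: mult_right_mono G)
  also have "\<dots> = G * integral {0..1} (\<lambda>y. cmod (?K (x - y)))"
    by simp
  also have "integral {0..1} (\<lambda>y. cmod (?K (x - y))) = integral {0..1} (\<lambda>y. cmod (?K y))"
    by (rule integral_periodic_reflect) (auto intro!: continuous_intros simp: tker_periodic)
  also have "G * \<dots> \<le> G * (12 * A)"
    by (intro mult_left_mono l1 G0)
  finally show ?thesis unfolding cfc_conv[OF g] by (simp add: mult_ac)
qed

text \<open>Symbol of a de la Vallee Poussin kernel: 1 on \<open>modes (2 * n)\<close>, then linear
  with slope \<open>1 / (2 * n)\<close> down to zero at \<open>4 * n\<close>.\<close>

definition trap :: "nat \<Rightarrow> int \<Rightarrow> real" where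
  "trap n k = max 0 (min 1 (2 - \<bar>real_of_int k\<bar> / (2 * real n)))"

lemma trap_bound: "0 \<le> trap n k" "trap n k \<le> 1"
  by (auto simp: trap_def)

lemma trap_one: "n \<ge> 1 \<Longrightarrow> \<bar>k\<bar> \<le> 2 * int n \<Longrightarrow> trap n k = 1"
  unfolding trap_def by (simp add: field_simps)

lemma trap_zero: "n \<ge> 1 \<Longrightarrow> \<bar>k\<bar> > 4 * int n \<Longrightarrow> trap n k = 0"
  unfolding trap_def by (simp add: field_simps)

lemma trap_lip:
  assumes "n \<ge> 1"
  shows "\<bar>trap n k - trap n (k - 1)\<bar> \<le> 1 / n"
proof -
  have "\<bar>\<bar>real_of_int k\<bar> / (2 * real n) - \<bar>real_of_int (k - 1)\<bar> / (2 * real n)\<bar>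
     = \<bar>\<bar>real_of_int k\<bar> - \<bar>real_of_int (k - 1)\<bar>\<bar> / (2 * real n)"
    by (simp add: diff_divide_distrib[symmetric])
  also have "\<dots> \<le> 1 / (2 * real n)" using assms by (intro divide_right_mono) auto
  also have "\<dots> \<le> 1 / n" using assms by (simp add: field_simps)
  finally have "\<bar>\<bar>real_of_int k\<bar> / (2 * real n) - \<bar>real_of_int (k - 1)\<bar> / (2 * real n)\<bar> \<le> 1 / n" .
  moreover have "\<bar>max 0 (min 1 (2 - a)) - max 0 (min 1 (2 - b))\<bar> \<le> \<bar>a - b\<bar>" for a b :: real
    by (simp add: max_def min_def abs_minus_commute)
  ultimately show ?thesis unfolding trap_def by (rule order_trans[rotated])
qed

lemma cfc_trig:
  assumes "finite S"
  shows "cfc (\<lambda>x. \<Sum>k\<in>S. a k * ek k x) l = (if l \<in> S then a l else 0)"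
proof -
  have "((\<lambda>x. \<Sum>k\<in>S. a k * ek (k - l) x) has_integral (\<Sum>k\<in>S. a k * (if k - l = 0 then 1 else 0))) {0..1}"
    by (intro has_integral_sum assms has_integral_mult_right integral_ek)
  moreover have "(\<Sum>k\<in>S. a k * ek (k - l) x) = (\<Sum>k\<in>S. a k * ek k x) * cis (- 2 * pi * real_of_int l * x)" for x
    unfolding sum_distrib_right by (intro sum.cong refl) (simp add: cis_mult algebra_simps)
  moreover have "(\<Sum>k\<in>S. a k * (if k - l = 0 then 1 else 0)) = (if l \<in> S then a l else 0)"
    using assms by (simp add: if_distrib[of "\<lambda>x. _ * x"] sum.delta cong: if_cong)
  ultimately show ?thesis unfolding cfc_def by (intro integral_unique) simp
qed

text \<open>Cutting \<open>\<mu>\<close> off by \<open>trap n\<close> does not change its action on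
  polynomials of degree \<open>2 * n\<close> and puts it into the scope of \<open>kernel\<close>.
  The product rule for differences doubles the constant, whence
  \<open>24 * A = 12 * (2 * A)\<close>.\<close>

lemma trig_multiplier:
  fixes a \<mu> :: tdist and n :: nat
  assumes n: "n \<ge> 1" and A: "A > 0"
    and b: "\<And>k. cmod (\<mu> k) \<le> A" and l: "\<And>k. cmod (\<mu> k - \<mu> (k - 1)) \<le> A / n"
    and F: "\<And>x. x \<in> {0..1} \<Longrightarrow> cmod (\<Sum>k\<in>modes (2*n). a k * ek k x) \<le> G"
  shows "cmod (\<Sum>k\<in>modes (2*n). \<mu> k * a k * ek k x) \<le> 24 * A * G"
proof -
  define m where "m = (\<lambda>k. complex_of_real (trap n k) * \<mu> k)"
  interpret kernel n m "2 * A"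
  proof
    fix k :: int
    have "\<bar>trap n k\<bar> \<le> 1" using trap_bound[of n k] by simp
    then have "cmod (m k) \<le> 1 * A"
      unfolding m_def norm_mult norm_of_real by (rule mult_mono[OF _ b]) simp_all
    then show "cmod (m k) \<le> 2 * A" using A by simp
    have "m k - m (k - 1) = complex_of_real (trap n k) * (\<mu> k - \<mu> (k - 1)) + complex_of_real (trap n k - trap n (k - 1)) * \<mu> (k - 1)"
      by (simp add: m_def algebra_simps)
    also have "cmod \<dots> \<le> 1 * (A / n) + 1 / n * A"
    proof (rule norm_triangle_mono)
      have "\<bar>trap n k\<bar> \<le> 1" using trap_bound[of n k] by simp
      then show "cmod (complex_of_real (trap n k) * (\<mu> k - \<mu> (k - 1))) \<le> 1 * (A / n)"
        unfolding norm_mult norm_of_real by (rule mult_mono[OF _ l]) simp_all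
      show "cmod (complex_of_real (trap n k - trap n (k - 1)) * \<mu> (k - 1)) \<le> 1 / n * A"
        unfolding norm_mult norm_of_real by (rule mult_mono[OF trap_lip[OF n] b]) simp_all
    qed
    finally show "cmod (m k - m (k - 1)) \<le> 2 * A / n" by simp
  qed (use n A in \<open>auto simp: m_def trap_zero\<close>)
  define g where "g = (\<lambda>x. \<Sum>k\<in>modes (2*n). a k * ek k x)"
  have "cmod (\<Sum>k\<in>modes (4*n). m k * cfc g k * ek k x) \<le> 12 * (2 * A) * G"
    by (rule multiplier) (use F in \<open>auto simp: g_def intro!: continuous_intros\<close>)
  also have "(\<Sum>k\<in>modes (4*n). m k * cfc g k * ek k x)
     = (\<Sum>k\<in>modes (2*n). \<mu> k * a k * ek k x)"
    unfolding g_def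
  proof (rule sum.mono_neutral_cong_right)
    fix k assume k: "k \<in> modes (2*n)"
    then have "trap n k = 1" by (intro trap_one n) auto
    with k show "m k * cfc (\<lambda>x. \<Sum>k\<in>modes (2*n). a k * ek k x) k * ek k x = \<mu> k * a k * ek k x"
      by (simp only: cfc_trig[OF finite_atLeastAtMost_int]) (simp add: m_def)
  next
    show "\<forall>i\<in>modes (4*n) - modes (2*n). m i * cfc (\<lambda>x. \<Sum>k\<in>modes (2*n). a k * ek k x) i * ek i x = 0"
      unfolding cfc_trig[OF finite_atLeastAtMost_int] by auto
  qed auto
  finally show ?thesis by simp
qed

section \<open>Uniqueness of Fourier coefficients\<close>

text \<open>Turns continuity at \<open>x\<close> into a form that \<open>l1\<close> and
  \<open>l1_diff\<close> can integrate. Within distance \<open>d\<close> of the integers continuity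
  gives \<open>e\<close>; elsewhere \<open>cmod (1 - ek 1 y) \<ge> d\<close>, and the slope
  \<open>2 * B / d\<close> already covers the largest possible oscillation
  \<open>2 * B\<close>.\<close>

lemma cmod_one_minus_ek_dist:
  assumes h: "continuous_on UNIV (h :: real \<Rightarrow> real)" and per: "\<And>x. h (x + 1) = h x" and e: "e > 0"
  shows "\<exists>M\<ge>0. \<forall>y. \<bar>h (x - y) - h x\<bar> \<le> e + M * cmod (1 - ek 1 y)"
proof -
  note per_int = periodic_add_int[of h, OF per]
  have "bounded (h ` {0..1})"
    by (intro compact_imp_bounded compact_continuous_image continuous_on_subset[OF h]) auto
  then obtain B where B: "\<And>y. y \<in> {0..1} \<Longrightarrow> \<bar>h y\<bar> \<le> B" unfolding bounded_iff by force
  have B': "\<bar>h y\<bar> \<le> B" for y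
    using B[of "frac y"] per_int[of "frac y" "\<lfloor>y\<rfloor>"] frac_lt_1[of y] by (simp add: frac_def)
  have "isCont h x" using h by (simp add: continuous_on_eq_continuous_at)
  then obtain d where d: "d > 0" "\<And>y. \<bar>y - x\<bar> < d \<Longrightarrow> \<bar>h y - h x\<bar> < e"
    unfolding continuous_at_eps_delta using e by (auto simp: dist_real_def)
  show ?thesis
  proof (intro exI[of _ "2 * B / d"] conjI allI)
    show "0 \<le> 2 * B / d" using B'[of 0] d by auto
    fix y0 :: real
    define y where "y = frac y0"
    have y: "0 \<le> y" "y \<le> 1" using frac_lt_1[of y0] by (auto simp: y_def)
    have hy: "h (x - y0) = h (x - y)"
      using per_int[of "x - y0" "\<lfloor>y0\<rfloor>"] by (simp add: y_def frac_def algebra_simps)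
    have ey: "ek 1 y0 = ek 1 y"
    proof -
      have "y0 = y + real_of_int \<lfloor>y0\<rfloor>" by (simp add: y_def frac_def)
      then have "ek 1 y0 = ek 1 y * ek 1 (real_of_int \<lfloor>y0\<rfloor>)" by (metis ek_add)
      then show ?thesis using cis_2pi_int[of "\<lfloor>y0\<rfloor>"] by simp
    qed
    have key: "\<bar>h (x - y) - h x\<bar> \<le> e + 2 * B / d * c" if "c \<ge> 0" "c < d \<longrightarrow> \<bar>h (x - y) - h x\<bar> < e" for c
    proof (cases "c < d")
      case True
      then show ?thesis using that B'[of 0] d by (smt (verit) divide_nonneg_nonneg mult_nonneg_nonneg)
    next
      case False
      then have "2 * B \<le> 2 * B / d * c" using d B'[of 0] by (simp add: field_simps mult_left_mono)
      then show ?thesis using B'[of x] B'[of "x - y"] e by linarith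
    qed
    have "\<bar>h (x - y) - h x\<bar> \<le> e + 2 * B / d * cmod (1 - ek 1 y)"
    proof (rule key)
      show "cmod (1 - ek 1 y) < d \<longrightarrow> \<bar>h (x - y) - h x\<bar> < e"
      proof
        assume c: "cmod (1 - ek 1 y) < d"
        show "\<bar>h (x - y) - h x\<bar> < e"
        proof (cases "y \<le> 1/2")
          case True
          then show ?thesis using norm_one_minus_ek_ge[of y] y c d(2)[of "x - y"] by auto
        next
          case False
          then show ?thesis using norm_one_minus_ek_ge'[of y] y c d(2)[of "x - y + 1"] per[of "x - y"] by auto
        qed
      qed
    qed simp
    then show "\<bar>h (x - y0) - h x\<bar> \<le> e + 2 * B / d * cmod (1 - ek 1 y0)" by (simp only: hy ey)
  qed
qed

text \<open>The kernels with symbol \<open>trap n\<close> form an approximate identity.\<close>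

lemma fc_eq_0_imp:
  assumes h: "continuous_on UNIV h" and per: "\<And>x. h (x + 1) = h x" and z: "fc h = (\<lambda>_. 0)"
  shows "h x = 0"
proof -
  have "\<bar>h x\<bar> \<le> e" if e: "e > 0" for e
  proof -
    \<comment> \<open>\<open>l1\<close> bounds the kernel mass by 12, so \<open>e / 24\<close>
      contributes \<open>e / 2\<close>; the scale \<open>n\<close> is then taken so large that the
      first moment contributes the other half.\<close>
    obtain M where M: "M \<ge> 0" "\<And>y. \<bar>h (x - y) - h x\<bar> \<le> e / 24 + M * cmod (1 - ek 1 y)"
      using cmod_one_minus_ek_dist[OF h per, of "e / 24" x] e by auto
    obtain n :: nat where nn: "n \<ge> 1" "6 * M / sqrt n \<le> e / 2"
    proof -
      obtain n :: nat where n: "real n > (12 * M / e)\<^sup>2 + 1" using reals_Archimedean2 by blast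
      have "12 * M / e \<le> sqrt n"
        using n by (intro real_le_rsqrt) linarith
      moreover have "real n \<ge> 1" using n by (smt (verit) zero_le_power2)
      moreover from this have "sqrt n > 0" by simp
      ultimately show ?thesis using e that[of n] by (auto simp: field_simps)
    qed
    define m where "m = (\<lambda>k. complex_of_real (trap n k))"
    interpret kernel n m 1
      using nn trap_bound trap_lip by unfold_locales (auto simp: m_def trap_zero of_real_diff[symmetric] simp del: of_real_diff)
    let ?K = "tker (4*n) m"
    have hc: "continuous_on S (\<lambda>y. h (x - y))" for S
      by (rule continuous_on_compose2[OF h]) (auto intro!: continuous_intros)
    have cK: "continuous_on S (\<lambda>y. ?K (x - y))" for S
      by (rule continuous_on_compose2[OF continuous_on_tker[of UNIV]]) (auto intro!: continuous_intros)
    have i0: "integral {0..1} (\<lambda>y. complex_of_real (h y) * ?K (x - y)) = 0"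
    proof -
      have "continuous_on {0..1} (\<lambda>y. complex_of_real (h y))"
        by (intro continuous_intros continuous_on_subset[OF h]) auto
      from cfc_conv[OF this, where L = "4*n" and m = m and x = x] show ?thesis
        using z by (simp add: fc_cfc)
    qed
    \<comment> \<open>The kernel has integral one since \<open>trap n 0 = 1\<close>, so
      \<open>h x\<close> may be written under the integral; by \<open>i0\<close> subtracting
      \<open>h y\<close> there changes nothing.\<close>
    have "cmod (of_real (h x)) = cmod (integral {0..1} (\<lambda>y. complex_of_real (h x - h y) * ?K (x - y)))"
    proof -
      have 1: "integral {0..1} (\<lambda>y. ?K (x - y)) = 1"
      proof -
        have c1: "cfc (\<lambda>_. 1) k = (if k = 0 then 1 else 0)" for k
          using cfc_trig[of "{0}" "\<lambda>_. 1" k] by simp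
        have "integral {0..1} (\<lambda>y. ?K (x - y)) = (\<Sum>k\<in>modes (4*n). m k * cfc (\<lambda>_. 1) k * ek k x)"
          using cfc_conv[where g = "\<lambda>_. 1" and L = "4*n" and m = m and x = x] by simp
        also have "\<dots> = (\<Sum>k\<in>modes (4*n). if k = 0 then m 0 else 0)"
          by (intro sum.cong refl) (simp add: c1)
        finally have "integral {0..1} (\<lambda>y. ?K (x - y)) = (\<Sum>k\<in>modes (4*n). if k = 0 then m 0 else 0)" .
        then show ?thesis using n by (simp add: m_def trap_one)
      qed
      have "integral {0..1} (\<lambda>y. complex_of_real (h x - h y) * ?K (x - y))
         = integral {0..1} (\<lambda>y. complex_of_real (h x) * ?K (x - y) - complex_of_real (h y) * ?K (x - y))"
        by (simp add: algebra_simps)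
      also have "\<dots> = integral {0..1} (\<lambda>y. complex_of_real (h x) * ?K (x - y)) - integral {0..1} (\<lambda>y. complex_of_real (h y) * ?K (x - y))"
        by (intro Henstock_Kurzweil_Integration.integral_diff integrable_continuous_real continuous_intros cK continuous_on_subset[OF h]) auto
      also have "\<dots> = of_real (h x)" using 1 i0 by simp
      finally show ?thesis by simp
    qed
    also have "\<dots> \<le> integral {0..1} (\<lambda>y. \<bar>h y - h x\<bar> * cmod (?K (x - y)))"
      by (intro integral_norm_bound_integral integrable_continuous_real continuous_intros cK continuous_on_subset[OF h])
         (auto simp: norm_mult abs_minus_commute simp flip: of_real_diff)
    also have "\<dots> = integral {0..1} (\<lambda>y. (\<lambda>y. \<bar>h (x - y) - h x\<bar> * cmod (?K y)) (x - y))"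
      by simp
    also have "\<dots> = integral {0..1} (\<lambda>y. \<bar>h (x - y) - h x\<bar> * cmod (?K y))"
      by (rule integral_periodic_reflect)
         (use per[of "x - _ - 1"] in \<open>auto intro!: continuous_intros hc simp: tker_periodic algebra_simps\<close>)
    also have "\<dots> \<le> integral {0..1} (\<lambda>y. e / 24 * cmod (?K y) + M * (cmod (1 - ek 1 y) * cmod (?K y)))"
    proof (intro integral_le integrable_continuous_real continuous_intros hc)
      fix y
      show "\<bar>h (x - y) - h x\<bar> * cmod (?K y) \<le> e / 24 * cmod (?K y) + M * (cmod (1 - ek 1 y) * cmod (?K y))"
        using mult_right_mono[OF M(2)[of y], of "cmod (?K y)"] by (simp add: algebra_simps)
    qed
    also have "\<dots> = e / 24 * integral {0..1} (\<lambda>y. cmod (?K y)) + M * integral {0..1} (\<lambda>y. cmod (1 - ek 1 y) * cmod (?K y))"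
      by (intro integral_unique has_integral_add has_integral_mult_right integrable_integral
        integrable_continuous_real continuous_intros)
    also have "\<dots> \<le> e / 24 * (12 * 1) + M * (6 * 1 / sqrt n)"
      using e M l1 l1_diff by (intro add_mono mult_left_mono) auto
    also have "\<dots> = e / 2 + 6 * M / sqrt n" by simp
    also have "\<dots> \<le> e" using nn(2) by linarith
    finally show ?thesis by simp
  qed
  then have "\<bar>h x\<bar> \<le> 0" by (rule field_le_epsilon[of _ 0, simplified])
  then show ?thesis by simp
qed

section \<open>Littlewood-Paley blocks\<close>

text \<open>The derivative is bounded on the compact interval from -3 to 3. Clamping the argument to
  it is 1-Lipschitz and does not alter \<open>f\<close>, which makes the local Lipschitz bound
  global.\<close>

lemma smooth_compact_lipschitz:
  assumes f: "smooth_real f" and supp: "\<And>x. f x \<noteq> 0 \<Longrightarrow> \<bar>x\<bar> < 3"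
  shows "\<exists>B>0. (\<forall>x. \<bar>f x\<bar> \<le> B) \<and> (\<forall>x y. \<bar>f x - f y\<bar> \<le> B * \<bar>x - y\<bar>)"
proof -
  obtain D where D0: "D 0 = f" and D: "\<And>n x. (D n has_real_derivative D (Suc n) x) (at x)"
    using f unfolding smooth_real_def by blast
  have "continuous_on {-3..3} (D 1)"
    by (meson D DERIV_isCont continuous_at_imp_continuous_on)
  then have "bounded (D 1 ` {-3..3})"
    by (intro compact_imp_bounded compact_continuous_image) auto
  then obtain B where B: "\<And>x. x \<in> {-3..3} \<Longrightarrow> \<bar>D 1 x\<bar> \<le> B" unfolding bounded_iff by force
  have B0: "B \<ge> 0" using B[of 0] by auto
  have lip1: "\<bar>f x - f y\<bar> \<le> B * \<bar>x - y\<bar>" if "x \<in> {-3..3}" "y \<in> {-3..3}" for x y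
  proof -
    have "norm (f x - f y) \<le> B * norm (x - y)"
    proof (rule field_differentiable_bound[of "{-3..3}" f "D 1"])
      fix z :: real assume "z \<in> {-3..3}"
      show "(f has_field_derivative D 1 z) (at z within {-3..3})"
        using D[of 0 z] by (simp add: D0 has_field_derivative_at_within)
      show "norm (D 1 z) \<le> B" using B \<open>z \<in> _\<close> by simp
    qed (use that in auto)
    then show ?thesis by simp
  qed
  define cl where "cl = (\<lambda>x::real. max (-3) (min 3 x))"
  have cl: "cl x \<in> {-3..3}" "f (cl x) = f x" for x
  proof -
    show "cl x \<in> {-3..3}" by (simp add: cl_def)
    show "f (cl x) = f x"
    proof (cases "\<bar>x\<bar> < 3")
      case True then show ?thesis by (simp add: cl_def)
    next
      case False
      then have "\<bar>cl x\<bar> = 3" by (auto simp: cl_def)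
      then show ?thesis using supp[of x] supp[of "cl x"] False by linarith
    qed
  qed
  have cl_lip: "\<bar>cl x - cl y\<bar> \<le> \<bar>x - y\<bar>" for x y
  proof -
    have 1: "\<bar>max c p - max c q\<bar> \<le> \<bar>p - q\<bar>" for c p q :: real by (simp add: max_def)
    have 2: "\<bar>min c p - min c q\<bar> \<le> \<bar>p - q\<bar>" for c p q :: real by (simp add: min_def)
    show ?thesis unfolding cl_def using 1 2 by (rule order_trans)
  qed
  have lip: "\<bar>f x - f y\<bar> \<le> B * \<bar>x - y\<bar>" for x y
    using lip1[OF cl(1)[of x] cl(1)[of y]] mult_left_mono[OF cl_lip[of x y] B0] by (simp add: cl(2))
  have bd: "\<bar>f x\<bar> \<le> 6 * B" for x
  proof -
    have "f 3 = 0" using supp[of 3] by auto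
    then have "\<bar>f x\<bar> \<le> B * \<bar>cl x - 3\<bar>" using lip[of "cl x" 3] by (simp add: cl(2))
    also have "\<dots> \<le> B * 6" using cl(1)[of x] B0 by (intro mult_left_mono) auto
    finally show ?thesis by (simp add: mult.commute)
  qed
  \<comment> \<open>A clamped point is at distance at most 6 from the zero 3 of \<open>f\<close>,
    whence \<open>6 * B\<close>; the added 1 ensures positivity.\<close>
  show ?thesis
  proof (intro exI[of _ "6 * B + 1"] conjI allI)
    fix x y
    have "B * \<bar>x - y\<bar> \<le> (6 * B + 1) * \<bar>x - y\<bar>" using B0 by (intro mult_right_mono) auto
    then show "\<bar>f x - f y\<bar> \<le> (6 * B + 1) * \<bar>x - y\<bar>" using lip[of x y] by linarith
    show "\<bar>f x\<bar> \<le> 6 * B + 1" using bd[of x] by linarith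
  qed (use B0 in auto)
qed

text \<open>\<open>Lw\<close> plays the part of \<open>A\<close> in \<open>kernel\<close> when the
  weight of block \<open>j\<close> is itself taken as a symbol at scale
  \<open>2 ^ j\<close>.\<close>

locale lp =
  fixes \<rho>0 \<rho> :: "real \<Rightarrow> real" and Lw :: real
  assumes part: "dyadic_partition \<rho>0 \<rho>"
    and Lw: "Lw > 0"
    and w_bound: "\<And>j k. \<bar>lp_w \<rho>0 \<rho> j k\<bar> \<le> Lw"
    and w_lip: "\<And>j k. \<bar>lp_w \<rho>0 \<rho> j k - lp_w \<rho>0 \<rho> j (k - 1)\<bar> \<le> Lw / 2 ^ j"

lemma lp_exists:
  assumes "dyadic_partition \<rho>0 \<rho>"
  shows "\<exists>Lw. lp \<rho>0 \<rho> Lw"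
proof -
  have s: "smooth_real \<rho>0" "smooth_real \<rho>" "\<And>x. \<rho>0 x \<noteq> 0 \<Longrightarrow> \<bar>x\<bar> \<le> 4/3" "\<And>x. \<rho> x \<noteq> 0 \<Longrightarrow> \<bar>x\<bar> \<le> 8/3"
    using assms unfolding dyadic_partition_def by blast+
  have s3: "\<bar>x\<bar> < 3" if "\<rho>0 x \<noteq> 0" for x using s(3)[OF that] by simp
  have s3': "\<bar>x\<bar> < 3" if "\<rho> x \<noteq> 0" for x using s(4)[OF that] by simp
  obtain B0 where B0: "B0 > 0" "\<And>x. \<bar>\<rho>0 x\<bar> \<le> B0" "\<And>x y. \<bar>\<rho>0 x - \<rho>0 y\<bar> \<le> B0 * \<bar>x - y\<bar>"
    using smooth_compact_lipschitz[OF s(1) s3] by blast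
  obtain B1 where B1: "B1 > 0" "\<And>x. \<bar>\<rho> x\<bar> \<le> B1" "\<And>x y. \<bar>\<rho> x - \<rho> y\<bar> \<le> B1 * \<bar>x - y\<bar>"
    using smooth_compact_lipschitz[OF s(2) s3'] by blast
  \<comment> \<open>The factor 2 arises because block \<open>j\<close> rescales by
    \<open>2 ^ (j - 1)\<close>, while the Lipschitz bound is measured against
    \<open>2 ^ j\<close>.\<close>
  have "lp \<rho>0 \<rho> (B0 + 2 * B1)"
  proof
    fix j k
    show "\<bar>lp_w \<rho>0 \<rho> j k\<bar> \<le> B0 + 2 * B1"
      using B0(1) B0(2)[of k] B1(1) B1(2)[of "k / 2 ^ (j - 1)"] by (simp add: lp_w_def)
    show "\<bar>lp_w \<rho>0 \<rho> j k - lp_w \<rho>0 \<rho> j (k - 1)\<bar> \<le> (B0 + 2 * B1) / 2 ^ j"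
    proof (cases j)
      case 0
      then show ?thesis using B0(3)[of k "real_of_int (k - 1)"] B1(1) by (simp add: lp_w_def)
    next
      case (Suc i)
      have "\<bar>\<rho> (k / 2 ^ i) - \<rho> (real_of_int (k - 1) / 2 ^ i)\<bar> \<le> B1 * \<bar>k / 2 ^ i - real_of_int (k - 1) / 2 ^ i\<bar>"
        by (rule B1(3))
      also have "\<dots> = 2 * B1 / 2 ^ j"
        by (simp add: diff_divide_distrib[symmetric] Suc)
      also have "\<dots> \<le> (B0 + 2 * B1) / 2 ^ j"
        using B0(1) by (intro divide_right_mono) auto
      finally show ?thesis by (simp add: lp_w_def Suc)
    qed
  qed (use assms B0 B1 in auto)
  then show ?thesis ..
qed

section \<open>Size and variation of the Gaussian symbol\<close>

text \<open>The first bound serves the Gaussian, the second its derivative; both must have the same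
  power for the multiplier theorem to apply with a single constant.\<close>

lemma exp_minus_le_powr:
  fixes y p :: real
  assumes "y > 0" "0 \<le> p" "p \<le> 1"
  shows "exp (- y) \<le> y powr (- p)" "y * exp (- y) \<le> 2 * y powr (- p)"
proof -
  have "exp (- y) \<le> y powr (- p) \<and> y * exp (- y) \<le> 2 * y powr (- p)"
  proof (cases "y \<le> 1")
    case True
    have 1: "1 \<le> y powr (- p)"
      using powr_mono'[of "- p" 0 y] assms True by simp
    have "y * exp (- y) \<le> 1 * 1" using True assms by (intro mult_mono) auto
    then show ?thesis using 1 assms order_trans[of "exp (- y)" 1 "y powr (- p)"] by auto
  next
    case False
    have 1: "1 / y \<le> y powr (- p)"
      using powr_mono[of "- 1" "- p" y] assms False by (simp add: powr_minus divide_inverse)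
    have q: "1 + y + y\<^sup>2 / 2 \<le> exp y" using exp_lower_Taylor_quadratic[of y] assms by simp
    have "y \<le> exp y" "y\<^sup>2 \<le> 2 * exp y" using q assms zero_le_power2[of y] by linarith+
    then have "exp (- y) \<le> 1 / y" "y * exp (- y) \<le> 2 / y"
      using assms by (simp_all add: exp_minus field_simps power2_eq_square)
    then show ?thesis using 1 by auto
  qed
  then show "exp (- y) \<le> y powr (- p)" "y * exp (- y) \<le> 2 * y powr (- p)" by auto
qed

abbreviation "gauss t x \<equiv> exp (- 4 * pi\<^sup>2 * x\<^sup>2 * t)"

lemma gauss_bound:
  fixes t a x p :: real
  assumes "t > 0" "a > 0" "0 \<le> p" "p \<le> 1" "a \<le> x"
  shows "gauss t x \<le> (4 * pi\<^sup>2 * a\<^sup>2 * t) powr (- p)"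
proof -
  have "exp (- (4 * pi\<^sup>2 * x\<^sup>2 * t)) \<le> exp (- (4 * pi\<^sup>2 * a\<^sup>2 * t))"
    using assms by (auto intro!: mult_right_mono mult_left_mono power_mono)
  also have "\<dots> \<le> (4 * pi\<^sup>2 * a\<^sup>2 * t) powr (- p)"
    using assms by (intro exp_minus_le_powr) auto
  finally show ?thesis by simp
qed

text \<open>In modulus the derivative is \<open>2 / z * (w * exp (- w))\<close> with
  \<open>w = 4 * pi\<^sup>2 * z\<^sup>2 * t\<close>. The gained factor \<open>1 / a\<close>, for
  \<open>a\<close> of order \<open>2 ^ j\<close>, is exactly the slow variation that
  \<open>kernel\<close> demands.\<close>

lemma gauss_lipschitz:
  fixes t a x y p :: real
  assumes t: "t > 0" and a: "a > 0" and p: "0 \<le> p" "p \<le> 1" and xy: "a \<le> x" "a \<le> y"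
  shows "\<bar>gauss t x - gauss t y\<bar>
     \<le> 4 / a * (4 * pi\<^sup>2 * a\<^sup>2 * t) powr (- p) * \<bar>x - y\<bar>"
proof -
  have "norm (gauss t x - gauss t y)
     \<le> (4 / a * (4 * pi\<^sup>2 * a\<^sup>2 * t) powr (- p)) * norm (x - y)"
  proof (rule field_differentiable_bound[of "{a..}" _ "\<lambda>z. - (8 * pi\<^sup>2 * z * t) * gauss t z"])
    fix z :: real assume "z \<in> {a..}"
    then have z: "a \<le> z" by simp
    show "((\<lambda>x. gauss t x) has_field_derivative - (8 * pi\<^sup>2 * z * t) * gauss t z) (at z within {a..})"
      by (auto intro!: derivative_eq_intros)
    define w where "w = 4 * pi\<^sup>2 * z\<^sup>2 * t"
    have w: "w > 0" using t a z by (simp add: w_def)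
    have "norm (- (8 * pi\<^sup>2 * z * t) * gauss t z) = 2 / z * (w * exp (- w))"
      using t a z by (simp add: w_def abs_mult power2_eq_square)
    also have "\<dots> \<le> 2 / a * (2 * w powr (- p))"
      using a z w p by (intro mult_mono exp_minus_le_powr divide_left_mono) auto
    also have "\<dots> \<le> 2 / a * (2 * (4 * pi\<^sup>2 * a\<^sup>2 * t) powr (- p))"
    proof -
      have "4 * pi\<^sup>2 * a\<^sup>2 * t \<le> w" unfolding w_def using a z t
        by (auto intro!: mult_right_mono mult_left_mono power_mono)
      then have "w powr (- p) \<le> (4 * pi\<^sup>2 * a\<^sup>2 * t) powr (- p)"
        using p t a by (intro powr_mono2') auto
      then show ?thesis using a by (intro mult_left_mono) auto
    qed
    finally show "norm (- (8 * pi\<^sup>2 * z * t) * gauss t z) \<le> 4 / a * (4 * pi\<^sup>2 * a\<^sup>2 * t) powr (- p)"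
      by simp
  qed (use xy in auto)
  then show ?thesis by simp
qed

lemma max_abs_lipschitz: "\<bar>max \<bar>x\<bar> a - max \<bar>y\<bar> a\<bar> \<le> \<bar>x - y\<bar>" for x y a :: real
proof -
  have "\<bar>max p a - max q a\<bar> \<le> \<bar>p - q\<bar>" for p q :: real by (simp add: max_def)
  from this[of "\<bar>x\<bar>" "\<bar>y\<bar>"] show ?thesis using abs_triangle_ineq3[of x y] by (rule order_trans)
qed

definition dx :: "tdist \<Rightarrow> tdist" where
  "dx f = (\<lambda>k. 2 * pi * \<i> * of_int k * f k)"

section \<open>Estimates on single blocks\<close>

context lp
begin

abbreviation "W \<equiv> lp_w \<rho>0 \<rho>"
abbreviation "Wc j k \<equiv> complex_of_real (W j k)"
abbreviation "blk \<equiv> lp_block \<rho>0 \<rho>"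

lemma W_upper_real:
  assumes w: "W j k \<noteq> 0"
  shows "\<bar>real_of_int k\<bar> \<le> 2 ^ (j + 1)"
proof (cases j)
  case 0
  then show ?thesis using part w unfolding dyadic_partition_def lp_w_def by fastforce
next
  case (Suc i)
  have "\<bar>k / 2 ^ i\<bar> \<le> 8 / 3" using part w unfolding dyadic_partition_def lp_w_def Suc by auto
  then have "\<bar>real_of_int k\<bar> \<le> 8 / 3 * 2 ^ i" by (simp add: field_simps)
  also have "\<dots> \<le> 2 ^ (j + 1)" by (simp add: Suc)
  finally show ?thesis .
qed

lemma W_upper:
  assumes "W j k \<noteq> 0"
  shows "\<bar>k\<bar> \<le> 2 ^ (j + 1)"
proof -
  have "real_of_int \<bar>k\<bar> \<le> real_of_int (2 ^ (j + 1))" using W_upper_real[OF assms] by simp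
  then show ?thesis unfolding of_int_le_iff .
qed

text \<open>For \<open>j = 0\<close> the bound merely says that a nonzero integer has modulus at
  least \<open>3 / 8\<close>; block 0 is the only one that can see the zero mode.\<close>

lemma W_lower: "W j k \<noteq> 0 \<Longrightarrow> (j = 0 \<and> k = 0) \<or> 3 / 8 * 2 ^ j \<le> \<bar>real_of_int k\<bar>"
proof -
  assume w: "W j k \<noteq> 0"
  show ?thesis
  proof (cases j)
    case 0
    then show ?thesis by auto
  next
    case (Suc i)
    have "3 / 4 \<le> \<bar>k / 2 ^ i\<bar>" using part w unfolding dyadic_partition_def lp_w_def Suc by auto
    then show ?thesis by (simp add: field_simps Suc)
  qed
qed

lemma W_sums: "(\<lambda>j. W j k) sums 1"
proof -
  obtain n :: nat where n: "2 * \<bar>real_of_int k\<bar> < real n" using reals_Archimedean2 by blast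
  \<comment> \<open>Convergence has to be established: the identity in
    \<open>dyadic_partition\<close> is about a \<open>suminf\<close>, which by itself carries no
    summability.\<close>
  have fin: "finite {i::nat. \<rho> (k / 2 ^ i) \<noteq> 0}"
  proof (rule finite_subset)
    show "{i::nat. \<rho> (k / 2 ^ i) \<noteq> 0} \<subseteq> {..n}"
    proof
      fix i assume "i \<in> {i::nat. \<rho> (k / 2 ^ i) \<noteq> 0}"
      then have "3 / 4 \<le> \<bar>k / 2 ^ i\<bar>" using part unfolding dyadic_partition_def by auto
      then have "3 / 4 * 2 ^ i \<le> \<bar>real_of_int k\<bar>" by (simp add: field_simps)
      moreover have "real i < 2 ^ i" by (rule of_nat_less_two_power)
      ultimately have "real i \<le> real n" using n by linarith
      then show "i \<in> {..n}" by simp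
    qed
  qed simp
  have "(\<lambda>i. \<rho> (k / 2 ^ i)) sums (\<Sum>i. \<rho> (k / 2 ^ i))"
    by (rule summable_sums[OF summable_finite[OF fin]]) auto
  then have "(\<lambda>i. W (Suc i) k) sums (1 - W 0 k)"
  proof -
    have "\<rho>0 k + (\<Sum>i. \<rho> (k / 2 ^ i)) = 1" using part unfolding dyadic_partition_def by blast
    then have "(\<Sum>i. \<rho> (k / 2 ^ i)) = 1 - W 0 k" by (simp add: lp_w_def)
    then show ?thesis using \<open>(\<lambda>i. \<rho> (k / 2 ^ i)) sums _\<close> by (simp add: lp_w_def)
  qed
  then show ?thesis using sums_Suc_iff[of "\<lambda>j. W j k" "1 - W 0 k"] by simp
qed

lemma blk_eq: "blk j f x = (\<Sum>k\<in>modes (2 * 2 ^ j). Wc j k * f k * ek k x)"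
  by (simp add: lp_block_def)

lemma blk_periodic: "blk j f (x + 1) = blk j f x"
  unfolding blk_eq ek_periodic ..

lemma continuous_on_blk [continuous_intros]: "continuous_on S (blk j f)"
  unfolding blk_eq by (intro continuous_intros)

lemma blk_frac: "blk j f (frac x) = blk j f x"
  using periodic_add_int[of "blk j f" "frac x" "\<lfloor>x\<rfloor>", OF blk_periodic] by (simp add: frac_def)

text \<open>The symbol has to be the true one only where the weight is nonzero. Off the dyadic
  annulus it may be flattened or clamped, which is how the global hypotheses on \<open>\<mu>\<close>
  are met below.\<close>

lemma blk_mult:
  assumes A: "A > 0" and b: "\<And>k. cmod (\<mu> k) \<le> A" and l: "\<And>k. cmod (\<mu> k - \<mu> (k - 1)) \<le> A / 2 ^ j"
    and eq: "\<And>k. W j k \<noteq> 0 \<Longrightarrow> g k = \<mu> k * f k"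
    and G: "\<And>x. cmod (blk j f x) \<le> G"
  shows "cmod (blk j g x) \<le> 24 * A * G"
proof -
  have "cmod (\<Sum>k\<in>modes (2 * 2 ^ j). \<mu> k * (Wc j k * f k) * ek k x) \<le> 24 * A * G"
    by (rule trig_multiplier) (use A b l G in \<open>auto simp: blk_eq\<close>)
  also have "(\<Sum>k\<in>modes (2 * 2 ^ j). \<mu> k * (Wc j k * f k) * ek k x) = blk j g x"
    unfolding blk_eq
  proof (rule sum.cong[OF refl])
    fix k
    show "\<mu> k * (Wc j k * f k) * ek k x = Wc j k * g k * ek k x"
      using eq[of k] by (cases "W j k = 0") auto
  qed
  finally show ?thesis .
qed

text \<open>Gaussian decay at frequency \<open>2 ^ j\<close>. Block 0 contains the undamped zero
  mode; it is covered because \<open>t \<le> 1\<close> makes the power on the right at least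
  one.\<close>

lemma blk_heat:
  assumes t: "0 < t" "t \<le> 1" and p: "0 \<le> p" "p \<le> 1" and G: "\<And>x. cmod (blk j f x) \<le> G"
  shows "cmod (blk j (heat t f) x) \<le> 288 * (t * 4 ^ j) powr (- p) * G"
proof -
  define A where "A = (t * 4 ^ j) powr (- p)"
  have A: "A > 0" using t by (simp add: A_def)
  \<comment> \<open>The factor 12 covers the Lipschitz constant \<open>4 / a\<close>, which is
    \<open>32 / 3\<close> divided by \<open>2 ^ j\<close>.\<close>
  have "cmod (blk j (heat t f) x) \<le> 24 * (12 * A) * G"
  proof (cases "j = 0")
    case True
    have A1: "1 \<le> A" using powr_mono'[of "- p" 0 t] t p by (simp add: A_def True)
    show ?thesis
    proof (rule blk_mult[OF _ _ _ _ G, where \<mu> = "\<lambda>k. complex_of_real (gauss t (real_of_int k))"])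
      fix k :: int
      have e: "0 < gauss t (real_of_int k)" "gauss t (real_of_int k) \<le> 1" for k
        using t by auto
      show "cmod (complex_of_real (gauss t (real_of_int k))) \<le> 12 * A"
        unfolding norm_of_real using e[of k] A1 by linarith
      show "cmod (complex_of_real (gauss t (real_of_int k)) -
          complex_of_real (gauss t (real_of_int (k - 1)))) \<le> 12 * A / 2 ^ j"
        unfolding of_real_diff[symmetric] norm_of_real using e[of k] e[of "k - 1"] A1 unfolding True power_0 div_by_1 by linarith
    qed (use A in \<open>auto simp: heat_def\<close>)
  next
    case False
    define a where "a = 3 / 8 * (2::real) ^ j"
    have a: "a > 0" by (simp add: a_def)
    \<comment> \<open>Since \<open>pi \<ge> 16 / 9\<close>, the factor \<open>4 * pi\<^sup>2\<close>
      outweighs the square of the inner radius \<open>3 / 8\<close> of the annulus.\<close>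
    have Aa: "(4 * pi\<^sup>2 * a\<^sup>2 * t) powr (- p) \<le> A"
    proof -
      have "(16/9)\<^sup>2 \<le> pi\<^sup>2" using pi_approx by (intro power_mono) auto
      then have "1 \<le> 4 * pi\<^sup>2 * (3/8)\<^sup>2" by (simp add: power2_eq_square field_simps)
      then have "t * 4 ^ j * 1 \<le> t * 4 ^ j * (4 * pi\<^sup>2 * (3/8)\<^sup>2)" using t by (intro mult_left_mono) auto
      also have "\<dots> = 4 * pi\<^sup>2 * a\<^sup>2 * t"
        by (simp add: a_def power_mult_distrib power2_eq_square power_mult_distrib[symmetric])
      finally show ?thesis unfolding A_def using t p by (intro powr_mono2') auto
    qed
    define m where "m = (\<lambda>k::int. gauss t (max \<bar>real_of_int k\<bar> a))"
    show ?thesis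
    proof (rule blk_mult[OF _ _ _ _ G, where \<mu> = "\<lambda>k. complex_of_real (m k)"])
      fix k :: int
      have "m k \<le> A" unfolding m_def
        by (rule order_trans[OF gauss_bound[OF t(1) a p] Aa]) simp
      moreover have "0 < m k" by (simp add: m_def)
      ultimately show "cmod (complex_of_real (m k)) \<le> 12 * A" by simp
      have "\<bar>m k - m (k - 1)\<bar> \<le> 4 / a * (4 * pi\<^sup>2 * a\<^sup>2 * t) powr (- p) * \<bar>max \<bar>real_of_int k\<bar> a - max \<bar>real_of_int (k - 1)\<bar> a\<bar>"
        unfolding m_def by (rule gauss_lipschitz[OF t(1) a p]) auto
      also have "\<dots> \<le> 4 / a * A * 1"
        using a Aa A max_abs_lipschitz[of "real_of_int k" a "real_of_int (k - 1)"] by (intro mult_mono) auto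
      also have "\<dots> \<le> 12 * A / 2 ^ j"
        using A by (simp add: a_def field_simps)
      finally show "cmod (complex_of_real (m k) - complex_of_real (m (k - 1))) \<le> 12 * A / 2 ^ j"
        unfolding of_real_diff[symmetric] norm_of_real .
      show "heat t f k = complex_of_real (m k) * f k" if "W j k \<noteq> 0"
      proof -
        have "max \<bar>real_of_int k\<bar> a = \<bar>real_of_int k\<bar>"
          using W_lower[OF that] False unfolding a_def by (intro max_absorb1) auto
        then show ?thesis by (simp add: heat_def m_def)
      qed
    qed (use A in auto)
  qed
  then show ?thesis by (simp add: A_def)
qed

lemma blk_dx:
  assumes G: "\<And>x. cmod (blk j f x) \<le> G"
  shows "cmod (blk j (dx f) x) \<le> 384 * 2 ^ j * G"
proof -
  \<comment> \<open>Clamping at the edge of the block bounds the symbol by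
    \<open>2 * pi * 2 ^ (j + 1) \<le> 16 * 2 ^ j\<close> and keeps its steps below
    \<open>2 * pi\<close>.\<close>
  define c where "c = (\<lambda>k::int. max (- (2 ^ (j + 1))) (min (real_of_int k) (2 ^ (j + 1))))"
  have pi4: "pi \<le> 4" using pi_less_4 by simp
  have "cmod (blk j (dx f) x) \<le> 24 * (16 * 2 ^ j) * G"
  proof (rule blk_mult[OF _ _ _ _ G, where \<mu> = "\<lambda>k. 2 * pi * \<i> * complex_of_real (c k)"])
    fix k
    have "\<bar>c k\<bar> \<le> 2 ^ (j + 1)" unfolding c_def by (auto simp: max_def min_def)
    then have "2 * pi * \<bar>c k\<bar> \<le> 2 * 4 * 2 ^ (j + 1)" using pi4 by (intro mult_mono) auto
    then show "cmod (2 * pi * \<i> * complex_of_real (c k)) \<le> 16 * 2 ^ j" by (simp add: norm_mult)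
    have "\<bar>c k - c (k - 1)\<bar> \<le> 1" unfolding c_def by (simp add: max_def min_def)
    then have "2 * pi * \<bar>c k - c (k - 1)\<bar> \<le> 2 * 4 * 1" using pi4 by (intro mult_mono) auto
    moreover have "cmod (2 * pi * \<i> * complex_of_real (c k) - 2 * pi * \<i> * complex_of_real (c (k - 1))) = 2 * pi * \<bar>c k - c (k - 1)\<bar>"
      unfolding right_diff_distrib[symmetric] of_real_diff[symmetric] norm_mult by (simp del: of_real_diff)
    ultimately show "cmod (2 * pi * \<i> * complex_of_real (c k) - 2 * pi * \<i> * complex_of_real (c (k - 1))) \<le> 16 * 2 ^ j / 2 ^ j"
      by simp
    show "dx f k = 2 * pi * \<i> * complex_of_real (c k) * f k" if "W j k \<noteq> 0"
    proof -
      have "\<bar>real_of_int k\<bar> \<le> 2 ^ (j + 1)" by (rule W_upper_real[OF that])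
      then have "c k = real_of_int k" by (auto simp: c_def)
      then show ?thesis by (simp add: dx_def)
    qed
  qed auto
  then show ?thesis by simp
qed

text \<open>Interpolation: with \<open>z = t * 4 ^ j\<close> the inequality
  \<open>1 - exp (- y) \<le> y\<close> gives a bound linear in \<open>z\<close>, the triangle
  inequality gives a constant, and the smaller of \<open>z\<close> and 1 is at most
  \<open>z powr d\<close>.\<close>

lemma blk_heat_diff:
  assumes t: "0 < t" "t \<le> 1" and d: "0 \<le> d" "d \<le> 1" and G: "\<And>x. cmod (blk j f x) \<le> G"
  shows "cmod (blk j (dsub (heat t f) f) x) \<le> 4000 * (t * 4 ^ j) powr d * G"
proof -
  define z where "z = t * (4::real) ^ j"
  have z: "z > 0" using t by (simp add: z_def)
  have G0: "G \<ge> 0" using order_trans[OF norm_ge_zero G] .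
  have pi10: "pi\<^sup>2 \<le> 10"
  proof -
    have "pi\<^sup>2 \<le> (315/100)\<^sup>2" using pi_approx by (intro power_mono) auto
    then show ?thesis by (simp add: power2_eq_square)
  qed
  have 1: "cmod (blk j (dsub (heat t f) f) x) \<le> 24 * (160 * z) * G"
  proof -
    define c where "c = (\<lambda>k::int. min \<bar>real_of_int k\<bar> (2 ^ (j + 1)))"
    have c: "0 \<le> c k" "c k \<le> 2 * 2 ^ j" for k by (auto simp: c_def)
    define m where "m = (\<lambda>k. gauss t (c k))"
    have z2: "t * (2 ^ j * 2 ^ j) = z" by (simp add: z_def power_mult_distrib[symmetric])
    show ?thesis
    proof (rule blk_mult[OF _ _ _ _ G, where \<mu> = "\<lambda>k. complex_of_real (m k - 1)"])
      fix k
      have "1 - m k \<le> 4 * pi\<^sup>2 * (c k)\<^sup>2 * t"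
        using exp_ge_add_one_self[of "- (4 * pi\<^sup>2 * (c k)\<^sup>2 * t)"] by (simp add: m_def)
      also have "\<dots> \<le> 4 * 10 * (2 * 2 ^ j)\<^sup>2 * t"
        using t c pi10 by (intro mult_mono power_mono) auto
      also have "\<dots> = 160 * z" unfolding z2[symmetric] by (simp add: power2_eq_square)
      finally have "1 - m k \<le> 160 * z" .
      moreover have "m k \<le> 1" using t by (simp add: m_def)
      ultimately show "cmod (complex_of_real (m k - 1)) \<le> 160 * z"
        unfolding norm_of_real by linarith
      have "\<bar>m k - m (k - 1)\<bar> \<le> 160 * t * 2 ^ j * \<bar>c k - c (k - 1)\<bar>"
      proof -
        have "norm (gauss t (c k) - gauss t (c (k - 1))) \<le> 160 * t * 2 ^ j * norm (c k - c (k - 1))"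
        proof (rule field_differentiable_bound[of "{0..2 * 2 ^ j}" _ "\<lambda>z. - (8 * pi\<^sup>2 * z * t) * gauss t z"])
          fix y :: real assume y: "y \<in> {0..2 * 2 ^ j}"
          show "((\<lambda>x. gauss t x) has_field_derivative - (8 * pi\<^sup>2 * y * t) * gauss t y) (at y within {0..2 * 2 ^ j})"
            by (auto intro!: derivative_eq_intros)
          have "norm (- (8 * pi\<^sup>2 * y * t) * gauss t y) = (8 * pi\<^sup>2 * y * t) * gauss t y"
            using y t by (simp add: abs_mult)
          also have "\<dots> \<le> (8 * 10 * (2 * 2 ^ j) * t) * 1"
            using y t pi10 by (intro mult_mono) auto
          finally show "norm (- (8 * pi\<^sup>2 * y * t) * gauss t y) \<le> 160 * t * 2 ^ j"
            by (simp add: mult_ac)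
        qed (use c in auto)
        then show ?thesis by (simp add: m_def)
      qed
      also have "\<dots> \<le> 160 * t * 2 ^ j * 1"
        using t by (intro mult_left_mono) (auto simp: c_def min_def)
      also have "\<dots> = 160 * z / 2 ^ j" unfolding z2[symmetric] by simp
      finally show "cmod (complex_of_real (m k - 1) - complex_of_real (m (k - 1) - 1)) \<le> 160 * z / 2 ^ j"
        unfolding of_real_diff[symmetric] norm_of_real by simp
      show "dsub (heat t f) f k = complex_of_real (m k - 1) * f k" if "W j k \<noteq> 0"
      proof -
        have "\<bar>real_of_int k\<bar> \<le> 2 ^ (j + 1)" by (rule W_upper_real[OF that])
        then have "c k = \<bar>real_of_int k\<bar>" by (auto simp: c_def)
        then show ?thesis by (simp add: dsub_def heat_def m_def algebra_simps)
      qed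
    qed (use z in auto)
  qed
  have 2: "cmod (blk j (dsub (heat t f) f) x) \<le> 289 * G"
  proof -
    have "blk j (dsub (heat t f) f) x = blk j (heat t f) x - blk j f x"
      unfolding blk_eq dsub_def by (simp add: sum_subtractf[symmetric] algebra_simps)
    also have "cmod \<dots> \<le> 288 * G + G"
      using blk_heat[OF t, of 0 j f G x] G t by (intro norm_triangle_le_diff add_mono) auto
    finally show ?thesis by simp
  qed
  show ?thesis
  proof (cases "z \<le> 1")
    case True
    have "z \<le> z powr d" using powr_mono'[of d 1 z] z d True by simp
    then have "24 * (160 * z) * G \<le> 4000 * z powr d * G" using G0 z by (intro mult_right_mono) auto
    then show ?thesis using 1 unfolding z_def[symmetric] by linarith
  next
    case False
    have "1 \<le> z powr d" using False d by (simp add: ge_one_powr_ge_zero)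
    then have "289 * G \<le> 4000 * z powr d * G" using G0 by (intro mult_right_mono) auto
    then show ?thesis using 2 unfolding z_def[symmetric] by linarith
  qed
qed

text \<open>Only boundedness is kept and the gained derivative is dropped: the nonlinearity is
  estimated in the supremum norm, where this is enough.\<close>

lemma blk_dx_rho:
  assumes G: "\<And>x. cmod (blk j f x) \<le> G"
  shows "cmod (blk j (dx_rho f) x) \<le> 120 * G"
proof -
  define a where "a = 3 / 8 * (2::real) ^ j"
  have a: "a > 0" by (simp add: a_def)
  have aj: "2 ^ j / 3 \<le> a" by (simp add: a_def)
  define M where "M = (\<lambda>k::int. max \<bar>real_of_int k\<bar> a)"
  have M: "a \<le> M k" "\<bar>real_of_int k\<bar> \<le> M k" for k by (auto simp: M_def)
  have Mpos: "M k > 0" for k using M(1)[of k] a by linarith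
  \<comment> \<open>The symbol \<open>1 / k\<close> is written as \<open>k * g k * g k\<close>,
    which agrees with it on the annulus, vanishes at 0 and has small differences because
    \<open>g\<close> varies by at most \<open>g k * g (k - 1)\<close>.\<close>
  define g where "g = (\<lambda>k. 1 / M k)"
  have g: "0 < g k" "g k \<le> 1 / a" "\<bar>real_of_int k * g k\<bar> \<le> 1" for k
    using M[of k] Mpos[of k] a by (auto simp: g_def abs_mult frac_le)
  have pi3: "pi \<ge> 3" using pi_approx by simp
  have "cmod (blk j (dx_rho f) x) \<le> 24 * 5 * G"
  proof (rule blk_mult[OF _ _ _ _ G, where \<mu> = "\<lambda>k. \<i> * complex_of_real (real_of_int k * g k * g k / (2 * pi))"])
    fix k :: int
    have gd: "\<bar>g k - g (k - 1)\<bar> \<le> g k * g (k - 1)"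
    proof -
      have "g k - g (k - 1) = (M (k - 1) - M k) * (g k * g (k - 1))"
        using Mpos[of k] Mpos[of "k - 1"] by (simp add: g_def field_simps)
      moreover have "\<bar>M (k - 1) - M k\<bar> \<le> 1" unfolding M_def
        using max_abs_lipschitz[of "real_of_int (k - 1)" a "real_of_int k"] by simp
      ultimately show ?thesis
        using mult_right_mono[of "\<bar>M (k - 1) - M k\<bar>" 1 "g k * g (k - 1)"] g(1)[of k] g(1)[of "k - 1"]
        by (simp add: abs_mult)
    qed
    have ga: "g k * g (k - 1) \<le> 1 / a * (1 / a)" using g(1,2)[of k] g(1,2)[of "k - 1"] a by (intro mult_mono) auto
    have inva: "1 / a \<le> 3 / 2 ^ j" using aj a by (simp add: field_simps)
    have "1 / 3 \<le> a" using aj one_le_power[of "2::real" j] by linarith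
    then have inva3: "1 / a \<le> 3" using a by (simp add: field_simps)
    have inva2: "1 / a * (1 / a) \<le> 3 / 2 ^ j * 3"
    proof (rule mult_mono[OF inva])
      show "1 / a \<le> 3" by (rule inva3)
    qed (use a in auto)
    have "\<bar>real_of_int k * g k * g k\<bar> \<le> 1 * (1 / a)"
      unfolding abs_mult[of "real_of_int k * g k"] using g[of k] a by (intro mult_mono) auto
    also have "\<dots> \<le> 3" using inva3 by simp
    finally have "\<bar>real_of_int k * g k * g k\<bar> / (2 * pi) \<le> 5 * 1"
      using pi3 by (simp add: field_simps)
    then show "cmod (\<i> * complex_of_real (real_of_int k * g k * g k / (2 * pi))) \<le> 5"
      by (simp only: norm_mult norm_of_real norm_ii abs_divide) simp
    let ?u = "real_of_int k" and ?v = "real_of_int (k - 1)"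
    have "?u * g k * g k - ?v * g (k - 1) * g (k - 1)
       = ?u * g k * (g k - g (k - 1)) + (?u * (g k - g (k - 1)) + g (k - 1)) * g (k - 1)"
      by (simp add: algebra_simps)
    also have "\<bar>\<dots>\<bar> \<le> 1 * (1 / a * (1 / a)) + (1 * g (k - 1) + g (k - 1)) * g (k - 1)"
    proof (rule order_trans[OF abs_triangle_ineq add_mono])
      show "\<bar>?u * g k * (g k - g (k - 1))\<bar> \<le> 1 * (1 / a * (1 / a))"
        unfolding abs_mult[of "?u * g k"] using g(3)[of k] gd ga by (intro mult_mono) auto
      have "\<bar>?u * (g k - g (k - 1))\<bar> \<le> \<bar>?u\<bar> * (g k * g (k - 1))"
        unfolding abs_mult by (intro mult_left_mono gd) auto
      also have "\<dots> = \<bar>?u * g k\<bar> * g (k - 1)" using g(1)[of k] by (simp add: abs_mult)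
      also have "\<dots> \<le> 1 * g (k - 1)" using g(1)[of "k - 1"] g(3)[of k] by (intro mult_right_mono) auto
      finally have "\<bar>?u * (g k - g (k - 1)) + g (k - 1)\<bar> \<le> 1 * g (k - 1) + g (k - 1)"
        using g(1)[of "k - 1"] by linarith
      then show "\<bar>(?u * (g k - g (k - 1)) + g (k - 1)) * g (k - 1)\<bar> \<le> (1 * g (k - 1) + g (k - 1)) * g (k - 1)"
        unfolding abs_mult using g(1)[of "k - 1"] by (intro mult_mono) auto
    qed
    also have "(1 * g (k - 1) + g (k - 1)) * g (k - 1) \<le> 2 * (1 / a * (1 / a))"
    proof -
      have "g (k - 1) * g (k - 1) \<le> 1 / a * (1 / a)" using g(1,2)[of "k - 1"] a by (intro mult_mono) auto
      then show ?thesis by (simp add: algebra_simps)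
    qed
    finally have "\<bar>?u * g k * g k - ?v * g (k - 1) * g (k - 1)\<bar> \<le> 27 / 2 ^ j"
      using inva2 by simp
    then have "\<bar>?u * g k * g k - ?v * g (k - 1) * g (k - 1)\<bar> / (2 * pi) \<le> 27 / 2 ^ j / 6"
      using pi3 by (intro frac_le) auto
    also have "\<dots> \<le> 5 / 2 ^ j" by (simp add: field_simps)
    finally have le: "\<bar>?u * g k * g k - ?v * g (k - 1) * g (k - 1)\<bar> / (2 * pi) \<le> 5 / 2 ^ j" .
    have "cmod (\<i> * complex_of_real (?u * g k * g k / (2 * pi)) - \<i> * complex_of_real (?v * g (k - 1) * g (k - 1) / (2 * pi)))
       = \<bar>?u * g k * g k - ?v * g (k - 1) * g (k - 1)\<bar> / (2 * pi)"
      unfolding right_diff_distrib[symmetric] of_real_diff[symmetric] diff_divide_distrib[symmetric] norm_mult norm_of_real by simp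
    then show "cmod (\<i> * complex_of_real (?u * g k * g k / (2 * pi)) - \<i> * complex_of_real (?v * g (k - 1) * g (k - 1) / (2 * pi))) \<le> 5 / 2 ^ j"
      using le by simp
    show "dx_rho f k = \<i> * complex_of_real (real_of_int k * g k * g k / (2 * pi)) * f k" if "W j k \<noteq> 0"
    proof (cases "k = 0")
      case True then show ?thesis by (simp add: dx_rho_def)
    next
      case False
      then have "M k = \<bar>real_of_int k\<bar>" using W_lower[OF that] by (auto simp: M_def a_def)
      then have "real_of_int k * g k * g k = 1 / real_of_int k" using False
        by (simp add: g_def field_simps)
      then have "real_of_int k * g k * g k / (2 * pi) = 1 / (2 * pi * real_of_int k)" by simp
      then show ?thesis using False by (simp only:) (simp add: dx_rho_def)
    qed
  qed auto
  then show ?thesis by simp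
qed

text \<open>The weight of the block is itself the kernel symbol. This embeds bounded continuous
  functions into regularity 0.\<close>

lemma blk_fc:
  assumes g: "continuous_on {0..1} g" and G: "\<And>y. y \<in> {0..1} \<Longrightarrow> \<bar>g y\<bar> \<le> G"
  shows "cmod (blk j (fc g) x) \<le> 12 * Lw * G"
proof -
  have z: "Wc j k = 0" if "\<bar>k\<bar> > 2 * 2 ^ j" for k
    using W_upper[of j k] that by (cases "W j k = 0") auto
  interpret kernel "2 ^ j" "\<lambda>k. Wc j k" Lw
  proof
    fix k :: int
    have "(2::int) ^ j > 0" by simp
    then show "\<bar>k\<bar> > 4 * int (2 ^ j) \<Longrightarrow> Wc j k = 0" using z[of k] by simp
    show "cmod (Wc j k - complex_of_real (W j (k - 1))) \<le> Lw / real (2 ^ j)"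
      unfolding of_real_diff[symmetric] norm_of_real using w_lip[of j k] by simp
  qed (use Lw w_bound in auto)
  have "cmod (\<Sum>k\<in>modes (4 * 2 ^ j). Wc j k * cfc (\<lambda>x. complex_of_real (g x)) k * ek k x) \<le> 12 * Lw * G"
    by (rule multiplier) (use g G in \<open>auto intro!: continuous_intros\<close>)
  also have "(\<Sum>k\<in>modes (4 * 2 ^ j). Wc j k * cfc (\<lambda>x. complex_of_real (g x)) k * ek k x) = blk j (fc g) x"
    unfolding blk_eq fc_cfc[symmetric]
  proof (rule sum.mono_neutral_right)
    show "\<forall>k\<in>modes (4 * 2 ^ j) - modes (2 * 2 ^ j). Wc j k * fc g k * ek k x = 0"
    proof
      fix k assume "k \<in> modes (4 * 2 ^ j) - modes (2 * 2 ^ j)"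
      then have "\<bar>k\<bar> > 2 * 2 ^ j" by auto
      then show "Wc j k * fc g k * ek k x = 0" by (simp only: z mult_zero_left)
    qed
  qed auto
  finally show ?thesis .
qed

end

section \<open>Besov bounds and the nonlinearity\<close>

lemma real_dist_dadd: "real_dist f \<Longrightarrow> real_dist g \<Longrightarrow> real_dist (dadd f g)"
  by (simp add: real_dist_def dadd_def)

lemma real_dist_dsub: "real_dist f \<Longrightarrow> real_dist g \<Longrightarrow> real_dist (dsub f g)"
  by (simp add: real_dist_def dsub_def)

lemma real_dist_heat: "real_dist f \<Longrightarrow> real_dist (heat t f)"
  by (simp add: real_dist_def heat_def)

lemma real_dist_dx: "real_dist f \<Longrightarrow> real_dist (dx f)"
  by (simp add: real_dist_def dx_def)

lemma real_dist_dx_rho: "real_dist f \<Longrightarrow> real_dist (dx_rho f)"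
  by (simp add: real_dist_def dx_rho_def)

lemma real_dist_fc: "real_dist (fc g)"
  unfolding real_dist_def fc_def by (simp add: integral_cnj cis_cnj)

lemma dx_rho_dsub: "dx_rho (dsub f g) = dsub (dx_rho f) (dx_rho g)"
  by (auto simp: dx_rho_def dsub_def fun_eq_iff algebra_simps diff_divide_distrib)

lemma fc_diff:
  assumes "continuous_on UNIV g" "continuous_on UNIV h"
  shows "fc (\<lambda>x. g x - h x) = dsub (fc g) (fc h)"
proof
  fix k
  have "fc (\<lambda>x. g x - h x) k = integral {0..1} (\<lambda>x. complex_of_real (g x) * cis (- 2 * pi * real_of_int k * x)
     - complex_of_real (h x) * cis (- 2 * pi * real_of_int k * x))"
    unfolding fc_def by (simp add: algebra_simps)
  also have "\<dots> = dsub (fc g) (fc h) k"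
    unfolding dsub_def fc_def
    by (intro Henstock_Kurzweil_Integration.integral_diff integrable_continuous_real continuous_intros
        continuous_on_subset[OF assms(1)] continuous_on_subset[OF assms(2)]) auto
  finally show "fc (\<lambda>x. g x - h x) k = dsub (fc g) (fc h) k" .
qed

lemma cfc_bound:
  assumes "continuous_on {0..1} g" and G: "\<And>y. y \<in> {0..1} \<Longrightarrow> cmod (g y) \<le> G"
  shows "cmod (cfc g k) \<le> G"
proof -
  have "cmod (cfc g k) \<le> integral {0..1} (\<lambda>x::real. G)"
    unfolding cfc_def
    by (intro integral_norm_bound_integral integrable_continuous_real continuous_intros assms) (auto simp: norm_mult G)
  then show ?thesis by simp
qed

text \<open>By \<open>fc_eq_0_imp\<close> at most one continuous periodic function has given
  coefficients, so the definite description in \<open>fun_of\<close> is resolved by exhibiting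
  one.\<close>

lemma fun_of_eqI:
  assumes g: "continuous_on UNIV g" "\<And>x. g (x + 1) = g x" "fc g = f"
  shows "fun_of f = g"
  unfolding fun_of_def
proof (rule the_equality)
  fix h assume h: "continuous_on UNIV h \<and> (\<forall>x. h (x + 1) = h x) \<and> fc h = f"
  have "h x - g x = 0" for x
  proof (rule fc_eq_0_imp[of "\<lambda>x. h x - g x"])
    show "fc (\<lambda>x. h x - g x) = (\<lambda>_. 0)"
      using g h by (simp add: fc_diff dsub_def)
  qed (use g h in \<open>auto intro!: continuous_intros\<close>)
  then show "h = g" by (simp add: fun_eq_iff)
qed (use g in auto)

lemma powr_small:
  fixes Q r e :: real
  assumes "0 \<le> Q" "0 < r" "0 < e"
  shows "\<exists>\<tau>>0. \<tau> \<le> 1 \<and> (\<forall>t. 0 < t \<longrightarrow> t \<le> \<tau> \<longrightarrow> Q * t powr r \<le> e)"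
proof -
  define \<tau> where "\<tau> = min 1 ((e / (Q + 1)) powr (1 / r))"
  have "Q * t powr r \<le> e" if t: "0 < t" "t \<le> \<tau>" for t
  proof -
    have "t powr r \<le> ((e / (Q + 1)) powr (1 / r)) powr r"
      using t assms by (intro powr_mono2) (auto simp: \<tau>_def)
    also have "\<dots> = e / (Q + 1)" using assms by (simp add: powr_powr)
    finally have "Q * t powr r \<le> Q * (e / (Q + 1))" using assms by (intro mult_left_mono)
    also have "\<dots> = e * (Q / (Q + 1))" by simp
    also have "\<dots> \<le> e * 1" using assms by (intro mult_left_mono) auto
    finally show ?thesis by simp
  qed
  moreover have "0 < \<tau>" "\<tau> \<le> 1" using assms by (auto simp: \<tau>_def)
  ultimately show ?thesis by blast
qed

lemma four_power_powr: "((4::real) ^ j) powr q = 2 powr (2 * real j * q)"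
proof -
  have "(4::real) ^ j = 2 powr (2 * real j)"
    by (simp add: powr_powr[symmetric] powr_realpow)
  then show ?thesis by (simp add: powr_powr)
qed

abbreviation "dyw j \<beta> \<equiv> 2 powr (- (real j - 1) * \<beta>)"

section \<open>Calculus of block bounds\<close>

context lp
begin

text \<open>Stands for the norm being at most \<open>c\<close>. Unlike \<open>besov_norm\<close>, a
  supremum that says nothing without \<open>besov_bdd\<close>, it carries its own
  finiteness.\<close>

definition bnd :: "real \<Rightarrow> tdist \<Rightarrow> real \<Rightarrow> bool" where
  "bnd \<beta> f c \<longleftrightarrow> (\<forall>j x. cmod (blk j f x) \<le> c * dyw j \<beta>)"

lemma bndD: "bnd \<beta> f c \<Longrightarrow> cmod (blk j f x) \<le> c * dyw j \<beta>"
  by (simp add: bnd_def)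

lemma bnd_nonneg: "bnd \<beta> f c \<Longrightarrow> 0 \<le> c"
  using order_trans[OF norm_ge_zero bndD[of \<beta> f c 0 0]] by (simp add: zero_le_mult_iff)

lemma bnd_weaken: "bnd \<beta> f c \<Longrightarrow> c \<le> d \<Longrightarrow> bnd \<beta> f d"
  unfolding bnd_def by (meson mult_right_mono order_trans powr_ge_zero)

lemma blk_dadd: "blk j (dadd f g) x = blk j f x + blk j g x"
  unfolding blk_eq dadd_def by (simp add: sum.distrib[symmetric] algebra_simps)

lemma blk_dsub: "blk j (dsub f g) x = blk j f x - blk j g x"
  unfolding blk_eq dsub_def by (simp add: sum_subtractf[symmetric] algebra_simps)

lemma blk_scale: "blk j (\<lambda>k. a * f k) x = a * blk j f x"
  unfolding blk_eq by (simp add: sum_distrib_left mult_ac)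

lemma bnd_dadd: "bnd \<beta> f c \<Longrightarrow> bnd \<beta> g d \<Longrightarrow> bnd \<beta> (dadd f g) (c + d)"
  unfolding bnd_def blk_dadd distrib_right by (blast intro: norm_triangle_mono)

lemma bnd_dsub: "bnd \<beta> f c \<Longrightarrow> bnd \<beta> g d \<Longrightarrow> bnd \<beta> (dsub f g) (c + d)"
  unfolding bnd_def blk_dsub distrib_right by (blast intro: norm_triangle_le_diff add_mono)

lemma bnd_scale: "bnd \<beta> f c \<Longrightarrow> bnd \<beta> (\<lambda>k. a * f k) (cmod a * c)"
  unfolding bnd_def blk_scale norm_mult by (simp add: mult.assoc mult_left_mono)

lemma bnd_zero: "0 \<le> c \<Longrightarrow> bnd \<beta> (\<lambda>_. 0) c"
  by (simp add: bnd_def blk_eq)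

text \<open>The loss of 2 is due to block 0 alone, whose weight \<open>2 powr \<beta>\<close> grows
  with the exponent.\<close>

lemma bnd_exponent:
  assumes "bnd \<beta>' f c" "\<beta> \<le> \<beta>'" "\<beta>' \<le> \<beta> + 1"
  shows "bnd \<beta> f (2 * c)"
  unfolding bnd_def
proof (intro allI)
  fix j x
  have "cmod (blk j f x) \<le> c * dyw j \<beta>'" by (rule bndD[OF assms(1)])
  also have "\<dots> \<le> c * (2 * dyw j \<beta>)"
  proof (intro mult_left_mono)
    have "- (real j - 1) * \<beta>' \<le> 1 + - (real j - 1) * \<beta>"
    proof -
      have "- (real j - 1) * (\<beta>' - \<beta>) \<le> 1 * (\<beta>' - \<beta>)" using assms by (intro mult_right_mono) auto
      then show ?thesis using assms by (simp add: algebra_simps)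
    qed
    then have "dyw j \<beta>' \<le> 2 powr (1 + - (real j - 1) * \<beta>)" by simp
    then show "dyw j \<beta>' \<le> 2 * dyw j \<beta>"
      by (simp only: powr_add) simp
  qed (use bnd_nonneg[OF assms(1)] in auto)
  finally show "cmod (blk j f x) \<le> 2 * c * dyw j \<beta>" by simp
qed

lemma bdd_blk: "bdd_above ((\<lambda>x. cmod (blk j f x)) ` {0..1})"
  by (intro bounded_imp_bdd_above compact_imp_bounded compact_continuous_image continuous_intros) auto

lemma bnd_besov:
  assumes "bnd \<beta> f c"
  shows "besov_bdd \<rho>0 \<rho> \<beta> f" "besov_norm \<rho>0 \<rho> \<beta> f \<le> c"
proof -
  have le: "besov_seq \<rho>0 \<rho> \<beta> f j \<le> c" for j
  proof -
    have "(SUP x\<in>{0..1}. cmod (blk j f x)) \<le> c * dyw j \<beta>"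
      by (rule cSUP_least) (use bndD[OF assms] in auto)
    then have "besov_seq \<rho>0 \<rho> \<beta> f j \<le> 2 powr ((real j - 1) * \<beta>) * (c * dyw j \<beta>)"
      unfolding besov_seq_def by (intro mult_left_mono) auto
    also have "\<dots> = c * 2 powr ((real j - 1) * \<beta> + - (real j - 1) * \<beta>)"
      by (simp only: powr_add mult_ac)
    also have "\<dots> = c" by (simp add: algebra_simps)
    finally show ?thesis .
  qed
  show "besov_bdd \<rho>0 \<rho> \<beta> f" unfolding besov_bdd_def using le by (auto intro!: bdd_aboveI)
  show "besov_norm \<rho>0 \<rho> \<beta> f \<le> c" unfolding besov_norm_def using le by (intro cSUP_least) auto
qed

lemma besov_bnd:
  assumes "besov_bdd \<rho>0 \<rho> \<beta> f"
  shows "bnd \<beta> f (besov_norm \<rho>0 \<rho> \<beta> f)"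
  unfolding bnd_def
proof (intro allI)
  fix j x
  have "cmod (blk j f x) = cmod (blk j f (frac x))" by (simp add: blk_frac)
  also have "\<dots> \<le> (SUP x\<in>{0..1}. cmod (blk j f x))"
    by (rule cSUP_upper[OF _ bdd_blk]) (use frac_lt_1[of x] in \<open>auto simp: less_imp_le\<close>)
  also have "\<dots> = (2 powr ((real j - 1) * \<beta>) * (SUP x\<in>{0..1}. cmod (blk j f x))) * dyw j \<beta>"
  proof -
    have "2 powr ((real j - 1) * \<beta>) * dyw j \<beta> = 1"
      by (simp add: powr_add[symmetric] algebra_simps)
    then show ?thesis by (metis mult.assoc mult.commute mult.right_neutral)
  qed
  also have "\<dots> \<le> besov_norm \<rho>0 \<rho> \<beta> f * dyw j \<beta>"
  proof (rule mult_right_mono)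
    have "besov_seq \<rho>0 \<rho> \<beta> f j \<le> besov_norm \<rho>0 \<rho> \<beta> f"
      unfolding besov_norm_def using assms unfolding besov_bdd_def by (intro cSUP_upper) auto
    then show "2 powr ((real j - 1) * \<beta>) * (SUP x\<in>{0..1}. cmod (blk j f x)) \<le> besov_norm \<rho>0 \<rho> \<beta> f"
      by (simp add: besov_seq_def)
  qed auto
  finally show "cmod (blk j f x) \<le> besov_norm \<rho>0 \<rho> \<beta> f * dyw j \<beta>" .
qed

lemma bnd_heat:
  assumes f: "bnd \<beta> f c" and t: "0 < t" "t \<le> 1" and b: "\<beta> \<le> \<beta>'" "\<beta>' \<le> \<beta> + 2"
  shows "bnd \<beta>' (heat t f) (288 * t powr (- (\<beta>' - \<beta>) / 2) * c)"
  unfolding bnd_def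
proof (intro allI)
  fix j x
  define p where "p = (\<beta>' - \<beta>) / 2"
  have p: "0 \<le> p" "p \<le> 1" using b by (auto simp: p_def)
  have c: "0 \<le> c" by (rule bnd_nonneg[OF f])
  have "cmod (blk j (heat t f) x) \<le> 288 * (t * 4 ^ j) powr (- p) * (c * dyw j \<beta>)"
    by (rule blk_heat[OF t p bndD[OF f]])
  also have "(t * 4 ^ j) powr (- p) = t powr (- p) * 2 powr (2 * real j * - p)"
    using t by (simp add: powr_mult four_power_powr)
  also have "288 * (t powr (- p) * 2 powr (2 * real j * - p)) * (c * dyw j \<beta>)
     = 288 * t powr (- p) * c * 2 powr (2 * real j * - p + - (real j - 1) * \<beta>)"
    by (simp only: powr_add mult_ac)
  also have "\<dots> \<le> 288 * t powr (- p) * c * dyw j \<beta>'"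
  proof (rule mult_left_mono)
    have "2 * real j * - p = - real j * (\<beta>' - \<beta>)" by (simp add: p_def)
    then have "2 * real j * - p + - (real j - 1) * \<beta> \<le> - (real j - 1) * \<beta>'"
      using b by (simp add: algebra_simps)
    then show "2 powr (2 * real j * - p + - (real j - 1) * \<beta>) \<le> dyw j \<beta>'"
      by simp
  qed (use c in auto)
  finally show "cmod (blk j (heat t f) x) \<le> 288 * t powr (- (\<beta>' - \<beta>) / 2) * c * dyw j \<beta>'"
    unfolding p_def minus_divide_left .
qed

text \<open>The constant is \<open>288 * 384 * 2\<close>, from \<open>blk_heat\<close>, \<open>blk_dx\<close> and the shift by one in the dyadic weight.\<close>

lemma bnd_heat_dx:
  assumes f: "bnd \<beta> f c" and t: "0 < t" "t \<le> 1" and b: "\<beta> \<le> 1 + \<beta>'" "1 + \<beta>' \<le> \<beta> + 2"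
  shows "bnd \<beta>' (heat t (dx f)) (221184 * t powr (- (1 + \<beta>' - \<beta>) / 2) * c)"
  unfolding bnd_def
proof (intro allI)
  fix j x
  define p where "p = (1 + \<beta>' - \<beta>) / 2"
  have p: "0 \<le> p" "p \<le> 1" using b by (auto simp: p_def)
  have c: "0 \<le> c" by (rule bnd_nonneg[OF f])
  have "cmod (blk j (heat t (dx f)) x) \<le> 288 * (t * 4 ^ j) powr (- p) * (384 * 2 ^ j * (c * dyw j \<beta>))"
    by (rule blk_heat[OF t p blk_dx[OF bndD[OF f]]])
  also have "(t * 4 ^ j) powr (- p) = t powr (- p) * 2 powr (2 * real j * - p)"
    using t by (simp add: powr_mult four_power_powr)
  also have "(2::real) ^ j = 2 powr real j" by (simp add: powr_realpow)
  also have "288 * (t powr (- p) * 2 powr (2 * real j * - p)) * (384 * 2 powr real j * (c * dyw j \<beta>))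
     = 110592 * (t powr (- p) * c * (2 powr (2 * real j * - p) * (2 powr real j * dyw j \<beta>)))"
    by (simp add: mult_ac)
  also have "2 powr (2 * real j * - p) * (2 powr real j * dyw j \<beta>) = 2 powr (2 * real j * - p + (real j + - (real j - 1) * \<beta>))"
    by (simp only: powr_add)
  also have "110592 * (t powr (- p) * c * 2 powr (2 * real j * - p + (real j + - (real j - 1) * \<beta>))) \<le> 110592 * (t powr (- p) * c * (2 * dyw j \<beta>'))"
  proof (intro mult_left_mono)
    have "2 * real j * - p = - real j * (1 + \<beta>' - \<beta>)" by (simp add: p_def)
    then have "2 * real j * - p + (real j + - (real j - 1) * \<beta>) \<le> 1 + - (real j - 1) * \<beta>'"
      using b by (simp add: algebra_simps)
    then have "2 powr (2 * real j * - p + (real j + - (real j - 1) * \<beta>)) \<le> 2 powr (1 + - (real j - 1) * \<beta>')"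
      by simp
    then show "2 powr (2 * real j * - p + (real j + - (real j - 1) * \<beta>)) \<le> 2 * dyw j \<beta>'"
      by (simp only: powr_add) simp
  qed (use c in auto)
  finally show "cmod (blk j (heat t (dx f)) x) \<le> 221184 * t powr (- (1 + \<beta>' - \<beta>) / 2) * c * dyw j \<beta>'"
    unfolding p_def minus_divide_left by simp
qed

text \<open>Speed of the heat flow at time zero, paid for in regularity. The constant is 4000 from
  \<open>blk_heat_diff\<close> times 4, a bound for the \<open>2 powr (2 * d)\<close> that the index
  shift leaves behind.\<close>

lemma bnd_heat_diff:
  assumes f: "bnd (\<beta> + 2 * d) f c" and t: "0 < t" "t \<le> 1" and d: "0 \<le> d" "d \<le> 1"
  shows "bnd \<beta> (dsub (heat t f) f) (16000 * t powr d * c)"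
  unfolding bnd_def
proof (intro allI)
  fix j x
  have c: "0 \<le> c" by (rule bnd_nonneg[OF f])
  have "cmod (blk j (dsub (heat t f) f) x) \<le> 4000 * (t * 4 ^ j) powr d * (c * 2 powr (- (real j - 1) * (\<beta> + 2 * d)))"
    by (rule blk_heat_diff[OF t d bndD[OF f]])
  also have "(t * 4 ^ j) powr d = t powr d * 2 powr (2 * real j * d)"
    using t by (simp add: powr_mult four_power_powr)
  also have "4000 * (t powr d * 2 powr (2 * real j * d)) * (c * 2 powr (- (real j - 1) * (\<beta> + 2 * d)))
     = 4000 * (t powr d * c * (2 powr (2 * real j * d) * 2 powr (- (real j - 1) * (\<beta> + 2 * d))))"
    by (simp add: mult_ac)
  also have "2 powr (2 * real j * d) * 2 powr (- (real j - 1) * (\<beta> + 2 * d)) = 2 powr (2 * real j * d + - (real j - 1) * (\<beta> + 2 * d))"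
    by (simp only: powr_add)
  also have "2 * real j * d + - (real j - 1) * (\<beta> + 2 * d) = 2 * d + - (real j - 1) * \<beta>"
    by (simp add: algebra_simps)
  also have "4000 * (t powr d * c * 2 powr (2 * d + - (real j - 1) * \<beta>)) \<le> 4000 * (t powr d * c * (4 * dyw j \<beta>))"
  proof (intro mult_left_mono)
    have "2 powr (2 * d) \<le> (4::real)" using powr_mono[of "2 * d" 2 2] d by simp
    then show "2 powr (2 * d + - (real j - 1) * \<beta>) \<le> 4 * dyw j \<beta>"
      unfolding powr_add by (intro mult_right_mono) auto
  qed (use c in auto)
  finally show "cmod (blk j (dsub (heat t f) f) x) \<le> 16000 * t powr d * c * dyw j \<beta>"
    by simp
qed

lemma bnd_dx_rho: "bnd \<beta> f c \<Longrightarrow> bnd \<beta> (dx_rho f) (120 * c)"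
  unfolding bnd_def by (metis blk_dx_rho mult.assoc)

lemma bnd_fc:
  assumes "continuous_on UNIV g" "\<And>y. \<bar>g y\<bar> \<le> G"
  shows "bnd 0 (fc g) (12 * Lw * G)"
  unfolding bnd_def using blk_fc[of g G] assms continuous_on_subset[OF assms(1)] by simp

section \<open>From coefficients to functions\<close>

lemma cfc_blk: "cfc (blk j f) k = Wc j k * f k"
proof -
  have "cfc (blk j f) k = (if k \<in> modes (2 * 2 ^ j) then Wc j k * f k else 0)"
    unfolding blk_eq by (rule cfc_trig) simp
  also have "\<dots> = Wc j k * f k"
    using W_upper[of j k] by (cases "W j k = 0") auto
  finally show ?thesis .
qed

text \<open>The weights sum to one, so some block sees mode \<open>k\<close>. The constant depends
  on \<open>k\<close>, but \<open>\<beta>\<close> may have any sign; it is used for integrability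
  and limits of single coefficients.\<close>

lemma coeff_bound: "\<exists>C\<ge>0. \<forall>f c. bnd \<beta> f c \<longrightarrow> cmod (f k) \<le> C * c"
proof -
  obtain j where j: "W j k \<noteq> 0"
  proof -
    have "\<exists>j. W j k \<noteq> 0"
    proof (rule ccontr)
      assume "\<nexists>j. W j k \<noteq> 0"
      then have "(\<lambda>j. W j k) = (\<lambda>_. 0)" by auto
      then show False using W_sums[of k] sums_unique2[OF sums_zero, of "1::real"] by simp
    qed
    then show ?thesis using that by blast
  qed
  define C where "C = dyw j \<beta> / \<bar>W j k\<bar>"
  have "cmod (f k) \<le> C * c" if "bnd \<beta> f c" for f c
  proof -
    have "\<bar>W j k\<bar> * cmod (f k) \<le> c * dyw j \<beta>"
      using cfc_bound[OF continuous_on_blk bndD[OF that], of j k] by (simp add: cfc_blk norm_mult)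
    then show ?thesis using j by (simp add: C_def field_simps)
  qed
  moreover have "C \<ge> 0" by (simp add: C_def)
  ultimately show ?thesis by blast
qed

text \<open>Sum over \<open>j\<close> of the weights \<open>dyw j \<beta>\<close>, hence the
  constant of the embedding of positive regularity into bounded functions.\<close>

definition cE :: "real \<Rightarrow> real" where
  "cE \<beta> = 2 powr \<beta> / (1 - 2 powr (- \<beta>))"

lemma cE_pos: "\<beta> > 0 \<Longrightarrow> cE \<beta> > 0"
  unfolding cE_def by (simp add: powr_less_one)

definition synth :: "tdist \<Rightarrow> real \<Rightarrow> complex" where
  "synth f x = (\<Sum>j. blk j f x)"

context
  fixes \<beta> c :: real and f :: tdist
  assumes b: "\<beta> > 0" and f: "bnd \<beta> f c"
begin

lemma blk_geom: "cmod (blk j f x) \<le> c * 2 powr \<beta> * (2 powr (- \<beta>)) ^ j"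
proof -
  have "dyw j \<beta> = 2 powr (\<beta> + - \<beta> * real j)" by (simp add: algebra_simps)
  also have "\<dots> = 2 powr \<beta> * (2 powr (- \<beta>)) ^ j" by (simp only: powr_add) (simp add: powr_powr powr_realpow[symmetric])
  finally show ?thesis using bndD[OF f, of j x] by simp
qed

lemma geom_summable: "summable (\<lambda>j. c * 2 powr \<beta> * (2 powr (- \<beta>)) ^ j)"
  using b by (intro summable_mult summable_geometric) (simp add: powr_less_one)

lemma geom_suminf: "(\<Sum>j. c * 2 powr \<beta> * (2 powr (- \<beta>)) ^ j) = c * cE \<beta>"
  using b by (subst suminf_mult) (simp_all add: suminf_geometric summable_geometric powr_less_one cE_def)

lemma synth_uniform: "uniform_limit UNIV (\<lambda>n x. \<Sum>j<n. blk j f x) (synth f) sequentially"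
  unfolding synth_def by (rule Weierstrass_m_test[OF blk_geom geom_summable])

lemma synth_continuous: "continuous_on UNIV (synth f)"
  by (rule uniform_limit_theorem[OF _ synth_uniform]) (auto intro!: always_eventually continuous_intros)

lemma synth_periodic: "synth f (x + 1) = synth f x"
  unfolding synth_def blk_periodic ..

lemma synth_bound: "cmod (synth f x) \<le> c * cE \<beta>"
proof -
  have s: "summable (\<lambda>j. cmod (blk j f x))"
    by (rule summable_comparison_test[OF _ geom_summable]) (use blk_geom in auto)
  have "cmod (synth f x) \<le> (\<Sum>j. cmod (blk j f x))"
    unfolding synth_def by (rule summable_norm[OF s])
  also have "\<dots> \<le> (\<Sum>j. c * 2 powr \<beta> * (2 powr (- \<beta>)) ^ j)"
    by (rule suminf_le[OF blk_geom s geom_summable])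
  finally show ?thesis by (simp add: geom_suminf)
qed

text \<open>Uniform convergence allows the coefficient to be computed block by block; what results
  are the partial sums of the partition of unity.\<close>

lemma cfc_synth: "cfc (synth f) = f"
proof
  fix k
  let ?e = "\<lambda>x. cis (- 2 * pi * real_of_int k * x)"
  have "uniform_limit {0..1} (\<lambda>n x. \<Sum>j<n. blk j f x * ?e x) (\<lambda>x. \<Sum>j. blk j f x * ?e x) sequentially"
    by (rule Weierstrass_m_test[OF _ geom_summable]) (use blk_geom in \<open>simp add: norm_mult\<close>)
  then obtain I J where I: "\<And>n. ((\<lambda>x. \<Sum>j<n. blk j f x * ?e x) has_integral I n) {0..1}"
    and J: "((\<lambda>x. \<Sum>j. blk j f x * ?e x) has_integral J) {0..1}" and lim: "I \<longlonglongrightarrow> J"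
    by (rule uniform_limit_integral) (auto intro!: continuous_intros)
  have "I n = (\<Sum>j<n. cfc (blk j f) k)" for n
  proof -
    have "I n = integral {0..1} (\<lambda>x. \<Sum>j<n. blk j f x * ?e x)" by (rule integral_unique[OF I, symmetric])
    also have "\<dots> = (\<Sum>j<n. cfc (blk j f) k)" unfolding cfc_def
      by (intro integral_sum integrable_continuous_real continuous_intros) auto
    finally show ?thesis .
  qed
  then have "I = (\<lambda>n. \<Sum>j<n. Wc j k * f k)" by (intro ext) (simp only: cfc_blk)
  moreover have "(\<lambda>n. \<Sum>j<n. Wc j k * f k) \<longlonglongrightarrow> f k"
    using sums_mult2[OF sums_of_real[OF W_sums[of k]], of "f k"] by (simp add: sums_def)
  ultimately have "J = f k" using lim LIMSEQ_unique by blast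
  moreover have "(\<Sum>j. blk j f x * ?e x) = synth f x * ?e x" for x
    unfolding synth_def
    by (rule suminf_mult2[symmetric])
       (rule summable_comparison_test[OF _ geom_summable], use blk_geom in auto)
  ultimately show "cfc (synth f) k = f k" unfolding cfc_def using J by (simp add: integral_unique)
qed

lemma coeff_le: "cmod (f k) \<le> c * cE \<beta>"
  using cfc_bound[of "synth f" "c * cE \<beta>" k] synth_bound continuous_on_subset[OF synth_continuous]
  by (simp add: cfc_synth)

end

lemma W_even: "W j (- k) = W j k"
  using part unfolding dyadic_partition_def lp_w_def by simp

lemma blk_real: "real_dist f \<Longrightarrow> cnj (blk j f x) = blk j f x"
proof -
  assume f: "real_dist f"
  have "cnj (blk j f x) = (\<Sum>k\<in>modes (2 * 2 ^ j). complex_of_real (W j (- k)) * f (- k) * ek (- k) x)"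
    unfolding blk_eq cnj_sum complex_cnj_mult cnj_ek W_even using f by (simp add: real_dist_def)
  also have "\<dots> = blk j f x" unfolding blk_eq
    by (rule sum.reindex_bij_witness[of _ uminus uminus]) auto
  finally show ?thesis .
qed

text \<open>The representative is the real part of \<open>synth f\<close>, which is already real
  since the dyadic weights are even.\<close>

lemma fun_of_props:
  assumes b: "\<beta> > 0" and f: "bnd \<beta> f c" and r: "real_dist f"
  shows "continuous_on UNIV (fun_of f)" "fun_of f (x + 1) = fun_of f x" "fc (fun_of f) = f" "\<bar>fun_of f x\<bar> \<le> c * cE \<beta>"
proof -
  let ?g = "\<lambda>x. Re (synth f x)"
  have cnj: "cnj (synth f x) = synth f x" for x
  proof -
    have "summable (\<lambda>j. blk j f x)"
      by (rule summable_comparison_test[OF _ geom_summable[OF b f]]) (use blk_geom[OF b f] in auto)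
    then have "(\<lambda>j. cnj (blk j f x)) sums cnj (synth f x)" unfolding synth_def sums_cnj by (rule summable_sums)
    then show ?thesis unfolding blk_real[OF r] synth_def by (simp add: sums_unique)
  qed
  have re: "complex_of_real (?g x) = synth f x" for x
    using cnj[of x] by (metis complex_is_Real_iff of_real_Re Reals_cnj_iff)
  have eq: "fun_of f = ?g"
    by (rule fun_of_eqI)
       (auto simp: fc_cfc re cfc_synth[OF b f] synth_periodic[OF b f] intro!: continuous_intros synth_continuous[OF b f])
  show "continuous_on UNIV (fun_of f)" unfolding eq by (intro continuous_intros synth_continuous[OF b f])
  show "fun_of f (x + 1) = fun_of f x" by (simp add: eq synth_periodic[OF b f])
  show "fc (fun_of f) = f" by (simp add: eq fc_cfc re cfc_synth[OF b f])
  show "\<bar>fun_of f x\<bar> \<le> c * cE \<beta>" unfolding eq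
    using abs_Re_le_cmod[of "synth f x"] synth_bound[OF b f, of x] by linarith
qed

lemma fun_of_dsub:
  assumes b: "\<beta> > 0" and f: "bnd \<beta> f c" "real_dist f" and g: "bnd \<beta> g d" "real_dist g"
  shows "fun_of (dsub f g) = (\<lambda>x. fun_of f x - fun_of g x)"
proof (rule fun_of_eqI)
  note F = fun_of_props[OF b f] and G = fun_of_props[OF b g]
  show "fc (\<lambda>x. fun_of f x - fun_of g x) = dsub f g"
    using fc_diff[OF F(1) G(1)] F(3) G(3) by simp
qed (use fun_of_props[OF b f] fun_of_props[OF b g] in \<open>auto intro!: continuous_intros\<close>)

section \<open>The cubic nonlinearity\<close>

abbreviation "cub u x \<equiv> (fun_of u x)\<^sup>2 * fun_of (dx_rho u) x"

text \<open>\<open>12 * Lw\<close> is the constant of \<open>blk_fc\<close>; 360 is three times the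
  120 of \<open>bnd_dx_rho\<close>, one for each of the three terms in a difference of cubic
  expressions.\<close>

definition cN :: "real \<Rightarrow> real" where
  "cN \<beta> = 12 * Lw * (360 * cE \<beta> ^ 3)"

lemma cN_pos: "\<beta> > 0 \<Longrightarrow> cN \<beta> > 0"
  unfolding cN_def using Lw cE_pos by simp

lemma bnd_nonlin:
  assumes b: "\<beta> > 0" and u: "bnd \<beta> u c" "real_dist u"
  shows "bnd 0 (nonlin u) (cN \<beta> * c ^ 3)"
proof -
  note U = fun_of_props[OF b u] and V = fun_of_props[OF b bnd_dx_rho[OF u(1)] real_dist_dx_rho[OF u(2)]]
  have E: "cE \<beta> > 0" by (rule cE_pos[OF b])
  have c: "c \<ge> 0" by (rule bnd_nonneg[OF u(1)])
  have "bnd 0 (nonlin u) (12 * Lw * (120 * cE \<beta> ^ 3 * c ^ 3))"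
    unfolding nonlin_def
  proof (rule bnd_fc)
    show "continuous_on UNIV (\<lambda>x. cub u x)"
      by (intro continuous_intros U V)
    fix x
    have "\<bar>cub u x\<bar> \<le> (c * cE \<beta>)\<^sup>2 * (120 * c * cE \<beta>)"
      unfolding abs_mult power_abs by (intro mult_mono power_mono U V) auto
    also have "\<dots> = 120 * cE \<beta> ^ 3 * c ^ 3" by (simp add: power2_eq_square power3_eq_cube)
    finally show "\<bar>cub u x\<bar> \<le> 120 * cE \<beta> ^ 3 * c ^ 3" .
  qed
  then show ?thesis
    by (rule bnd_weaken) (use E c Lw in \<open>simp add: cN_def mult_right_mono\<close>)
qed

lemma bnd_nonlin_diff:
  assumes b: "\<beta> > 0" and u: "bnd \<beta> u M" "real_dist u" and v: "bnd \<beta> v M" "real_dist v"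
    and d: "bnd \<beta> (dsub u v) d"
  shows "bnd 0 (dsub (nonlin u) (nonlin v)) (cN \<beta> * M\<^sup>2 * d)"
proof -
  note U = fun_of_props[OF b u] and V = fun_of_props[OF b v]
  note U' = fun_of_props[OF b bnd_dx_rho[OF u(1)] real_dist_dx_rho[OF u(2)]]
  note V' = fun_of_props[OF b bnd_dx_rho[OF v(1)] real_dist_dx_rho[OF v(2)]]
  have rd: "real_dist (dsub u v)" by (rule real_dist_dsub[OF u(2) v(2)])
  note D = fun_of_props[OF b d rd] and D' = fun_of_props[OF b bnd_dx_rho[OF d] real_dist_dx_rho[OF rd]]
  have E: "cE \<beta> > 0" by (rule cE_pos[OF b])
  have M: "M \<ge> 0" by (rule bnd_nonneg[OF u(1)])
  have d0: "d \<ge> 0" by (rule bnd_nonneg[OF d])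
  let ?e = "cE \<beta>"
  have "dsub (nonlin u) (nonlin v) = fc (\<lambda>x. cub u x - cub v x)"
    unfolding nonlin_def by (rule fc_diff[symmetric]) (intro continuous_intros U V U' V')+
  moreover have "bnd 0 (fc (\<lambda>x. cub u x - cub v x)) (12 * Lw * (360 * ?e ^ 3 * M\<^sup>2 * d))"
  proof (rule bnd_fc)
    show "continuous_on UNIV (\<lambda>x. cub u x - cub v x)"
      by (intro continuous_intros U V U' V')
    fix x
    have du: "fun_of (dsub u v) x = fun_of u x - fun_of v x"
      by (simp add: fun_of_dsub[OF b u v])
    have du': "fun_of (dx_rho (dsub u v)) x = fun_of (dx_rho u) x - fun_of (dx_rho v) x"
      unfolding dx_rho_dsub
      by (simp add: fun_of_dsub[OF b bnd_dx_rho[OF u(1)] real_dist_dx_rho[OF u(2)] bnd_dx_rho[OF v(1)] real_dist_dx_rho[OF v(2)]])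
    have "cub u x - cub v x
       = fun_of (dsub u v) x * (fun_of u x + fun_of v x) * fun_of (dx_rho u) x + (fun_of v x)\<^sup>2 * fun_of (dx_rho (dsub u v)) x"
      unfolding du du' by (simp add: algebra_simps power2_eq_square)
    also have "\<bar>\<dots>\<bar> \<le> (d * ?e) * (M * ?e + M * ?e) * (120 * M * ?e) + (M * ?e)\<^sup>2 * (120 * d * ?e)"
      using E M d0
      by (intro order_trans[OF abs_triangle_ineq] add_mono; unfold abs_mult power_abs;
          intro mult_mono power_mono order_trans[OF abs_triangle_ineq] add_mono U V U' V' D D') auto
    also have "\<dots> = 360 * ?e ^ 3 * M\<^sup>2 * d" by (simp add: power2_eq_square power3_eq_cube)
    finally show "\<bar>cub u x - cub v x\<bar> \<le> 360 * ?e ^ 3 * M\<^sup>2 * d" .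
  qed
  ultimately show ?thesis by (simp add: cN_def mult_ac)
qed

end

section \<open>Duhamel integrals\<close>

lemma beta_integral:
  assumes a: "a < 1" and b: "b < 1" and t: "t > (0::real)"
  shows "((\<lambda>s. (t - s) powr (- a) * s powr (- b)) has_integral (Beta (1 - b) (1 - a) * t powr (1 - a - b))) {0..t}"
proof -
  have "((\<lambda>s. s powr (1 - b - 1) * (1 - s) powr (1 - a - 1)) has_integral Beta (1 - b) (1 - a)) (cbox 0 1)"
    using has_integral_Beta_real[of "1 - b" "1 - a"] a b by simp
  from has_integral_affinity'[OF this, of "1 / t" 0]
  have "((\<lambda>s. (s / t) powr (- b) * (1 - s / t) powr (- a)) has_integral (t * Beta (1 - b) (1 - a))) {0..t}"
    using t by (simp add: divide_simps)
  then have "((\<lambda>s. t powr (- a - b) * ((s / t) powr (- b) * (1 - s / t) powr (- a))) has_integral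
      (t powr (- a - b) * (t * Beta (1 - b) (1 - a)))) {0..t}"
    by (rule has_integral_mult_right)
  also have "t powr (- a - b) * (t * Beta (1 - b) (1 - a)) = Beta (1 - b) (1 - a) * t powr (1 - a - b)"
  proof -
    have "t powr (1 + (- a - b)) = t * t powr (- a - b)" using t by (simp only: powr_add) simp
    then show ?thesis by (simp add: algebra_simps)
  qed
  finally show ?thesis
  proof (rule has_integral_eq[rotated])
    fix s assume s: "s \<in> {0..t}"
    have "1 - s / t = (t - s) / t" using t by (simp add: field_simps)
    moreover have "t powr (- a - b) = t powr (- a) * t powr (- b)" by (simp add: powr_add[symmetric])
    ultimately show "t powr (- a - b) * ((s / t) powr (- b) * (1 - s / t) powr (- a)) = (t - s) powr (- a) * s powr (- b)"
      using s t by (simp add: powr_divide)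
  qed
qed

lemma Beta_real_pos: "a > 0 \<Longrightarrow> b > 0 \<Longrightarrow> Beta a (b::real) > 0"
  by (simp add: Beta_def Gamma_real_pos)

lemma powr_tail_integral:
  assumes a: "a < 1" and t: "r \<le> (t::real)"
  shows "((\<lambda>s. (t - s) powr (- a)) has_integral ((t - r) powr (1 - a) / (1 - a))) {r..t}"
proof -
  have "((\<lambda>s. s powr (- a)) has_integral ((t - r) powr (1 - a) / (1 - a))) (cbox 0 (t - r))"
    using has_integral_powr_from_0[of "- a" "t - r"] a t by (simp add: algebra_simps)
  from has_integral_affinity[OF this, of "- 1" t]
  have "((\<lambda>s. (t - s) powr (- a)) has_integral ((t - r) powr (1 - a) / (1 - a))) ((\<lambda>x. t - x) ` {0..t - r})"
    by simp
  moreover have "(\<lambda>x. t - x) ` {0..t - r} = {r..t}"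
    using image_affinity_atLeastAtMost[of "- 1" t 0 "t - r"] t by simp
  ultimately show ?thesis by simp
qed

text \<open>Integrated coefficient by coefficient, as in \<open>mild_sol\<close>. The lower limit is
  free so that the integral can be restarted at a positive time.\<close>

definition duh :: "(real \<Rightarrow> tdist) \<Rightarrow> real \<Rightarrow> real \<Rightarrow> tdist" where
  "duh F a t k = integral {a..t} (\<lambda>s. heat (t - s) (F s) k)"

lemma real_dist_duh:
  assumes "\<And>s. s \<in> {a..t} \<Longrightarrow> real_dist (F s)"
  shows "real_dist (duh F a t)"
  unfolding real_dist_def duh_def
  using real_dist_heat[OF assms] by (auto simp: real_dist_def integral_cnj intro!: integral_cong)

lemma heat_heat: "heat s (heat t f) = heat (s + t) f"
proof
  fix k
  have "exp (- 4 * pi\<^sup>2 * (real_of_int k)\<^sup>2 * (s + t)) = gauss s (real_of_int k) * gauss t (real_of_int k)"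
    unfolding exp_add[symmetric] distrib_left ..
  then show "heat s (heat t f) k = heat (s + t) f k" by (simp add: heat_def)
qed

lemma heat_dadd: "heat t (dadd f g) = dadd (heat t f) (heat t g)"
  by (simp add: heat_def dadd_def algebra_simps)

text \<open>Restart at time \<open>r\<close> by the semigroup law; continuity in time rests on
  it.\<close>

lemma duh_split:
  assumes "0 \<le> r" "r \<le> t" and int: "(\<lambda>s. heat (t - s) (F s) k) integrable_on {0..t}"
  shows "duh F 0 t k = heat (t - r) (duh F 0 r) k + duh F r t k"
proof -
  have "duh F 0 t k = integral {0..r} (\<lambda>s. heat (t - s) (F s) k) + duh F r t k"
    unfolding duh_def using assms
    by (intro Henstock_Kurzweil_Integration.integral_combine[symmetric]) auto
  also have "integral {0..r} (\<lambda>s. heat (t - s) (F s) k) = integral {0..r} (\<lambda>s. heat (t - r) (heat (r - s) (F s)) k)"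
    unfolding heat_heat by simp
  also have "\<dots> = heat (t - r) (duh F 0 r) k"
    unfolding heat_def[of "t - r"] duh_def by simp
  finally show ?thesis .
qed

context lp
begin

text \<open>A block is a finite sum of modes and so commutes with the coefficientwise integral; the
  norm inequality is then applied for each \<open>x\<close>. The open interval is used because the
  bound is known only for \<open>a < s\<close> and \<open>s < t\<close>.\<close>

lemma duh_bnd:
  assumes int: "\<And>k. (\<lambda>s. heat (t - s) (F s) k) integrable_on {a..t}"
    and b: "\<And>s. a < s \<Longrightarrow> s < t \<Longrightarrow> bnd \<sigma> (heat (t - s) (F s)) (q s)"
    and q: "(q has_integral I) {a..t}"
  shows "bnd \<sigma> (duh F a t) I"
  unfolding bnd_def
proof (intro allI)
  fix j x
  let ?c = "dyw j \<sigma>"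
  have int': "(\<lambda>s. heat (t - s) (F s) k) integrable_on {a<..<t}" for k
    using int[of k] unfolding integrable_on_Icc_iff_Ioo .
  have q': "(q has_integral I) {a<..<t}" using q unfolding has_integral_Icc_iff_Ioo .
  have "((\<lambda>s. blk j (heat (t - s) (F s)) x) has_integral blk j (duh F a t) x) {a<..<t}"
    unfolding blk_eq duh_def integral_open_interval_real
    by (intro has_integral_sum has_integral_mult_left has_integral_mult_right integrable_integral int') auto
  then have "cmod (blk j (duh F a t) x) \<le> integral {a<..<t} (\<lambda>s. q s * ?c)"
    using integral_norm_bound_integral[of "\<lambda>s. blk j (heat (t - s) (F s)) x" "{a<..<t}" "\<lambda>s. q s * ?c"]
      has_integral_mult_left[OF q', of ?c] bndD[OF b]
    by (auto simp: has_integral_integrable integral_unique)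
  also have "\<dots> = I * ?c" using has_integral_mult_left[OF q', of ?c] by (rule integral_unique)
  finally show "cmod (blk j (duh F a t) x) \<le> I * ?c" .
qed

lemma heat_integrable:
  assumes b: "\<And>s. a < s \<Longrightarrow> s < t \<Longrightarrow> bnd \<beta> (F s) (q s)"
    and c: "\<And>k. continuous_on {a<..<t} (\<lambda>s. F s k)"
    and q: "q integrable_on {a..t}"
  shows "(\<lambda>s. heat (t - s) (F s) k) integrable_on {a..t}"
proof -
  obtain C where C: "C \<ge> 0" "\<And>f c. bnd \<beta> f c \<Longrightarrow> cmod (f k) \<le> C * c" using coeff_bound[of \<beta> k] by blast
  have "(\<lambda>s. heat (t - s) (F s) k) integrable_on {a<..<t}"
  proof (rule measurable_bounded_by_integrable_imp_integrable)
    show "(\<lambda>s. heat (t - s) (F s) k) \<in> borel_measurable (lebesgue_on {a<..<t})"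
      unfolding heat_def by (intro continuous_imp_measurable_on_sets_lebesgue continuous_intros c) auto
    show "(\<lambda>s. C * q s) integrable_on {a<..<t}"
      using q unfolding integrable_on_Icc_iff_Ioo by (rule integrable_on_mult_right)
    fix s assume s: "s \<in> {a<..<t}"
    have "cmod (heat (t - s) (F s) k) \<le> 1 * cmod (F s k)"
      unfolding heat_def norm_mult using s by (intro mult_right_mono) auto
    also have "\<dots> \<le> C * q s" using C(2)[OF b] s by simp
    finally show "cmod (heat (t - s) (F s) k) \<le> C * q s" .
  qed auto
  then show ?thesis unfolding integrable_on_Icc_iff_Ioo .
qed

text \<open>The continuity part of \<open>cont_C\<close>, separated from membership in
  \<open>in_C\<close> so that iterates can be handled by bounds alone.\<close>

definition contb :: "real \<Rightarrow> real set \<Rightarrow> (real \<Rightarrow> tdist) \<Rightarrow> bool" where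
  "contb \<beta> I u \<longleftrightarrow> (\<forall>s0\<in>I. \<forall>e>0. \<exists>d>0. \<forall>s\<in>I. \<bar>s - s0\<bar> < d \<longrightarrow> bnd \<beta> (dsub (u s) (u s0)) e)"

lemma contb_dadd:
  assumes "contb \<beta> I u" "contb \<beta> I v"
  shows "contb \<beta> I (\<lambda>s. dadd (u s) (v s))"
  unfolding contb_def
proof (intro ballI allI impI)
  fix s0 e :: real assume s0: "s0 \<in> I" and e: "e > 0"
  obtain d1 where d1: "d1 > 0" "\<And>s. s \<in> I \<Longrightarrow> \<bar>s - s0\<bar> < d1 \<Longrightarrow> bnd \<beta> (dsub (u s) (u s0)) (e / 2)"
    using assms(1) s0 e unfolding contb_def by (meson half_gt_zero)
  obtain d2 where d2: "d2 > 0" "\<And>s. s \<in> I \<Longrightarrow> \<bar>s - s0\<bar> < d2 \<Longrightarrow> bnd \<beta> (dsub (v s) (v s0)) (e / 2)"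
    using assms(2) s0 e unfolding contb_def by (meson half_gt_zero)
  have eq: "dsub (dadd (u s) (v s)) (dadd (u s0) (v s0)) = dadd (dsub (u s) (u s0)) (dsub (v s) (v s0))" for s
    by (simp add: dsub_def dadd_def algebra_simps)
  show "\<exists>d>0. \<forall>s\<in>I. \<bar>s - s0\<bar> < d \<longrightarrow> bnd \<beta> (dsub (dadd (u s) (v s)) (dadd (u s0) (v s0))) e"
  proof (intro exI[of _ "min d1 d2"] conjI ballI impI)
    fix s assume "s \<in> I" "\<bar>s - s0\<bar> < min d1 d2"
    then show "bnd \<beta> (dsub (dadd (u s) (v s)) (dadd (u s0) (v s0))) e"
      unfolding eq using bnd_dadd[OF d1(2) d2(2), of s s] by simp
  qed (use d1 d2 in auto)
qed

lemma contb_subset: "contb \<beta> I u \<Longrightarrow> J \<subseteq> I \<Longrightarrow> contb \<beta> J u"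
  unfolding contb_def by (meson subset_iff)

lemma contb_exponent:
  assumes u: "contb \<beta>' I u" and "\<beta> \<le> \<beta>'" "\<beta>' \<le> \<beta> + 1"
  shows "contb \<beta> I u"
  unfolding contb_def
proof (intro ballI allI impI)
  fix s0 e :: real assume s0: "s0 \<in> I" and e: "e > 0"
  obtain d1 where d1: "d1 > 0" "\<And>s. s \<in> I \<Longrightarrow> \<bar>s - s0\<bar> < d1 \<Longrightarrow> bnd \<beta>' (dsub (u s) (u s0)) (e / 2)"
    using u s0 e unfolding contb_def by (meson half_gt_zero)
  then show "\<exists>d>0. \<forall>s\<in>I. \<bar>s - s0\<bar> < d \<longrightarrow> bnd \<beta> (dsub (u s) (u s0)) e"
    using bnd_exponent[OF d1(2) assms(2,3)] by fastforce
qed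

lemma bnd_dsub_commute: "bnd \<beta> (dsub f g) c \<longleftrightarrow> bnd \<beta> (dsub g f) c"
  unfolding bnd_def blk_dsub by (simp add: norm_minus_commute)

text \<open>A Hoelder modulus away from time zero is enough: at \<open>s0\<close> it is used with
  \<open>a = s0 / 2\<close>, on a neighbourhood that stays above that value.\<close>

lemma contb_modulus:
  assumes "\<And>a. a > 0 \<Longrightarrow> \<exists>C r. r > 0 \<and> (\<forall>s t. a \<le> s \<longrightarrow> s < t \<longrightarrow> t \<le> S \<longrightarrow> bnd \<beta> (dsub (u t) (u s)) (C * (t - s) powr r))"
  shows "contb \<beta> {0<..S} u"
  unfolding contb_def
proof (intro ballI allI impI)
  fix s0 e :: real assume s0: "s0 \<in> {0<..S}" and e: "e > 0"
  obtain C r where r: "r > 0" and C: "\<And>s t. s0 / 2 \<le> s \<Longrightarrow> s < t \<Longrightarrow> t \<le> S \<Longrightarrow> bnd \<beta> (dsub (u t) (u s)) (C * (t - s) powr r)"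
    using assms[of "s0 / 2"] s0 by auto
  obtain \<tau> where \<tau>: "\<tau> > 0" "\<And>h. 0 < h \<Longrightarrow> h \<le> \<tau> \<Longrightarrow> \<bar>C\<bar> * h powr r \<le> e"
    using powr_small[of "\<bar>C\<bar>" r e] r e by auto
  define d where "d = min (s0 / 2) \<tau>"
  have d: "d > 0" using s0 \<tau> by (simp add: d_def)
  have small: "C * h powr r \<le> e" if "0 < h" "h < d" for h
  proof -
    have "C * h powr r \<le> \<bar>C\<bar> * h powr r" by (intro mult_right_mono) auto
    moreover have "h \<le> \<tau>" using that by (simp add: d_def)
    ultimately show ?thesis using \<tau>(2)[of h] that(1) by linarith
  qed
  show "\<exists>d>0. \<forall>s\<in>{0<..S}. \<bar>s - s0\<bar> < d \<longrightarrow> bnd \<beta> (dsub (u s) (u s0)) e"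
  proof (intro exI[of _ d] conjI ballI impI d)
    fix s assume s: "s \<in> {0<..S}" "\<bar>s - s0\<bar> < d"
    have sd: "s0 / 2 \<le> s" using s(2) s0 unfolding d_def by (auto simp: abs_if split: if_splits)
    consider "s = s0" | "s < s0" | "s > s0" by linarith
    then show "bnd \<beta> (dsub (u s) (u s0)) e"
    proof cases
      case 1
      then show ?thesis using e bnd_zero[of e \<beta>] by (simp add: dsub_def)
    next
      case 2
      then show ?thesis using bnd_weaken[OF C[OF sd 2] small] s s0 unfolding bnd_dsub_commute[of _ "u s"] by auto
    next
      case 3
      then show ?thesis using bnd_weaken[OF C[of s0 s] small] s s0 by auto
    qed
  qed
qed

lemma contb_nonlin:
  assumes b: "\<beta> > 0" and u: "contb \<beta> I u" and r: "\<And>s. s \<in> I \<Longrightarrow> real_dist (u s)"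
    and bd: "\<And>s. s \<in> I \<Longrightarrow> bnd \<beta> (u s) (m s)"
  shows "continuous_on I (\<lambda>s. nonlin (u s) k)"
  unfolding continuous_on_iff
proof (intro ballI allI impI)
  fix s0 e :: real assume s0: "s0 \<in> I" and e: "e > 0"
  obtain C where C: "C \<ge> 0" "\<And>f c. bnd 0 f c \<Longrightarrow> cmod (f k) \<le> C * c" using coeff_bound[of 0 k] by blast
  \<comment> \<open>The added 1 makes \<open>M\<close> a bound also for nearby times, since
    \<open>e'\<close> is at most 1.\<close>
  define M where "M = m s0 + 1"
  have m0: "m s0 \<ge> 0" by (rule bnd_nonneg[OF bd[OF s0]])
  define D where "D = C * (cN \<beta> * M\<^sup>2) + 1"
  have D: "D > 0" unfolding D_def using C(1) cN_pos[OF b]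
    by (intro add_nonneg_pos mult_nonneg_nonneg) auto
  define e' where "e' = min 1 (e / (2 * D))"
  have e': "e' > 0" "e' \<le> 1" "e' \<le> e / (2 * D)" using e D by (auto simp: e'_def)
  obtain d where d: "d > 0" "\<And>s. s \<in> I \<Longrightarrow> \<bar>s - s0\<bar> < d \<Longrightarrow> bnd \<beta> (dsub (u s) (u s0)) e'"
    using u s0 e'(1) unfolding contb_def by blast
  show "\<exists>d>0. \<forall>x'\<in>I. dist x' s0 < d \<longrightarrow> dist (nonlin (u x') k) (nonlin (u s0) k) < e"
  proof (intro exI[of _ d] conjI ballI impI d(1))
    fix s assume s: "s \<in> I" "dist s s0 < d"
    then have ds: "bnd \<beta> (dsub (u s) (u s0)) e'" by (intro d(2)) (auto simp: dist_real_def)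
    have "bnd \<beta> (dadd (dsub (u s) (u s0)) (u s0)) (e' + m s0)" by (rule bnd_dadd[OF ds bd[OF s0]])
    then have 1: "bnd \<beta> (u s) M" using e' by (auto simp: M_def dadd_def dsub_def elim!: bnd_weaken)
    have 2: "bnd \<beta> (u s0) M" by (rule bnd_weaken[OF bd[OF s0]]) (simp add: M_def)
    have "cmod (dsub (nonlin (u s)) (nonlin (u s0)) k) \<le> C * (cN \<beta> * M\<^sup>2 * e')"
      by (rule C(2)[OF bnd_nonlin_diff[OF b 1 r[OF s(1)] 2 r[OF s0] ds]])
    also have "\<dots> \<le> D * e'" using e' by (simp add: D_def algebra_simps)
    also have "\<dots> \<le> D * (e / (2 * D))" using e' D by (intro mult_left_mono) auto
    also have "\<dots> < e" using D e by simp
    finally show "dist (nonlin (u s) k) (nonlin (u s0) k) < e" by (simp add: dist_norm dsub_def)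
  qed
qed

section \<open>The forcing term\<close>

definition force :: "real \<Rightarrow> (real \<Rightarrow> tdist) \<Rightarrow> real \<Rightarrow> tdist" where
  "force chi u s = (\<lambda>k. complex_of_real chi * (2 * pi * \<i> * of_int k) * nonlin (u s) k)"

lemma force_dx: "force chi u s = dx (\<lambda>k. complex_of_real chi * nonlin (u s) k)"
  by (simp add: force_def dx_def fun_eq_iff)

lemma real_dist_force: "real_dist (force chi u s)"
proof -
  have "real_dist (nonlin (u s))" unfolding nonlin_def by (rule real_dist_fc)
  then show ?thesis unfolding force_dx by (intro real_dist_dx) (simp add: real_dist_def)
qed

abbreviation cH :: real where "cH \<equiv> 221184"

lemma bnd_heat_force:
  assumes n: "bnd 0 (nonlin (u s)) c" and t: "0 < t" "t \<le> 1" and s: "- 1 \<le> \<sigma>" "\<sigma> \<le> 1"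
  shows "bnd \<sigma> (heat t (force chi u s)) (cH * \<bar>chi\<bar> * t powr (- ((1 + \<sigma>) / 2)) * c)"
  using bnd_heat_dx[OF bnd_scale[OF n, of "complex_of_real chi"] t, of \<sigma>] s
  unfolding force_dx by (simp add: mult_ac minus_divide_left)

lemma bnd_heat_force_diff:
  assumes n: "bnd 0 (dsub (nonlin (u s)) (nonlin (v s))) c" and t: "0 < t" "t \<le> 1" and s: "- 1 \<le> \<sigma>" "\<sigma> \<le> 1"
  shows "bnd \<sigma> (heat t (dsub (force chi u s) (force chi v s))) (cH * \<bar>chi\<bar> * t powr (- ((1 + \<sigma>) / 2)) * c)"
proof -
  have "dsub (force chi u s) (force chi v s) = dx (\<lambda>k. complex_of_real chi * dsub (nonlin (u s)) (nonlin (v s)) k)"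
    by (simp add: force_def dx_def dsub_def fun_eq_iff algebra_simps)
  then show ?thesis
    using bnd_heat_dx[OF bnd_scale[OF n, of "complex_of_real chi"] t, of \<sigma>] s
    by (simp add: mult_ac minus_divide_left)
qed

lemma force_integrable:
  assumes \<beta>: "\<beta> > 0" and u: "contb \<beta> {0<..S} u" "\<And>s. s \<in> {0<..S} \<Longrightarrow> real_dist (u s)"
    "\<And>s. s \<in> {0<..S} \<Longrightarrow> bnd \<beta> (u s) (m s)"
    and K: "\<And>s. s \<in> {0<..S} \<Longrightarrow> m s ^ 3 \<le> K * s powr (- b)" and b: "b < 1" and t: "0 < t" "t \<le> S"
  shows "(\<lambda>s. heat (t - s) (force chi u s) k) integrable_on {0..t}"
proof (cases "chi = 0")
  case True
  then show ?thesis by (simp add: force_def heat_def integrable_0)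
next
  case False
  have N: "(\<lambda>s. heat (t - s) (nonlin (u s)) k) integrable_on {0..t}"
  proof (rule heat_integrable[of 0 t 0])
    show "bnd 0 (nonlin (u s)) (cN \<beta> * (K * s powr (- b)))" if "0 < s" "s < t" for s
    proof (rule bnd_weaken[OF bnd_nonlin[OF \<beta> u(3) u(2)]])
      show "cN \<beta> * m s ^ 3 \<le> cN \<beta> * (K * s powr (- b))"
        using K[of s] cN_pos[OF \<beta>] that t by (intro mult_left_mono) auto
    qed (use that t in auto)
    show "continuous_on {0<..<t} (\<lambda>s. nonlin (u s) k)" for k
      by (rule contb_nonlin[OF \<beta> contb_subset[OF u(1)] u(2) u(3)]) (use t in auto)
    have "(\<lambda>s. s powr (- b)) integrable_on {0..t}"
      using has_integral_powr_from_0[of "- b" t] b t by (auto intro: has_integral_integrable)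
    then show "(\<lambda>s. cN \<beta> * (K * s powr (- b))) integrable_on {0..t}"
      by (intro integrable_on_mult_right)
  qed
  have "heat (t - s) (force chi u s) k = (complex_of_real chi * (2 * pi * \<i> * of_int k)) * heat (t - s) (nonlin (u s)) k" for s
    by (simp add: heat_def force_def)
  then show ?thesis using integrable_on_mult_right[OF N] by simp
qed

text \<open>Two singularities meet: smoothing from regularity 0 to \<open>\<sigma>\<close> costs
  \<open>(1 + \<sigma>) / 2\<close> at \<open>r = t\<close>, the cubic growth of \<open>u\<close>
  costs \<open>b\<close> at \<open>r = 0\<close>. Both exponents are below one, and a Beta integral
  results.\<close>

lemma duh_force_bnd:
  assumes \<beta>: "\<beta> > 0" and u: "contb \<beta> {0<..S} u" "\<And>s. s \<in> {0<..S} \<Longrightarrow> real_dist (u s)"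
    "\<And>s. s \<in> {0<..S} \<Longrightarrow> bnd \<beta> (u s) (m s)"
    and K: "\<And>s. s \<in> {0<..S} \<Longrightarrow> m s ^ 3 \<le> K * s powr (- b)" and b: "b < 1" and t: "0 < t" "t \<le> S" "S \<le> 1"
    and s: "- 1 \<le> \<sigma>" "\<sigma> < 1"
  shows "bnd \<sigma> (duh (force chi u) 0 t)
    (cH * \<bar>chi\<bar> * cN \<beta> * K * (Beta (1 - b) (1 - (1 + \<sigma>) / 2) * t powr (1 - (1 + \<sigma>) / 2 - b)))"
proof (rule duh_bnd[OF force_integrable[OF \<beta> u K b t(1,2)]])
  show "bnd \<sigma> (heat (t - r) (force chi u r)) (cH * \<bar>chi\<bar> * cN \<beta> * K * ((t - r) powr (- ((1 + \<sigma>) / 2)) * r powr (- b)))"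
    if r: "0 < r" "r < t" for r
  proof -
    have "bnd 0 (nonlin (u r)) (cN \<beta> * (K * r powr (- b)))"
    proof (rule bnd_weaken[OF bnd_nonlin[OF \<beta> u(3) u(2)]])
      show "cN \<beta> * m r ^ 3 \<le> cN \<beta> * (K * r powr (- b))"
        using K[of r] cN_pos[OF \<beta>] r t by (intro mult_left_mono) auto
    qed (use r t in auto)
    from bnd_heat_force[where u = u and s = r and t = "t - r" and \<sigma> = \<sigma> and chi = chi, OF this] show ?thesis
      using r t s by (simp add: mult_ac)
  qed
  show "((\<lambda>r. cH * \<bar>chi\<bar> * cN \<beta> * K * ((t - r) powr (- ((1 + \<sigma>) / 2)) * r powr (- b))) has_integral
     cH * \<bar>chi\<bar> * cN \<beta> * K * (Beta (1 - b) (1 - (1 + \<sigma>) / 2) * t powr (1 - (1 + \<sigma>) / 2 - b))) {0..t}"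
    by (intro has_integral_mult_right beta_integral) (use b s t in auto)
qed

text \<open>Away from time zero the singular factor is frozen at its value for \<open>a\<close>. The
  remaining positive power of \<open>t - r\<close> becomes the modulus of continuity in
  time.\<close>

lemma duh_force_tail:
  assumes \<beta>: "\<beta> > 0" and u: "contb \<beta> {0<..S} u" "\<And>s. s \<in> {0<..S} \<Longrightarrow> real_dist (u s)"
    "\<And>s. s \<in> {0<..S} \<Longrightarrow> bnd \<beta> (u s) (m s)"
    and K: "\<And>s. s \<in> {0<..S} \<Longrightarrow> m s ^ 3 \<le> K * s powr (- b)" and b: "0 \<le> b" "b < 1" and K0: "K \<ge> 0"
    and t: "0 < a" "a \<le> r" "r < t" "t \<le> S" "S \<le> 1"
    and s: "- 1 \<le> \<sigma>" "\<sigma> < 1"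
  shows "bnd \<sigma> (duh (force chi u) r t)
    (cH * \<bar>chi\<bar> * (cN \<beta> * (K * a powr (- b))) * ((t - r) powr (1 - (1 + \<sigma>) / 2) / (1 - (1 + \<sigma>) / 2)))"
proof (rule duh_bnd)
  have "(\<lambda>s. heat (t - s) (force chi u s) k) integrable_on {0..t}" for k
    by (rule force_integrable[OF \<beta> u K b(2)]) (use t in auto)
  then show "(\<lambda>s. heat (t - s) (force chi u s) k) integrable_on {r..t}" for k
    by (rule integrable_on_subinterval) (use t in auto)
  show "bnd \<sigma> (heat (t - s) (force chi u s)) (cH * \<bar>chi\<bar> * (cN \<beta> * (K * a powr (- b))) * (t - s) powr (- ((1 + \<sigma>) / 2)))"
    if r': "r < s" "s < t" for s
  proof -
    have "bnd 0 (nonlin (u s)) (cN \<beta> * (K * a powr (- b)))"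
    proof (rule bnd_weaken[OF bnd_nonlin[OF \<beta> u(3) u(2)]])
      have "s powr (- b) \<le> a powr (- b)" using r' t b by (intro powr_mono2') auto
      then have "K * s powr (- b) \<le> K * a powr (- b)" using K0 by (intro mult_left_mono)
      then show "cN \<beta> * m s ^ 3 \<le> cN \<beta> * (K * a powr (- b))"
        using K[of s] cN_pos[OF \<beta>] r' t by (intro mult_left_mono) auto
    qed (use r' t in auto)
    from bnd_heat_force[where u = u and s = s and t = "t - s" and \<sigma> = \<sigma> and chi = chi, OF this] show ?thesis
      using r' t s by (simp add: mult_ac)
  qed
  show "((\<lambda>x. cH * \<bar>chi\<bar> * (cN \<beta> * (K * a powr (- b))) * (t - x) powr (- ((1 + \<sigma>) / 2))) has_integral
     cH * \<bar>chi\<bar> * (cN \<beta> * (K * a powr (- b))) * ((t - r) powr (1 - (1 + \<sigma>) / 2) / (1 - (1 + \<sigma>) / 2))) {r..t}"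
    by (intro has_integral_mult_right powr_tail_integral) (use s t in auto)
qed

end

section \<open>Smooth approximation and passage to limits\<close>

lemma gauss_poly_bound:
  fixes a :: real
  assumes a: "a > 0"
  shows "\<exists>C\<ge>0. \<forall>x\<ge>0. exp (- a * x\<^sup>2) \<le> C / (1 + x) ^ N"
proof -
  \<comment> \<open>One term of the exponential series gives the polynomial decay; since
    \<open>x \<le> 1 + x\<^sup>2\<close>, the quantity \<open>min a 1 * (1 + x)\<close> is at most
    \<open>1 + a + a * x\<^sup>2\<close>.\<close>
  define C where "C = exp (1 + a) * fact N / (min a 1) ^ N"
  define m where "m = min a 1"
  have m: "0 < m" "m \<le> a" "m \<le> 1" using a by (auto simp: m_def)
  have "exp (- a * x\<^sup>2) \<le> C / (1 + x) ^ N" if x: "x \<ge> 0" for x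
  proof -
    have "m * (1 + x) \<le> 1 + a + a * x\<^sup>2"
    proof -
      have "0 \<le> (x - 1)\<^sup>2" by simp
      then have "x \<le> 1 + x\<^sup>2" using x by (simp add: power2_diff)
      then have "m * x \<le> a * (1 + x\<^sup>2)" using m x by (intro mult_mono) auto
      then show ?thesis using m by (simp add: algebra_simps)
    qed
    moreover have "(m * (1 + x)) ^ N / fact N \<le> exp (m * (1 + x))"
    proof -
      have "(\<Sum>i\<in>{N}. (m * (1 + x)) ^ i /\<^sub>R fact i) \<le> exp (m * (1 + x))"
        unfolding exp_def using m x by (intro sum_le_suminf summable_exp_generic) auto
      then show ?thesis by (simp add: divide_inverse mult.commute)
    qed
    ultimately have "(m * (1 + x)) ^ N / fact N \<le> exp (1 + a + a * x\<^sup>2)"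
      by (meson exp_le_cancel_iff order_trans)
    then have "(m * (1 + x)) ^ N \<le> fact N * exp (1 + a + a * x\<^sup>2)"
      by (simp add: pos_divide_le_eq mult.commute)
    then have "m ^ N * (1 + x) ^ N \<le> fact N * (exp (1 + a) * exp (a * x\<^sup>2))"
      unfolding power_mult_distrib exp_add[of "1 + a"] .
    then show ?thesis using m x by (simp add: C_def m_def[symmetric] exp_minus field_simps)
  qed
  moreover have "C \<ge> 0" using a by (simp add: C_def)
  ultimately show ?thesis by blast
qed

lemma smooth_dist_heat:
  assumes f: "\<And>k. cmod (f k) \<le> c" and t: "t > 0"
  shows "smooth_dist (heat t f)"
  unfolding smooth_dist_def
proof
  fix N :: nat
  obtain C where C: "C \<ge> 0" "\<And>x. x \<ge> 0 \<Longrightarrow> exp (- (4 * pi\<^sup>2 * t) * x\<^sup>2) \<le> C / (1 + x) ^ N"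
    using gauss_poly_bound[of "4 * pi\<^sup>2 * t" N] t by auto
  show "\<exists>C. \<forall>k. cmod (heat t f k) \<le> C / (1 + \<bar>real_of_int k\<bar>) ^ N"
  proof (intro exI[of _ "C * c"] allI)
    fix k :: int
    have "gauss t (real_of_int k) \<le> C / (1 + \<bar>real_of_int k\<bar>) ^ N"
      using C(2)[of "\<bar>real_of_int k\<bar>"] by (simp add: mult_ac)
    then have "gauss t (real_of_int k) * cmod (f k) \<le> C / (1 + \<bar>real_of_int k\<bar>) ^ N * c"
      using C(1) by (intro mult_mono f) auto
    then show "cmod (heat t f k) \<le> C * c / (1 + \<bar>real_of_int k\<bar>) ^ N"
      by (simp add: heat_def norm_mult)
  qed
qed

text \<open>The subtracted term lets the induction close by telescoping; what is used later is the
  uniform bound 4.\<close>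

lemma sum_inverse_squares_le: "(\<Sum>k\<in>modes n. 1 / (1 + \<bar>real_of_int k\<bar>)\<^sup>2) \<le> 4 - 2 / (1 + real n)"
proof (induction n)
  case 0
  then show ?case by simp
next
  case (Suc n)
  have set: "{-int (Suc n)..int (Suc n)} = insert (- int (Suc n)) (insert (int (Suc n)) (modes n))" by auto
  have "(\<Sum>k\<in>{-int (Suc n)..int (Suc n)}. 1 / (1 + \<bar>real_of_int k\<bar>)\<^sup>2)
    = 2 / (2 + real n)\<^sup>2 + (\<Sum>k\<in>modes n. 1 / (1 + \<bar>real_of_int k\<bar>)\<^sup>2)"
    unfolding set by (subst sum.insert; simp)+
  also have "\<dots> \<le> 2 / (2 + real n)\<^sup>2 + (4 - 2 / (1 + real n))" using Suc by simp
  also have "\<dots> \<le> 4 - 2 / (1 + real (Suc n))"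
  proof -
    have "2 / (2 + real n)\<^sup>2 \<le> 2 / ((1 + real n) * (2 + real n))"
      unfolding power2_eq_square by (intro divide_left_mono mult_right_mono) auto
    also have "\<dots> = 2 / (1 + real n) - 2 / (2 + real n)" by (simp add: field_simps)
    finally show ?thesis by simp
  qed
  finally show ?case .
qed

lemma cube_sum_le:
  fixes x y :: real
  assumes "0 \<le> x" "0 \<le> y"
  shows "(x + y) ^ 3 \<le> 4 * (x ^ 3 + y ^ 3)"
proof -
  \<comment> \<open>This is the difference of the two sides.\<close>
  have "0 \<le> 3 * (x + y) * (x - y)\<^sup>2" using assms by (intro mult_nonneg_nonneg) auto
  then show ?thesis by (simp add: power2_eq_square power3_eq_cube algebra_simps)
qed

context lp
begin

lemma smooth_bnd:
  assumes g: "smooth_dist g"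
  shows "\<exists>c. bnd 0 g c"
proof -
  obtain C where C: "\<And>k. cmod (g k) \<le> C / (1 + \<bar>real_of_int k\<bar>) ^ 2" using g unfolding smooth_dist_def by meson
  have C0: "C \<ge> 0" using order_trans[OF norm_ge_zero C[of 0]] by simp
  have "bnd 0 g (Lw * C * 4)"
    unfolding bnd_def
  proof (intro allI)
    fix j x
    have "cmod (blk j g x) \<le> (\<Sum>k\<in>modes (2 * 2 ^ j). Lw * (C * (1 / (1 + \<bar>real_of_int k\<bar>)\<^sup>2)))"
      unfolding blk_eq
    proof (rule order_trans[OF norm_sum sum_mono])
      fix k
      have "\<bar>W j k\<bar> * cmod (g k) \<le> Lw * (C * (1 / (1 + \<bar>real_of_int k\<bar>)\<^sup>2))"
        using C[of k] Lw by (intro mult_mono w_bound) auto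
      then show "cmod (Wc j k * g k * ek k x) \<le> Lw * (C * (1 / (1 + \<bar>real_of_int k\<bar>)\<^sup>2))"
        by (simp add: norm_mult)
    qed
    also have "\<dots> = Lw * (C * (\<Sum>k\<in>modes (2 * 2 ^ j). 1 / (1 + \<bar>real_of_int k\<bar>)\<^sup>2))"
      by (simp only: sum_distrib_left)
    also have "\<dots> \<le> Lw * (C * 4)"
    proof (intro mult_left_mono)
      have "0 \<le> 2 / (1 + real (2 * 2 ^ j))" by simp
      then show "(\<Sum>k\<in>modes (2 * 2 ^ j). 1 / (1 + \<bar>real_of_int k\<bar>)\<^sup>2) \<le> 4"
        using sum_inverse_squares_le[of "2 * 2 ^ j"] by linarith
    qed (use Lw C0 in auto)
    finally show "cmod (blk j g x) \<le> Lw * C * 4 * 2 powr (- (real j - 1) * 0)" by simp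
  qed
  then show ?thesis ..
qed

lemma in_C_bnd: "in_C \<rho>0 \<rho> \<beta> f \<Longrightarrow> bnd \<beta> f (besov_norm \<rho>0 \<rho> \<beta> f)"
  unfolding in_C_def by (blast intro: besov_bnd)

lemma in_C_real: "in_C \<rho>0 \<rho> \<beta> f \<Longrightarrow> real_dist f"
  unfolding in_C_def by blast

text \<open>The smooth approximants are \<open>heat t f\<close> for small \<open>t\<close>; the
  surplus regularity \<open>2 * d\<close> gives them a rate of convergence.\<close>

lemma in_C_if_bnd:
  assumes f: "bnd (\<beta> + 2 * d) f c" "real_dist f" and f': "bnd \<beta> f c'" and d: "0 < d" "d \<le> 1" "\<beta> > 0"
  shows "in_C \<rho>0 \<rho> \<beta> f"
  unfolding in_C_def
proof (intro conjI allI impI)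
  show "besov_bdd \<rho>0 \<rho> \<beta> f" by (rule bnd_besov(1)[OF f'])
  fix e :: real assume e: "e > 0"
  have c: "c \<ge> 0" by (rule bnd_nonneg[OF f(1)])
  obtain t where t: "0 < t" "t \<le> 1" and small: "16000 * c * t powr d \<le> e / 2"
    using powr_small[of "16000 * c" d "e / 2"] c d e by auto
  have b: "bnd \<beta> (dsub f (heat t f)) (16000 * t powr d * c)"
    using bnd_heat_diff[OF f(1) t] d unfolding bnd_dsub_commute[of _ f] by simp
  show "\<exists>g. smooth_dist g \<and> real_dist g \<and> besov_bdd \<rho>0 \<rho> \<beta> (dsub f g) \<and> besov_norm \<rho>0 \<rho> \<beta> (dsub f g) < e"
  proof (intro exI conjI)
    show "smooth_dist (heat t f)" by (rule smooth_dist_heat[OF coeff_le[OF d(3) f'] t(1)])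
    show "real_dist (heat t f)" by (rule real_dist_heat[OF f(2)])
    show "besov_bdd \<rho>0 \<rho> \<beta> (dsub f (heat t f))" by (rule bnd_besov(1)[OF b])
    show "besov_norm \<rho>0 \<rho> \<beta> (dsub f (heat t f)) < e" using bnd_besov(2)[OF b] small e by (simp add: mult_ac)
  qed
qed (use f in auto)

text \<open>At the regularity of \<open>z\<close> itself the flow has no rate, so \<open>z\<close>
  is split into a smooth part, which has one, and a remainder that is small uniformly in
  \<open>t\<close>.\<close>

lemma heat_tendsto:
  assumes z: "in_C \<rho>0 \<rho> \<beta> z" and b: "- 2 < \<beta>" "\<beta> < 0" and e: "e > 0"
  shows "\<exists>\<tau>>0. \<forall>t. 0 < t \<longrightarrow> t \<le> \<tau> \<longrightarrow> bnd \<beta> (dsub (heat t z) z) e"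
proof -
  \<comment> \<open>600 exceeds \<open>2 * 289\<close>, where \<open>289 = 288 + 1\<close> bounds
    the heat flow minus the identity on the remainder.\<close>
  obtain g where g: "smooth_dist g" "besov_bdd \<rho>0 \<rho> \<beta> (dsub z g)" "besov_norm \<rho>0 \<rho> \<beta> (dsub z g) < e / 600"
    using z e unfolding in_C_def by (meson divide_pos_pos zero_less_numeral)
  have r: "bnd \<beta> (dsub z g) (e / 600)"
    by (rule bnd_weaken[OF besov_bnd[OF g(2)]]) (use g in simp)
  obtain c where c: "bnd 0 g c" using smooth_bnd[OF g(1)] by blast
  have c0: "c \<ge> 0" by (rule bnd_nonneg[OF c])
  define d where "d = - \<beta> / 2"
  have d: "0 < d" "d \<le> 1" using b by (auto simp: d_def)
  obtain \<tau> where \<tau>: "\<tau> > 0" "\<tau> \<le> 1" "\<And>t. 0 < t \<Longrightarrow> t \<le> \<tau> \<Longrightarrow> 16000 * c * t powr d \<le> e / 2"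
    using powr_small[of "16000 * c" d "e / 2"] c0 d e by auto
  show ?thesis
  proof (intro exI[of _ \<tau>] conjI allI impI \<tau>(1))
    fix t assume t: "0 < t" "t \<le> \<tau>"
    then have t1: "t \<le> 1" using \<tau> by simp
    have small: "16000 * t powr d * c \<le> e / 2" using \<tau>(3)[OF t] by (simp add: mult_ac)
    have 1: "bnd \<beta> (dsub (heat t g) g) (16000 * t powr d * c)"
      by (rule bnd_heat_diff[OF _ t(1) t1]) (use c d in \<open>auto simp: d_def\<close>)
    have 2: "bnd \<beta> (dsub (heat t (dsub z g)) (dsub z g)) (288 * 1 * (e / 600) + e / 600)"
      using bnd_dsub[OF bnd_heat[OF r t(1) t1, of \<beta>] r] t(1) by simp
    have eq: "dsub (heat t z) z = dadd (dsub (heat t g) g) (dsub (heat t (dsub z g)) (dsub z g))"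
      by (simp add: dsub_def dadd_def heat_def fun_eq_iff algebra_simps)
    show "bnd \<beta> (dsub (heat t z) z) e"
      unfolding eq by (rule bnd_weaken[OF bnd_dadd[OF 1 2]]) (use small e in simp)
  qed
qed

text \<open>Each block involves finitely many modes, so bounds survive coefficientwise limits. This
  is the form in which completeness enters.\<close>

lemma bnd_limit:
  assumes lim: "\<And>k. (\<lambda>n. f n k) \<longlonglongrightarrow> g k" and b: "\<And>n. n \<ge> N \<Longrightarrow> bnd \<beta> (f n) c"
  shows "bnd \<beta> g c"
  unfolding bnd_def
proof (intro allI)
  fix j x
  have "(\<lambda>n. blk j (f n) x) \<longlonglongrightarrow> blk j g x"
    unfolding blk_eq by (intro tendsto_intros lim)
  then have "(\<lambda>n. cmod (blk j (f n) x)) \<longlonglongrightarrow> cmod (blk j g x)" by (rule tendsto_norm)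
  then show "cmod (blk j g x) \<le> c * dyw j \<beta>"
    by (rule LIMSEQ_le_const2) (use bndD[OF b] in blast)
qed

lemma cont_C_contb:
  assumes "cont_C \<rho>0 \<rho> \<beta> I w"
  shows "contb \<beta> I w"
  unfolding contb_def
proof (intro ballI allI impI)
  fix s0 e :: real assume s0: "s0 \<in> I" and e: "e > 0"
  obtain d where d: "d > 0" "\<And>s. s \<in> I \<Longrightarrow> \<bar>s - s0\<bar> < d \<Longrightarrow> besov_norm \<rho>0 \<rho> \<beta> (dsub (w s) (w s0)) < e"
    using assms s0 e unfolding cont_C_def by blast
  show "\<exists>d>0. \<forall>s\<in>I. \<bar>s - s0\<bar> < d \<longrightarrow> bnd \<beta> (dsub (w s) (w s0)) e"
  proof (intro exI[of _ d] conjI ballI impI d(1))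
    fix s assume s: "s \<in> I" "\<bar>s - s0\<bar> < d"
    have "in_C \<rho>0 \<rho> \<beta> (w s)" "in_C \<rho>0 \<rho> \<beta> (w s0)" using assms s s0 unfolding cont_C_def by auto
    from bnd_dsub[OF this[THEN in_C_bnd]] have "besov_bdd \<rho>0 \<rho> \<beta> (dsub (w s) (w s0))" by (rule bnd_besov)
    from besov_bnd[OF this] show "bnd \<beta> (dsub (w s) (w s0)) e"
      by (rule bnd_weaken) (use d(2)[OF s] in simp)
  qed
qed

lemma contb_cont_C:
  assumes "contb \<beta> I w" "\<And>t. t \<in> I \<Longrightarrow> in_C \<rho>0 \<rho> \<beta> (w t)"
  shows "cont_C \<rho>0 \<rho> \<beta> I w"
  unfolding cont_C_def
proof (intro conjI ballI allI impI assms(2))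
  fix t e :: real assume t: "t \<in> I" and e: "e > 0"
  obtain d where d: "d > 0" "\<And>s. s \<in> I \<Longrightarrow> \<bar>s - t\<bar> < d \<Longrightarrow> bnd \<beta> (dsub (w s) (w t)) (e / 2)"
    using assms(1) t e unfolding contb_def by (meson half_gt_zero)
  show "\<exists>d>0. \<forall>s\<in>I. \<bar>s - t\<bar> < d \<longrightarrow> besov_norm \<rho>0 \<rho> \<beta> (dsub (w s) (w t)) < e"
  proof (intro exI[of _ d] conjI ballI impI d(1))
    fix s assume "s \<in> I" "\<bar>s - t\<bar> < d"
    from bnd_besov(2)[OF d(2)[OF this]] show "besov_norm \<rho>0 \<rho> \<beta> (dsub (w s) (w t)) < e" using e by simp
  qed
qed

text \<open>Makes the supremum in the hypothesis on \<open>Z\<close> a genuine bound at each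
  time.\<close>

lemma cont_C_bdd:
  assumes w: "cont_C \<rho>0 \<rho> \<beta> {0..T} w"
  shows "bdd_above ((\<lambda>t. besov_norm \<rho>0 \<rho> \<beta> (w t)) ` {0..T})"
proof -
  have b: "bnd \<beta> (w t) (besov_norm \<rho>0 \<rho> \<beta> (w t))" if "t \<in> {0..T}" for t
    using w that unfolding cont_C_def by (intro in_C_bnd) auto
  have le: "besov_norm \<rho>0 \<rho> \<beta> (w s) \<le> besov_norm \<rho>0 \<rho> \<beta> (w t) + e"
    if "t \<in> {0..T}" "bnd \<beta> (dsub (w s) (w t)) e" for s t e
  proof -
    have "bnd \<beta> (dadd (dsub (w s) (w t)) (w t)) (e + besov_norm \<rho>0 \<rho> \<beta> (w t))"
      by (rule bnd_dadd[OF that(2) b[OF that(1)]])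
    then have "bnd \<beta> (w s) (e + besov_norm \<rho>0 \<rho> \<beta> (w t))" by (simp add: dadd_def dsub_def)
    from bnd_besov(2)[OF this] show ?thesis by simp
  qed
  have "continuous_on {0..T} (\<lambda>t. besov_norm \<rho>0 \<rho> \<beta> (w t))"
    unfolding continuous_on_iff
  proof (intro ballI allI impI)
    fix t e :: real assume t: "t \<in> {0..T}" and e: "e > 0"
    obtain d where d: "d > 0" "\<And>s. s \<in> {0..T} \<Longrightarrow> \<bar>s - t\<bar> < d \<Longrightarrow> bnd \<beta> (dsub (w s) (w t)) (e / 2)"
      using cont_C_contb[OF w] t e unfolding contb_def by (meson half_gt_zero)
    show "\<exists>d>0. \<forall>x'\<in>{0..T}. dist x' t < d \<longrightarrow> dist (besov_norm \<rho>0 \<rho> \<beta> (w x')) (besov_norm \<rho>0 \<rho> \<beta> (w t)) < e"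
    proof (intro exI[of _ d] conjI ballI impI d(1))
      fix s assume s: "s \<in> {0..T}" "dist s t < d"
      then have 1: "bnd \<beta> (dsub (w s) (w t)) (e / 2)" by (intro d(2)) (auto simp: dist_real_def)
      then have 2: "bnd \<beta> (dsub (w t) (w s)) (e / 2)" unfolding bnd_dsub_commute[of _ "w t"] .
      show "dist (besov_norm \<rho>0 \<rho> \<beta> (w s)) (besov_norm \<rho>0 \<rho> \<beta> (w t)) < e"
        using le[OF t 1] le[OF s(1) 2] e unfolding dist_real_def by linarith
    qed
  qed
  then show ?thesis
    by (intro bounded_imp_bdd_above compact_imp_bounded compact_continuous_image) auto
qed

definition Phi :: "real \<Rightarrow> tdist \<Rightarrow> (real \<Rightarrow> tdist) \<Rightarrow> (real \<Rightarrow> tdist) \<Rightarrow> real \<Rightarrow> tdist" where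
  "Phi chi \<zeta> Z w t = dadd (heat t \<zeta>) (duh (force chi (\<lambda>s. dadd (w s) (Z s))) 0 t)"

lemma mild_sol_iff:
  "mild_sol \<rho>0 \<rho> \<alpha> \<eta> chi \<zeta> Z S w \<longleftrightarrow> in_Ceta \<rho>0 \<rho> \<alpha> \<eta> S w \<and>
     (\<forall>t\<in>{0<..S}. (\<forall>k. (\<lambda>s. heat (t - s) (force chi (\<lambda>s. dadd (w s) (Z s)) s) k) integrable_on {0..t})
        \<and> w t = Phi chi \<zeta> Z w t)"
  unfolding mild_sol_def Phi_def duh_def force_def dadd_def[of "heat _ _"] fun_eq_iff by blast

end

section \<open>The fixed point argument\<close>

locale ks = lp \<rho>0 \<rho> Lw for \<rho>0 \<rho> Lw +
  fixes \<alpha>0 \<alpha> \<eta> chi :: real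
  assumes par0: "- 1/2 < \<alpha>0" "\<alpha>0 < 0" "0 < \<alpha>" "\<alpha> < \<alpha>0 + 1/2" "(\<alpha> - \<alpha>0) / 2 < \<eta>" "\<eta> < 1/4"
begin

lemma par: "\<alpha>0 < 0" "- 1 < 2 * \<alpha>0" "0 < \<alpha>" "2 * \<alpha> < 2 * \<alpha>0 + 1" "\<alpha> - \<alpha>0 < 2 * \<eta>" "4 * \<eta> < 1" "2 * \<alpha> < 1" "0 < \<eta>"
  using par0 by simp_all

text \<open>\<open>\<beta> \<le> \<alpha> / 2\<close> leaves the surplus
  \<open>\<alpha> - 3 * \<beta> / 2\<close> in the Duhamel exponent nonnegative;
  \<open>\<beta> \<le> 1/2 - 2 * \<eta>\<close> leaves room for \<open>\<epsilon>\<close> in the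
  contraction.\<close>

definition \<beta> :: real where "\<beta> = min (\<alpha> / 2) (1/2 - 2 * \<eta>)"
definition \<gamma> :: real where "\<gamma> = \<eta> - (\<alpha> - \<beta>) / 2"
definition \<theta> :: real where "\<theta> = min (\<eta> - (\<alpha> - \<alpha>0) / 2) (1/2 - 2 * \<eta>)"
text \<open>Half of \<open>1/2 - 2 * \<eta>\<close>; the other half is reserved for
  \<open>\<beta> / 2\<close>.\<close>

definition \<epsilon> :: real where "\<epsilon> = 1/4 - \<eta>"

lemma beta_bounds: "0 < \<beta>" "2 * \<beta> \<le> \<alpha>" "\<beta> + 2 * \<eta> \<le> 1/2" "\<beta> < \<alpha>" "\<alpha> \<le> \<beta> + 1"
  using par by (auto simp: \<beta>_def min_def field_simps)

lemma gamma_bounds: "0 < \<gamma>" "\<gamma> \<le> \<eta>"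
  using par beta_bounds by (auto simp: \<gamma>_def field_simps)

lemma theta_pos: "0 < \<theta>" using par by (simp add: \<theta>_def)

text \<open>The 36 is \<open>4 * (1 + 8)\<close>: the cubic growth constant of the unit ball is
  \<open>4 * (1 + 8 * z ^ 3)\<close>, at most \<open>36 * R\<close>.\<close>

definition C1 :: "real \<Rightarrow> real" where
  "C1 \<sigma> = cH * \<bar>chi\<bar> * cN \<beta> * 36 * Beta (1 - 3 * \<gamma>) (1 - (1 + \<sigma>) / 2)"

text \<open>288 stems from the linear flow, the two values of \<open>C1\<close> from the Duhamel
  term at both regularities. The summand 1 gives \<open>C0 * R \<ge> 1\<close>, which confines the
  time interval to length at most one.\<close>

definition C0 :: real where "C0 = 1 + 288 + C1 \<beta> + C1 \<alpha>"

lemma C1_nonneg: "\<sigma> < 1 \<Longrightarrow> 0 \<le> C1 \<sigma>"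
  unfolding C1_def using gamma_bounds par cN_pos[OF beta_bounds(1)] Beta_real_pos[of "1 - 3 * \<gamma>" "1 - (1 + \<sigma>) / 2"] by simp

lemma C0: "1 \<le> C0" "288 + C1 \<beta> \<le> C0" "288 + C1 \<alpha> \<le> C0"
  unfolding C0_def using C1_nonneg[of \<beta>] C1_nonneg[of \<alpha>] beta_bounds par by auto

end

text \<open>\<open>z\<close> bounds \<open>Z\<close> in regularity \<open>\<alpha>\<close>; lowering
  this to \<open>\<beta>\<close> by \<open>bnd_exponent\<close> produces
  \<open>2 * z\<close>.\<close>

locale ks_data = ks \<rho>0 \<rho> Lw \<alpha>0 \<alpha> \<eta> chi for \<rho>0 \<rho> Lw \<alpha>0 \<alpha> \<eta> chi +
  fixes \<zeta> :: tdist and Z :: "real \<Rightarrow> tdist" and S R z :: real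
  assumes zeta: "real_dist \<zeta>" "bnd \<alpha>0 \<zeta> R"
    and Z: "\<And>t. t \<in> {0<..S} \<Longrightarrow> real_dist (Z t)" "\<And>t. t \<in> {0<..S} \<Longrightarrow> bnd \<beta> (Z t) (2 * z)" "contb \<beta> {0<..S} Z"
    and z: "0 \<le> z" "z ^ 3 \<le> R" and R: "1 \<le> R"
    and S: "0 < S" "S \<le> 1" "C0 * R * S powr \<theta> \<le> 1"
begin

abbreviation "P \<equiv> Phi chi \<zeta> Z"
abbreviation "U w \<equiv> (\<lambda>s. dadd (w s) (Z s))"

section \<open>Invariance of the ball\<close>

text \<open>Used with two pairs of parameters: \<open>adm 1 \<gamma>\<close> is the ball of the
  iteration, and \<open>adm M \<eta>\<close> with large \<open>M\<close> contains every competing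
  mild solution.\<close>

definition adm :: "real \<Rightarrow> real \<Rightarrow> (real \<Rightarrow> tdist) \<Rightarrow> bool" where
  "adm M p w \<longleftrightarrow> contb \<beta> {0<..S} w \<and> (\<forall>t\<in>{0<..S}. real_dist (w t) \<and> bnd \<beta> (w t) (M * t powr (- p)))"

lemma adm_U:
  assumes w: "adm M p w"
  shows "contb \<beta> {0<..S} (U w)" "s \<in> {0<..S} \<Longrightarrow> real_dist (U w s)"
    "s \<in> {0<..S} \<Longrightarrow> bnd \<beta> (U w s) (M * s powr (- p) + 2 * z)"
  using w unfolding adm_def
  by (auto intro!: contb_dadd real_dist_dadd bnd_dadd Z)

lemma cube_bound:
  assumes "0 \<le> M" "0 \<le> p" "0 < s" "s \<le> 1"
  shows "(M * s powr (- p) + 2 * z) ^ 3 \<le> (4 * (M ^ 3 + 8 * z ^ 3)) * s powr (- (3 * p))"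
proof -
  have s1: "1 \<le> s powr (- (3 * p))" using powr_mono'[of "- (3 * p)" 0 s] assms by simp
  have "(M * s powr (- p) + 2 * z) ^ 3 \<le> 4 * ((M * s powr (- p)) ^ 3 + (2 * z) ^ 3)"
    by (rule cube_sum_le) (use assms z in auto)
  also have "(M * s powr (- p)) ^ 3 = M ^ 3 * s powr (- (3 * p))"
    using assms by (simp add: power_mult_distrib powr_power)
  also have "4 * (M ^ 3 * s powr (- (3 * p)) + (2 * z) ^ 3) \<le> 4 * (M ^ 3 * s powr (- (3 * p)) + (8 * z ^ 3) * s powr (- (3 * p)))"
    using mult_left_mono[OF s1, of "8 * z ^ 3"] z by (simp add: power_mult_distrib)
  finally show ?thesis by (simp add: algebra_simps)
qed

definition KM :: "real \<Rightarrow> real" where "KM M = 4 * (M ^ 3 + 8 * z ^ 3)"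

abbreviation "duh_const M p \<sigma> t \<equiv> cH * \<bar>chi\<bar> * cN \<beta> * KM M *
  (Beta (1 - 3 * p) (1 - (1 + \<sigma>) / 2) * t powr (1 - (1 + \<sigma>) / 2 - 3 * p))"

lemma KM_nonneg: "0 \<le> M \<Longrightarrow> 0 \<le> KM M"
  using z by (simp add: KM_def)

lemma adm_K:
  assumes "0 \<le> M" "0 \<le> p" "s \<in> {0<..S}"
  shows "(M * s powr (- p) + 2 * z) ^ 3 \<le> KM M * s powr (- (3 * p))"
  unfolding KM_def by (rule cube_bound) (use assms S in auto)

lemma adm_integrable:
  assumes w: "adm M p w" and M: "0 \<le> M" "0 \<le> p" "3 * p < 1" and t: "t \<in> {0<..S}"
  shows "(\<lambda>s. heat (t - s) (force chi (U w) s) k) integrable_on {0..t}"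
  by (rule force_integrable[OF beta_bounds(1) adm_U[OF w] adm_K[OF M(1,2)] M(3)]) (use t in auto)

lemma P_real: "real_dist (P w t)"
  unfolding Phi_def by (intro real_dist_dadd real_dist_heat real_dist_duh real_dist_force zeta)

lemma P_bnd:
  assumes w: "adm M p w" and M: "0 \<le> M" "0 \<le> p" "3 * p < 1" and t: "t \<in> {0<..S}"
    and s: "\<alpha>0 \<le> \<sigma>" "\<sigma> < 1"
  shows "bnd \<sigma> (P w t) (288 * t powr (- (\<sigma> - \<alpha>0) / 2) * R
    + duh_const M p \<sigma> t)"
  unfolding Phi_def
proof (rule bnd_dadd)
  show "bnd \<sigma> (heat t \<zeta>) (288 * t powr (- (\<sigma> - \<alpha>0) / 2) * R)"
    by (rule bnd_heat[OF zeta(2)]) (use t S s par in auto)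
  show "bnd \<sigma> (duh (force chi (U w)) 0 t)
      (duh_const M p \<sigma> t)"
    by (rule duh_force_bnd[OF beta_bounds(1) adm_U[OF w] adm_K[OF M(1,2)] M(3)]) (use t S s par in auto)
qed

text \<open>\<open>\<sigma> = \<beta>\<close> is stability of the ball,
  \<open>\<sigma> = \<alpha>\<close> the bound claimed for the solution. One proof serves both,
  because \<open>\<sigma>\<close> cancels when the exponents are compared with the target
  power.\<close>

lemma P_ball:
  assumes w: "adm 1 \<gamma> w" and t: "t \<in> {0<..S}" and s: "\<sigma> = \<beta> \<or> \<sigma> = \<alpha>"
  shows "bnd \<sigma> (P w t) (t powr (- (\<eta> - (\<alpha> - \<sigma>) / 2)))"
proof -
  have s': "\<alpha>0 \<le> \<sigma>" "\<sigma> < 1" "288 + C1 \<sigma> \<le> C0" using s beta_bounds par C0 by auto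
  have t01: "0 < t" "t \<le> 1" using t S by auto
  have p3: "3 * \<gamma> < 1" using gamma_bounds par by linarith
  define q where "q = \<eta> - (\<alpha> - \<sigma>) / 2"
  have tR: "R * t powr \<theta> * C0 \<le> 1"
  proof -
    have "t powr \<theta> \<le> S powr \<theta>" using t theta_pos by (intro powr_mono2) auto
    then have "C0 * R * t powr \<theta> \<le> C0 * R * S powr \<theta>" using C0 R by (intro mult_left_mono) auto
    then show ?thesis using S(3) by (simp add: mult_ac)
  qed
  have e1: "t powr (- (\<sigma> - \<alpha>0) / 2) \<le> t powr \<theta> * t powr (- q)"
    unfolding powr_add[symmetric] using t01 s'
    by (intro powr_mono') (auto simp: q_def \<theta>_def min_def field_simps)
  \<comment> \<open>Smoothing loss, cubic singularity and target power add up to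
    \<open>1/2 - 2 * \<eta>\<close> plus the surplus
    \<open>\<alpha> - 3 * \<beta> / 2\<close>.\<close>
  have e2: "t powr (1 - (1 + \<sigma>) / 2 - 3 * \<gamma>) \<le> t powr \<theta> * t powr (- q)"
  proof -
    have "\<theta> \<le> 1/2 - 2 * \<eta>" by (simp add: \<theta>_def)
    also have "\<dots> \<le> 1/2 - 2 * \<eta> + \<alpha> - 3 * \<beta> / 2" using beta_bounds by linarith
    also have "\<dots> = 1 - (1 + \<sigma>) / 2 - 3 * \<gamma> + q" by (simp add: q_def \<gamma>_def field_simps)
    finally show ?thesis unfolding powr_add[symmetric] using t01 by (intro powr_mono') auto
  qed
  have KM1: "KM 1 \<le> 36 * R" using z R by (simp add: KM_def)
  have B0: "0 \<le> Beta (1 - 3 * \<gamma>) (1 - (1 + \<sigma>) / 2)"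
    using Beta_real_pos[of "1 - 3 * \<gamma>" "1 - (1 + \<sigma>) / 2"] p3 s' by simp
  have "288 * t powr (- (\<sigma> - \<alpha>0) / 2) * R
    + duh_const 1 \<gamma> \<sigma> t
    \<le> 288 * (t powr \<theta> * t powr (- q)) * R
    + cH * \<bar>chi\<bar> * cN \<beta> * (36 * R) * (Beta (1 - 3 * \<gamma>) (1 - (1 + \<sigma>) / 2) * (t powr \<theta> * t powr (- q)))"
    using e1 e2 KM1 B0 R cN_pos[OF beta_bounds(1)] KM_nonneg[of 1]
    by (intro add_mono mult_mono) (auto intro!: mult_nonneg_nonneg)
  also have "\<dots> = (R * t powr \<theta> * (288 + C1 \<sigma>)) * t powr (- q)"
    by (simp add: C1_def algebra_simps)
  also have "\<dots> \<le> 1 * t powr (- q)"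
  proof (rule mult_right_mono)
    have "R * t powr \<theta> * (288 + C1 \<sigma>) \<le> R * t powr \<theta> * C0" using s' R by (intro mult_left_mono) auto
    then show "R * t powr \<theta> * (288 + C1 \<sigma>) \<le> 1" using tR by linarith
  qed auto
  finally show ?thesis
    using P_bnd[OF w _ _ p3 t s'(1,2)] gamma_bounds by (auto simp: q_def elim: bnd_weaken)
qed

lemma P_dsub:
  assumes w: "adm M p w" and M: "0 \<le> M" "0 \<le> p" "3 * p < 1" and r: "0 < r" "r < t" "t \<le> S"
  shows "dsub (P w t) (heat (t - r) (P w r)) = duh (force chi (U w)) r t"
proof
  fix k
  have "duh (force chi (U w)) 0 t k = heat (t - r) (duh (force chi (U w)) 0 r) k + duh (force chi (U w)) r t k"
    by (rule duh_split[OF _ _ adm_integrable[OF w M]]) (use r in auto)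
  moreover have "heat (t - r) (P w r) = dadd (heat t \<zeta>) (heat (t - r) (duh (force chi (U w)) 0 r))"
    unfolding Phi_def heat_dadd heat_heat by simp
  ultimately show "dsub (P w t) (heat (t - r) (P w r)) k = duh (force chi (U w)) r t k"
    by (simp add: dsub_def dadd_def Phi_def)
qed

section \<open>Extra regularity and continuity at positive times\<close>

text \<open>The surplus \<open>1/4\<close> keeps \<open>\<alpha> + 1/4\<close> below one, where the
  smoothing singularity is still integrable. It yields both membership in \<open>in_C\<close> and
  continuity in time.\<close>

lemma P_high:
  assumes w: "adm M p w" and M: "0 \<le> M" "0 \<le> p" "3 * p < 1" and a: "0 < a"
  shows "\<exists>c\<ge>0. \<forall>t. a \<le> t \<longrightarrow> t \<le> S \<longrightarrow> bnd (\<alpha> + 2 * (1/8)) (P w t) c"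
proof -
  define \<sigma> where "\<sigma> = \<alpha> + 2 * (1/8)"
  define r where "r = 1 - (1 + \<sigma>) / 2 - 3 * p"
  define K where "K = cH * \<bar>chi\<bar> * cN \<beta> * KM M * Beta (1 - 3 * p) (1 - (1 + \<sigma>) / 2)"
  have s: "\<alpha>0 \<le> \<sigma>" "\<sigma> < 1" using par by (auto simp: \<sigma>_def)
  have K0: "0 \<le> K" unfolding K_def
    using cN_pos[OF beta_bounds(1)] KM_nonneg[OF M(1)] Beta_real_pos[of "1 - 3 * p" "1 - (1 + \<sigma>) / 2"] M s by simp
  have "bnd \<sigma> (P w t) (288 * a powr (- (\<sigma> - \<alpha>0) / 2) * R + K * a powr (- \<bar>r\<bar>))" if t: "a \<le> t" "t \<le> S" for t
  proof (rule bnd_weaken[OF P_bnd[OF w M _ s]])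
    have t1: "t \<le> 1" using t S by simp
    have "t powr (- (\<sigma> - \<alpha>0) / 2) \<le> a powr (- (\<sigma> - \<alpha>0) / 2)"
      using a t s by (intro powr_mono2') auto
    \<comment> \<open>The sign of \<open>r\<close> is not determined; passing to its absolute value
      treats both cases, since times are at most one.\<close>
    moreover have "t powr r \<le> a powr (- \<bar>r\<bar>)"
    proof -
      have "t powr r \<le> t powr (- \<bar>r\<bar>)" using a t t1 by (intro powr_mono') auto
      also have "\<dots> \<le> a powr (- \<bar>r\<bar>)" using a t by (intro powr_mono2') auto
      finally show ?thesis .
    qed
    ultimately have "288 * t powr (- (\<sigma> - \<alpha>0) / 2) * R + K * t powr r \<le> 288 * a powr (- (\<sigma> - \<alpha>0) / 2) * R + K * a powr (- \<bar>r\<bar>)"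
      using R K0 by (intro add_mono mult_right_mono mult_left_mono) auto
    then show "288 * t powr (- (\<sigma> - \<alpha>0) / 2) * R
      + duh_const M p \<sigma> t
      \<le> 288 * a powr (- (\<sigma> - \<alpha>0) / 2) * R + K * a powr (- \<bar>r\<bar>)"
      by (simp add: K_def r_def mult_ac)
  qed (use t a in auto)
  moreover have "0 \<le> 288 * a powr (- (\<sigma> - \<alpha>0) / 2) * R + K * a powr (- \<bar>r\<bar>)" using K0 R by simp
  ultimately show ?thesis unfolding \<sigma>_def by blast
qed

text \<open>The increment splits into the heat flow acting on \<open>P w s\<close>, small by its
  extra regularity, and the Duhamel integral over the short interval from \<open>s\<close> to
  \<open>t\<close>.\<close>

lemma P_contb:
  assumes w: "adm M p w" and M: "0 \<le> M" "0 \<le> p" "3 * p < 1"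
  shows "contb \<alpha> {0<..S} (P w)"
proof (rule contb_modulus)
  fix a :: real assume a: "a > 0"
  obtain c where c: "c \<ge> 0" "\<And>t. a \<le> t \<Longrightarrow> t \<le> S \<Longrightarrow> bnd (\<alpha> + 2 * (1/8)) (P w t) c"
    using P_high[OF w M a] by blast
  define q where "q = 1 - (1 + \<alpha>) / 2"
  have q: "1/8 \<le> q" using par by (simp add: q_def)
  define K where "K = cH * \<bar>chi\<bar> * (cN \<beta> * (KM M * a powr (- (3 * p)))) / q"
  have K0: "0 \<le> K" unfolding K_def using cN_pos[OF beta_bounds(1)] KM_nonneg[OF M(1)] q by simp
  show "\<exists>C r. r > 0 \<and> (\<forall>s t. a \<le> s \<longrightarrow> s < t \<longrightarrow> t \<le> S \<longrightarrow> bnd \<alpha> (dsub (P w t) (P w s)) (C * (t - s) powr r))"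
  proof (rule exI[of _ "16000 * c + K"], rule exI[of _ "1/8"], intro conjI allI impI)
    fix s t assume st: "a \<le> s" "s < t" "t \<le> S"
    define h where "h = t - s"
    have h: "0 < h" "h \<le> 1" using st a S by (auto simp: h_def)
    have eq: "dsub (P w t) (P w s) = dadd (dsub (heat h (P w s)) (P w s)) (duh (force chi (U w)) s t)"
      using P_dsub[OF w M, of s t] st a by (auto simp: h_def dsub_def dadd_def fun_eq_iff algebra_simps)
    have 1: "bnd \<alpha> (dsub (heat h (P w s)) (P w s)) (16000 * h powr (1/8) * c)"
      by (rule bnd_heat_diff[OF c(2) h]) (use st in auto)
    have "bnd \<alpha> (duh (force chi (U w)) s t)
       (cH * \<bar>chi\<bar> * (cN \<beta> * (KM M * a powr (- (3 * p)))) * ((t - s) powr (1 - (1 + \<alpha>) / 2) / (1 - (1 + \<alpha>) / 2)))"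
      by (rule duh_force_tail[OF beta_bounds(1) adm_U[OF w] adm_K[OF M(1,2)] _ M(3) KM_nonneg[OF M(1)] a]) (use st M S par in auto)
    then have "bnd \<alpha> (duh (force chi (U w)) s t) (K * h powr q)"
      by (simp add: K_def q_def h_def)
    moreover have "K * h powr q \<le> K * h powr (1/8)"
      using K0 h q by (intro mult_left_mono powr_mono') auto
    ultimately have 2: "bnd \<alpha> (duh (force chi (U w)) s t) (K * h powr (1/8))" by (rule bnd_weaken)
    show "bnd \<alpha> (dsub (P w t) (P w s)) ((16000 * c + K) * (t - s) powr (1/8))"
      using bnd_dadd[OF 1 2] unfolding eq h_def by (simp add: algebra_simps)
  qed simp
qed

lemma P_in_C:
  assumes w: "adm 1 \<gamma> w" and t: "t \<in> {0<..S}"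
  shows "in_C \<rho>0 \<rho> \<alpha> (P w t)"
proof -
  have M: "0 \<le> (1::real)" "0 \<le> \<gamma>" "3 * \<gamma> < 1" using gamma_bounds par by auto
  obtain c where "bnd (\<alpha> + 2 * (1/8)) (P w t) c"
    using P_high[OF w M, of t] t by auto
  from in_C_if_bnd[OF this P_real P_ball[OF w t]] show ?thesis using par by simp
qed

lemma P_adm:
  assumes w: "adm 1 \<gamma> w"
  shows "adm 1 \<gamma> (P w)"
  unfolding adm_def
proof (intro conjI ballI P_real)
  have M: "0 \<le> (1::real)" "0 \<le> \<gamma>" "3 * \<gamma> < 1" using gamma_bounds par by auto
  show "contb \<beta> {0<..S} (P w)" by (rule contb_exponent[OF P_contb[OF w M]]) (use beta_bounds in auto)
  fix t assume t: "t \<in> {0<..S}"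
  show "bnd \<beta> (P w t) (1 * t powr - \<gamma>)" using P_ball[OF w t, of \<beta>] by (simp add: \<gamma>_def)
qed

lemma adm_mono:
  assumes w: "adm 1 \<gamma> w" and M: "1 \<le> M"
  shows "adm M \<eta> w"
proof -
  have "bnd \<beta> (w t) (M * t powr (- \<eta>))" if t: "t \<in> {0<..S}" for t
  proof -
    have "1 * t powr (- \<gamma>) \<le> M * t powr (- \<eta>)"
      using M t S gamma_bounds by (intro mult_mono powr_mono') auto
    moreover have "bnd \<beta> (w t) (1 * t powr (- \<gamma>))" using w t unfolding adm_def by blast
    ultimately show ?thesis by (rule bnd_weaken[rotated])
  qed
  then show ?thesis using w unfolding adm_def by blast
qed

section \<open>Contraction in the exponential weight and uniqueness\<close>

definition Kc :: "real \<Rightarrow> real" where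
  "Kc M = cH * \<bar>chi\<bar> * (cN \<beta> * (M + 2 * z)\<^sup>2) * Beta (1 - 3 * \<eta>) (1 - ((1 + \<beta>) / 2 + \<epsilon>))"

lemma Kc_nonneg: "0 \<le> Kc M"
proof -
  have "0 < Beta (1 - 3 * \<eta>) (1 - ((1 + \<beta>) / 2 + \<epsilon>))"
    by (rule Beta_real_pos) (use beta_bounds par par(8) in \<open>auto simp: \<epsilon>_def field_simps\<close>)
  then show ?thesis unfolding Kc_def using cN_pos[OF beta_bounds(1)] by simp
qed

text \<open>The weight \<open>exp (l * t)\<close> makes the Duhamel map a contraction on the whole interval; the gain
  \<open>l powr (- \<epsilon>)\<close> comes from \<open>exp (- l * (t - s)) \<le> (l * (t - s)) powr (- \<epsilon>)\<close>.\<close>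

lemma contraction:
  assumes w: "adm M \<eta> w" and v: "adm M \<eta> v" and M: "0 \<le> M" and l: "0 < l" and D: "0 \<le> D"
    and d: "\<And>t. t \<in> {0<..S} \<Longrightarrow> bnd \<beta> (dsub (w t) (v t)) (D * exp (l * t) * t powr (- \<eta>))"
    and t: "t \<in> {0<..S}"
  shows "bnd \<beta> (dsub (P w t) (P v t)) (Kc M * l powr (- \<epsilon>) * (D * exp (l * t) * t powr (- \<eta>)))"
proof -
  define a where "a = (1 + \<beta>) / 2 + \<epsilon>"
  \<comment> \<open>\<open>a'\<close> is precisely the condition
    \<open>1 - a - 3 * \<eta> \<ge> - \<eta>\<close>, so the weight \<open>t powr (- \<eta>)\<close>
    is reproduced even after \<open>\<epsilon>\<close> has been given away.\<close>
  have a: "a < 1" and a': "\<beta> / 2 + \<epsilon> \<le> 1/2 - 2 * \<eta>" and eps_bounds: "0 < \<epsilon>" "\<epsilon> \<le> 1"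
    using beta_bounds par par(8) by (auto simp: a_def \<epsilon>_def field_simps)
  have e3: "3 * \<eta> < 1" using par by simp
  have t01: "0 < t" "t \<le> 1" using t S by auto
  define Q where "Q = cH * \<bar>chi\<bar> * (cN \<beta> * (M + 2 * z)\<^sup>2) * (D * exp (l * t) * l powr (- \<epsilon>))"
  have Q0: "0 \<le> Q" unfolding Q_def using cN_pos[OF beta_bounds(1)] D by simp
  let ?F = "\<lambda>s. dsub (force chi (U w) s) (force chi (U v) s)"
  have eq: "dsub (P w t) (P v t) = duh ?F 0 t"
  proof
    fix k
    have "heat (t - s) (?F s) k
       = heat (t - s) (force chi (U w) s) k - heat (t - s) (force chi (U v) s) k" for s
      by (simp add: heat_def dsub_def algebra_simps)
    then have "duh ?F 0 t k = duh (force chi (U w)) 0 t k - duh (force chi (U v)) 0 t k"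
      unfolding duh_def
      using adm_integrable[OF w M _ e3 t, of k] adm_integrable[OF v M _ e3 t, of k] par(8)
      by (simp add: Henstock_Kurzweil_Integration.integral_diff)
    then show "dsub (P w t) (P v t) k = duh ?F 0 t k"
      by (simp add: dsub_def dadd_def Phi_def)
  qed
  have "bnd \<beta> (dsub (P w t) (P v t)) (Q * (Beta (1 - 3 * \<eta>) (1 - a) * t powr (1 - a - 3 * \<eta>)))"
    unfolding eq
  proof (rule duh_bnd)
    show "(\<lambda>s. heat (t - s) (?F s) k) integrable_on {0..t}" for k
    proof -
      have "(\<lambda>s. heat (t - s) (force chi (U w) s) k - heat (t - s) (force chi (U v) s) k) integrable_on {0..t}"
        using adm_integrable[OF w M _ e3 t, of k] adm_integrable[OF v M _ e3 t, of k] par(8)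
        by (intro integrable_diff) auto
      then show ?thesis by (simp add: heat_def dsub_def algebra_simps)
    qed
    show "((\<lambda>s. Q * ((t - s) powr (- a) * s powr (- (3 * \<eta>)))) has_integral
       Q * (Beta (1 - 3 * \<eta>) (1 - a) * t powr (1 - a - 3 * \<eta>))) {0..t}"
      by (intro has_integral_mult_right beta_integral a e3 t01)
    fix s assume s: "0 < s" "s < t"
    then have sS: "s \<in> {0<..S}" using t by auto
    have s1: "s \<le> 1" using s t01 by simp
    define m where "m = (M + 2 * z) * s powr (- \<eta>)"
    have "M * s powr (- \<eta>) + 2 * z \<le> m"
    proof -
      have "1 \<le> s powr (- \<eta>)" using powr_mono'[of "- \<eta>" 0 s] s s1 par(8) by simp
      then have "2 * z * 1 \<le> 2 * z * s powr (- \<eta>)" using z by (intro mult_left_mono) auto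
      then show ?thesis by (simp add: m_def algebra_simps)
    qed
    then have bu: "bnd \<beta> (U w s) m" and bv: "bnd \<beta> (U v s) m"
      using adm_U(3)[OF w sS] adm_U(3)[OF v sS] by (auto elim: bnd_weaken)
    have "dsub (U w s) (U v s) = dsub (w s) (v s)" by (simp add: dsub_def dadd_def)
    then have N: "bnd 0 (dsub (nonlin (U w s)) (nonlin (U v s))) (cN \<beta> * m\<^sup>2 * (D * exp (l * s) * s powr (- \<eta>)))"
      using bnd_nonlin_diff[OF beta_bounds(1) bu adm_U(2)[OF w sS] bv adm_U(2)[OF v sS]] d[OF sS] by simp
    have "bnd \<beta> (heat (t - s) (?F s))
       (cH * \<bar>chi\<bar> * (t - s) powr (- ((1 + \<beta>) / 2)) * (cN \<beta> * m\<^sup>2 * (D * exp (l * s) * s powr (- \<eta>))))"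
      by (rule bnd_heat_force_diff[where u = "U w" and v = "U v" and s = s, OF N]) (use s t01 beta_bounds par in auto)
    moreover have "cH * \<bar>chi\<bar> * (t - s) powr (- ((1 + \<beta>) / 2)) * (cN \<beta> * m\<^sup>2 * (D * exp (l * s) * s powr (- \<eta>)))
       \<le> Q * ((t - s) powr (- a) * s powr (- (3 * \<eta>)))"
    proof -
      have "exp (- (l * (t - s))) \<le> (l * (t - s)) powr (- \<epsilon>)"
        using l s eps_bounds by (intro exp_minus_le_powr) auto
      also have "\<dots> = l powr (- \<epsilon>) * (t - s) powr (- \<epsilon>)" using l s by (simp add: powr_mult)
      finally have "exp (l * t) * exp (- (l * (t - s))) \<le> exp (l * t) * (l powr (- \<epsilon>) * (t - s) powr (- \<epsilon>))"
        by (intro mult_left_mono) auto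
      moreover have "exp (l * t) * exp (- (l * (t - s))) = exp (l * s)"
        unfolding exp_add[symmetric] by (simp add: algebra_simps)
      ultimately have ex: "exp (l * s) \<le> exp (l * t) * (l powr (- \<epsilon>) * (t - s) powr (- \<epsilon>))" by simp
      have m2: "m\<^sup>2 = (M + 2 * z)\<^sup>2 * s powr (- (2 * \<eta>))"
        using s by (simp add: m_def power_mult_distrib powr_power)
      have p1: "s powr (- (3 * \<eta>)) = s powr (- (2 * \<eta>)) * s powr (- \<eta>)" unfolding powr_add[symmetric] by simp
      have p2: "(t - s) powr (- a) = (t - s) powr (- ((1 + \<beta>) / 2)) * (t - s) powr (- \<epsilon>)" unfolding powr_add[symmetric] by (simp add: a_def)
      have "cH * \<bar>chi\<bar> * (t - s) powr (- ((1 + \<beta>) / 2)) * (cN \<beta> * m\<^sup>2 * (D * exp (l * s) * s powr (- \<eta>)))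
         \<le> cH * \<bar>chi\<bar> * (t - s) powr (- ((1 + \<beta>) / 2)) * (cN \<beta> * m\<^sup>2 * (D * (exp (l * t) * (l powr (- \<epsilon>) * (t - s) powr (- \<epsilon>))) * s powr (- \<eta>)))"
        using cN_pos[OF beta_bounds(1)] D ex by (intro mult_left_mono mult_right_mono) auto
      also have "\<dots> = Q * ((t - s) powr (- a) * s powr (- (3 * \<eta>)))"
        unfolding m2 p1 p2 Q_def by (simp only: mult_ac)
      finally show ?thesis .
    qed
    ultimately show "bnd \<beta> (heat (t - s) (?F s)) (Q * ((t - s) powr (- a) * s powr (- (3 * \<eta>))))"
      by (rule bnd_weaken)
  qed
  moreover have "Q * (Beta (1 - 3 * \<eta>) (1 - a) * t powr (1 - a - 3 * \<eta>)) \<le> Kc M * l powr (- \<epsilon>) * (D * exp (l * t) * t powr (- \<eta>))"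
  proof -
    have "t powr (1 - a - 3 * \<eta>) \<le> t powr (- \<eta>)"
      using t01 a' by (intro powr_mono') (auto simp: a_def field_simps)
    moreover have "0 < Beta (1 - 3 * \<eta>) (1 - a)" by (rule Beta_real_pos) (use a e3 in auto)
    ultimately have "Q * (Beta (1 - 3 * \<eta>) (1 - a) * t powr (1 - a - 3 * \<eta>)) \<le> Q * (Beta (1 - 3 * \<eta>) (1 - a) * t powr (- \<eta>))"
      using Q0 by (intro mult_left_mono) auto
    also have "\<dots> = Kc M * l powr (- \<epsilon>) * (D * exp (l * t) * t powr (- \<eta>))"
      by (simp add: Q_def Kc_def a_def mult_ac)
    finally show ?thesis .
  qed
  ultimately show ?thesis by (rule bnd_weaken)
qed

text \<open>Quantified over all pairs and all \<open>D\<close>, so that one \<open>l\<close> can be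
  used at every step of an iteration.\<close>

definition halving :: "real \<Rightarrow> real \<Rightarrow> bool" where
  "halving M l \<longleftrightarrow> (\<forall>w v D t. adm M \<eta> w \<longrightarrow> adm M \<eta> v \<longrightarrow> 0 \<le> D \<longrightarrow>
    (\<forall>t\<in>{0<..S}. bnd \<beta> (dsub (w t) (v t)) (D * exp (l * t) * t powr (- \<eta>))) \<longrightarrow>
    t \<in> {0<..S} \<longrightarrow> bnd \<beta> (dsub (P w t) (P v t)) (D / 2 * exp (l * t) * t powr (- \<eta>)))"

lemma contraction_half:
  assumes M: "0 \<le> M"
  shows "\<exists>l>0. halving M l"
proof -
  have eps_bounds: "0 < \<epsilon>" using par by (simp add: \<epsilon>_def)
  \<comment> \<open>Chosen so that \<open>l powr (- \<epsilon>)\<close> is the reciprocal of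
    \<open>2 * Kc M + 1\<close>.\<close>
  define l where "l = (2 * Kc M + 1) powr (1 / \<epsilon>)"
  have l0: "0 < l" using Kc_nonneg[of M] by (simp add: l_def)
  have "l powr (- \<epsilon>) = 1 / (2 * Kc M + 1)"
    using eps_bounds Kc_nonneg[of M] by (simp add: l_def powr_powr powr_minus divide_inverse)
  then have half: "Kc M * l powr (- \<epsilon>) \<le> 1 / 2"
    using Kc_nonneg[of M] by (simp only:) (simp add: field_simps)
  show ?thesis
    unfolding halving_def
  proof (intro exI[of _ l] conjI allI impI l0)
    fix w v D t
    assume a: "adm M \<eta> w" "adm M \<eta> v" "0 \<le> D" "\<forall>t\<in>{0<..S}. bnd \<beta> (dsub (w t) (v t)) (D * exp (l * t) * t powr (- \<eta>))" "t \<in> {0<..S}"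
    have "Kc M * l powr (- \<epsilon>) * (D * exp (l * t) * t powr (- \<eta>)) \<le> 1 / 2 * (D * exp (l * t) * t powr (- \<eta>))"
      using half a(3) by (intro mult_right_mono) auto
    with contraction[OF a(1,2) M l0 a(3) _ a(5)] a(4)
    show "bnd \<beta> (dsub (P w t) (P v t)) (D / 2 * exp (l * t) * t powr (- \<eta>))"
      by (auto elim: bnd_weaken)
  qed
qed

text \<open>Two fixed points start from the trivial distance \<open>2 * M\<close>, which is halved
  arbitrarily often; their coefficients therefore agree.\<close>

lemma unique:
  assumes w: "adm M \<eta> w" "\<And>t. t \<in> {0<..S} \<Longrightarrow> w t = P w t"
    and v: "adm M \<eta> v" "\<And>t. t \<in> {0<..S} \<Longrightarrow> v t = P v t" and M: "0 \<le> M" and t: "t \<in> {0<..S}"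
  shows "w t = v t"
proof -
  obtain l where l: "l > 0" "\<And>w v D t. adm M \<eta> w \<Longrightarrow> adm M \<eta> v \<Longrightarrow> 0 \<le> D \<Longrightarrow>
    (\<forall>t\<in>{0<..S}. bnd \<beta> (dsub (w t) (v t)) (D * exp (l * t) * t powr (- \<eta>))) \<Longrightarrow>
    t \<in> {0<..S} \<Longrightarrow> bnd \<beta> (dsub (P w t) (P v t)) (D / 2 * exp (l * t) * t powr (- \<eta>))"
    using contraction_half[OF M] unfolding halving_def by blast
  have step: "\<forall>t\<in>{0<..S}. bnd \<beta> (dsub (w t) (v t)) (2 * M / 2 ^ n * exp (l * t) * t powr (- \<eta>))" for n
  proof (induction n)
    case 0
    show ?case
    proof
      fix t assume t: "t \<in> {0<..S}"
      have "bnd \<beta> (dsub (w t) (v t)) (M * t powr (- \<eta>) + M * t powr (- \<eta>))"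
        using w(1) v(1) t unfolding adm_def by (intro bnd_dsub) auto
      moreover have "M * t powr (- \<eta>) + M * t powr (- \<eta>) \<le> 2 * M / 2 ^ 0 * exp (l * t) * t powr (- \<eta>)"
      proof -
        have "1 \<le> exp (l * t)" using l(1) t by simp
        then have "2 * M * t powr (- \<eta>) * 1 \<le> 2 * M * t powr (- \<eta>) * exp (l * t)"
          using M by (intro mult_left_mono) auto
        then show ?thesis by (simp add: mult_ac)
      qed
      ultimately show "bnd \<beta> (dsub (w t) (v t)) (2 * M / 2 ^ 0 * exp (l * t) * t powr (- \<eta>))"
        by (rule bnd_weaken)
    qed
  next
    case (Suc n)
    show ?case
    proof
      fix t assume t: "t \<in> {0<..S}"
      have "bnd \<beta> (dsub (P w t) (P v t)) (2 * M / 2 ^ n / 2 * exp (l * t) * t powr (- \<eta>))"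
        by (rule l(2)[OF w(1) v(1) _ Suc t]) (use M in simp)
      moreover have "2 * M / 2 ^ n / 2 = 2 * M / 2 ^ Suc n" by simp
      ultimately show "bnd \<beta> (dsub (w t) (v t)) (2 * M / 2 ^ Suc n * exp (l * t) * t powr (- \<eta>))"
        by (simp only: w(2)[OF t, symmetric] v(2)[OF t, symmetric])
    qed
  qed
  show ?thesis
  proof
    fix k
    obtain C where C: "C \<ge> 0" "\<And>f c. bnd \<beta> f c \<Longrightarrow> cmod (f k) \<le> C * c" using coeff_bound[of \<beta> k] by blast
    have "cmod (w t k - v t k) \<le> C * (2 * M * exp (l * t) * t powr (- \<eta>)) * (1 / 2) ^ n" for n
    proof -
      have "cmod (w t k - v t k) \<le> C * (2 * M / 2 ^ n * exp (l * t) * t powr (- \<eta>))"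
        using C(2)[OF bspec[OF step[of n] t]] by (simp add: dsub_def)
      also have "\<dots> = C * (2 * M * exp (l * t) * t powr (- \<eta>)) * (1 / 2) ^ n"
        unfolding power_one_over by simp
      finally show ?thesis .
    qed
    moreover have "(\<lambda>n. C * (2 * M * exp (l * t) * t powr (- \<eta>)) * (1 / 2) ^ n) \<longlonglongrightarrow> C * (2 * M * exp (l * t) * t powr (- \<eta>)) * 0"
      by (rule tendsto_mult[OF tendsto_const LIMSEQ_power_zero]) simp
    ultimately have "cmod (w t k - v t k) \<le> C * (2 * M * exp (l * t) * t powr (- \<eta>)) * 0"
      by (rule LIMSEQ_le_const[rotated, OF exI, OF allI, OF impI])
    then show "w t k = v t k" by simp
  qed
qed

end

lemma convergent_geometric:
  fixes X :: "nat \<Rightarrow> complex"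
  assumes B: "\<And>n m. cmod (X (n + m) - X n) \<le> B / 2 ^ n"
  shows "convergent X"
proof -
  have B0: "0 \<le> B" using order_trans[OF norm_ge_zero B[of 0 0]] by simp
  have "Cauchy X"
    unfolding Cauchy_altdef
  proof (intro allI impI)
    fix e :: real assume e: "e > 0"
    obtain N where N: "(B + 1) / e < 2 ^ N" using real_arch_pow[of 2 "(B + 1) / e"] by auto
    show "\<exists>M. \<forall>m\<ge>M. \<forall>n>m. dist (X m) (X n) < e"
    proof (intro exI[of _ N] allI impI)
      fix m n assume mn: "N \<le> m" "m < n"
      have "dist (X m) (X n) \<le> B / 2 ^ m" using B[of m "n - m"] mn by (simp add: dist_norm norm_minus_commute)
      also have "\<dots> \<le> B / 2 ^ N" using mn B0 by (intro divide_left_mono power_increasing) auto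
      also have "\<dots> < e" using N e by (simp add: field_simps)
      finally show "dist (X m) (X n) < e" .
    qed
  qed
  then show ?thesis by (rule Cauchy_convergent)
qed

context ks_data
begin

section \<open>Picard iteration\<close>

definition it :: "nat \<Rightarrow> real \<Rightarrow> tdist" where
  "it n = (P ^^ n) (\<lambda>_ _. 0)"

lemma it_0: "it 0 = (\<lambda>_ _. 0)" and it_Suc: "it (Suc n) = P (it n)"
  by (simp_all add: it_def)

lemma it_adm: "adm 1 \<gamma> (it n)"
proof (induction n)
  case 0
  have "contb \<beta> {0<..S} (\<lambda>_ _. 0)"
    unfolding contb_def
  proof (intro ballI allI impI)
    fix s0 e :: real assume e: "e > 0"
    have "dsub (\<lambda>_. 0) (\<lambda>_. 0) = (\<lambda>_. 0)" by (simp add: dsub_def)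
    then show "\<exists>d>0. \<forall>s\<in>{0<..S}. \<bar>s - s0\<bar> < d \<longrightarrow> bnd \<beta> (dsub (\<lambda>_. 0) (\<lambda>_. 0)) e"
      using bnd_zero[of e \<beta>] e by (intro exI[of _ 1]) simp
  qed
  moreover have "bnd \<beta> (\<lambda>_. 0) (1 * t powr - \<gamma>)" for t by (rule bnd_zero) simp
  ultimately show ?case unfolding adm_def it_0 by (simp add: real_dist_def)
next
  case (Suc n)
  then show ?case unfolding it_Suc by (rule P_adm)
qed

text \<open>Fixed once by choice, so that the weight \<open>E\<close> depends on time only.\<close>

definition lam :: real where
  "lam = (SOME l. l > 0 \<and> halving 1 l)"

lemma lam:
  shows "lam > 0" "\<And>w v D t. adm 1 \<eta> w \<Longrightarrow> adm 1 \<eta> v \<Longrightarrow> 0 \<le> D \<Longrightarrow>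
    (\<forall>t\<in>{0<..S}. bnd \<beta> (dsub (w t) (v t)) (D * exp (lam * t) * t powr (- \<eta>))) \<Longrightarrow>
    t \<in> {0<..S} \<Longrightarrow> bnd \<beta> (dsub (P w t) (P v t)) (D / 2 * exp (lam * t) * t powr (- \<eta>))"
  using someI_ex[OF contraction_half[of 1]] unfolding lam_def[symmetric] by (auto simp: halving_def)

definition E :: "real \<Rightarrow> real" where "E t = exp (lam * t) * t powr (- \<eta>)"

lemma E_nonneg: "0 \<le> E t" by (simp add: E_def)

lemma lam_E:
  assumes "adm 1 \<gamma> w" "adm 1 \<gamma> v" "0 \<le> D" "\<And>t. t \<in> {0<..S} \<Longrightarrow> bnd \<beta> (dsub (w t) (v t)) (D * E t)" "t \<in> {0<..S}"
  shows "bnd \<beta> (dsub (P w t) (P v t)) (D / 2 * E t)"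
  using lam(2)[OF adm_mono[OF assms(1)] adm_mono[OF assms(2)] assms(3) _ assms(5)] assms(4)
  unfolding E_def by (simp add: mult.assoc)

lemma it_step: "t \<in> {0<..S} \<Longrightarrow> bnd \<beta> (dsub (it (Suc n) t) (it n t)) (2 / 2 ^ n * E t)"
proof (induction n arbitrary: t)
  case 0
  have b: "bnd \<beta> (it n t) (t powr (- \<eta>))" for n
    using adm_mono[OF it_adm[of n], of 1] 0 unfolding adm_def by simp
  have "1 \<le> exp (lam * t)" using lam(1) 0 by simp
  then have "t powr (- \<eta>) * 1 \<le> t powr (- \<eta>) * exp (lam * t)" by (intro mult_left_mono) auto
  then have "t powr (- \<eta>) + t powr (- \<eta>) \<le> 2 / 2 ^ 0 * E t" by (simp add: E_def mult.commute)
  then show ?case by (rule bnd_weaken[OF bnd_dsub[OF b b]])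
next
  case (Suc n)
  have "bnd \<beta> (dsub (P (it (Suc n)) t) (P (it n) t)) (2 / 2 ^ n / 2 * E t)"
    by (rule lam_E[OF it_adm it_adm _ Suc.IH Suc.prems]) auto
  then show ?case by (simp add: it_Suc mult.commute)
qed

lemma it_tele: "t \<in> {0<..S} \<Longrightarrow> bnd \<beta> (dsub (it (n + m) t) (it n t)) (4 / 2 ^ n * E t)"
proof -
  assume t: "t \<in> {0<..S}"
  \<comment> \<open>Strengthened to the exact partial geometric sum, for which the induction on
    \<open>m\<close> closes.\<close>
  have "bnd \<beta> (dsub (it (n + m) t) (it n t)) (4 / 2 ^ n * (1 - 1 / 2 ^ m) * E t)"
  proof (induction m)
    case 0
    then show ?case using bnd_zero[of 0 \<beta>] by (simp add: dsub_def)
  next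
    case (Suc m)
    have eq: "dsub (it (n + Suc m) t) (it n t) = dadd (dsub (it (Suc (n + m)) t) (it (n + m) t)) (dsub (it (n + m) t) (it n t))"
      by (simp add: dsub_def dadd_def)
    have "bnd \<beta> (dsub (it (n + Suc m) t) (it n t)) (2 / 2 ^ (n + m) * E t + 4 / 2 ^ n * (1 - 1 / 2 ^ m) * E t)"
      unfolding eq by (rule bnd_dadd[OF it_step[OF t] Suc])
    moreover have "2 / 2 ^ (n + m) * E t + 4 / 2 ^ n * (1 - 1 / 2 ^ m) * E t = 4 / 2 ^ n * (1 - 1 / 2 ^ Suc m) * E t"
      by (simp add: power_add field_simps)
    ultimately show ?case by simp
  qed
  moreover have "4 / 2 ^ n * (1 - 1 / 2 ^ m) * E t \<le> 4 / 2 ^ n * 1 * E t"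
    using E_nonneg[of t] by (intro mult_right_mono mult_left_mono) auto
  ultimately have "bnd \<beta> (dsub (it (n + m) t) (it n t)) (4 / 2 ^ n * 1 * E t)" by (rule bnd_weaken)
  then show ?thesis by simp
qed

definition sol :: "real \<Rightarrow> tdist" where
  "sol t k = lim (\<lambda>n. it n t k)"

lemma it_tendsto:
  assumes t: "t \<in> {0<..S}"
  shows "(\<lambda>n. it n t k) \<longlonglongrightarrow> sol t k"
proof -
  obtain C where C: "C \<ge> 0" "\<And>f c. bnd \<beta> f c \<Longrightarrow> cmod (f k) \<le> C * c" using coeff_bound[of \<beta> k] by blast
  have "cmod (it (n + m) t k - it n t k) \<le> C * (4 * E t) / 2 ^ n" for n m
    using C(2)[OF it_tele[OF t, of n m]] by (simp add: dsub_def)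
  then have "convergent (\<lambda>n. it n t k)" by (rule convergent_geometric)
  then show ?thesis unfolding sol_def convergent_LIMSEQ_iff .
qed

lemma sol_it:
  assumes t: "t \<in> {0<..S}"
  shows "bnd \<beta> (dsub (sol t) (it n t)) (4 / 2 ^ n * E t)"
proof (rule bnd_limit)
  show "(\<lambda>m. dsub (it (n + m) t) (it n t) k) \<longlonglongrightarrow> dsub (sol t) (it n t) k" for k
    unfolding dsub_def
    using LIMSEQ_ignore_initial_segment[OF it_tendsto[OF t, of k], of n]
    by (intro tendsto_diff tendsto_const) (simp add: add.commute)
  show "bnd \<beta> (dsub (it (n + m) t) (it n t)) (4 / 2 ^ n * E t)" for m by (rule it_tele[OF t])
qed

lemma sol_adm: "adm 1 \<gamma> sol"
  unfolding adm_def
proof (intro conjI ballI)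
  fix t assume t: "t \<in> {0<..S}"
  show "bnd \<beta> (sol t) (1 * t powr - \<gamma>)"
  proof (rule bnd_limit[OF it_tendsto[OF t]])
    show "bnd \<beta> (it n t) (1 * t powr - \<gamma>)" for n using it_adm[of n] t unfolding adm_def by blast
  qed
  show "real_dist (sol t)"
    unfolding real_dist_def
  proof
    fix k
    have "it n t (- k) = cnj (it n t k)" for n
      using it_adm[of n] t unfolding adm_def real_dist_def by blast
    then have "(\<lambda>n. cnj (it n t k)) \<longlonglongrightarrow> sol t (- k)" using it_tendsto[OF t, of "- k"] by simp
    moreover have "(\<lambda>n. cnj (it n t k)) \<longlonglongrightarrow> cnj (sol t k)" by (intro tendsto_intros it_tendsto t)
    ultimately show "sol t (- k) = cnj (sol t k)" by (rule LIMSEQ_unique)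
  qed
next
  show "contb \<beta> {0<..S} sol"
    unfolding contb_def
  proof (intro ballI allI impI)
    fix s0 e :: real assume s0: "s0 \<in> {0<..S}" and e: "e > 0"
    \<comment> \<open>The weight \<open>E\<close> is unbounded at time zero; on times from
      \<open>s0 / 2\<close> to \<open>S\<close> it is at most \<open>B\<close>, which makes the
      convergence of the iterates locally uniform.\<close>
    define B where "B = exp (lam * S) * (s0 / 2) powr (- \<eta>)"
    have E_le: "E s \<le> B" if "s0 / 2 \<le> s" "s \<le> S" for s
    proof -
      have "exp (lam * s) \<le> exp (lam * S)" using that lam(1) by simp
      moreover have "s powr (- \<eta>) \<le> (s0 / 2) powr (- \<eta>)" using that s0 par(8) by (intro powr_mono2') auto
      ultimately show ?thesis unfolding E_def B_def by (rule mult_mono) simp_all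
    qed
    have B0: "0 \<le> B" by (simp add: B_def)
    obtain n where n: "(12 * B + 1) / e < 2 ^ n" using real_arch_pow[of 2 "(12 * B + 1) / e"] by auto
    have Bn: "4 / 2 ^ n * B \<le> e / 3" using n e by (simp add: field_simps)
    have "contb \<beta> {0<..S} (it n)" using it_adm[of n] unfolding adm_def by (rule conjunct1)
    from this[unfolded contb_def, rule_format, OF s0, of "e / 3"]
    obtain d where d: "d > 0" "\<forall>s\<in>{0<..S}. \<bar>s - s0\<bar> < d \<longrightarrow> bnd \<beta> (dsub (it n s) (it n s0)) (e / 3)"
      using e by auto
    have near: "bnd \<beta> (dsub (sol s) (it n s)) (e / 3)" if "s \<in> {0<..S}" "s0 / 2 \<le> s" for s
    proof (rule bnd_weaken[OF sol_it[OF that(1)]])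
      have "4 / 2 ^ n * E s \<le> 4 / 2 ^ n * B" using E_le[OF that(2)] that(1) by (intro mult_left_mono) auto
      then show "4 / 2 ^ n * E s \<le> e / 3" using Bn by linarith
    qed
    show "\<exists>d>0. \<forall>s\<in>{0<..S}. \<bar>s - s0\<bar> < d \<longrightarrow> bnd \<beta> (dsub (sol s) (sol s0)) e"
    proof (intro exI[of _ "min d (s0 / 2)"] conjI ballI impI)
      show "0 < min d (s0 / 2)" using d s0 by auto
      fix s assume s: "s \<in> {0<..S}" "\<bar>s - s0\<bar> < min d (s0 / 2)"
      have sd: "\<bar>s - s0\<bar> < d" and s2: "s0 / 2 \<le> s" using s(2) by linarith+
      have "bnd \<beta> (dsub (it n s0) (sol s0)) (e / 3)"
        using near[OF s0] s0 unfolding bnd_dsub_commute[of _ "it n s0"] by simp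
      from bnd_dadd[OF bnd_dadd[OF near[OF s(1) s2] d(2)[rule_format, OF s(1) sd]] this]
      show "bnd \<beta> (dsub (sol s) (sol s0)) e" by (simp add: dadd_def dsub_def)
    qed
  qed
qed

text \<open>\<open>P\<close> halves the weighted distance between \<open>sol\<close> and
  \<open>it n\<close>, so the iterates also converge to \<open>P sol\<close>.\<close>

lemma sol_fixed:
  assumes t: "t \<in> {0<..S}"
  shows "sol t = P sol t"
proof
  fix k
  obtain C where C: "C \<ge> 0" "\<And>f c. bnd \<beta> f c \<Longrightarrow> cmod (f k) \<le> C * c" using coeff_bound[of \<beta> k] by blast
  have le: "cmod (P sol t k - it (Suc n) t k) \<le> (C * (2 * E t)) * (1 / 2) ^ n" for n
  proof -
    have "bnd \<beta> (dsub (P sol t) (P (it n) t)) (4 / 2 ^ n / 2 * E t)"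
      by (rule lam_E[OF sol_adm it_adm _ sol_it t]) auto
    from C(2)[OF this] have "cmod (P sol t k - it (Suc n) t k) \<le> C * (4 / 2 ^ n / 2 * E t)"
      by (simp add: dsub_def it_Suc)
    also have "\<dots> = (C * (2 * E t)) * (1 / 2) ^ n" unfolding power_one_over by simp
    finally show ?thesis .
  qed
  have "(\<lambda>n. (C * (2 * E t)) * (1 / 2) ^ n) \<longlonglongrightarrow> (C * (2 * E t)) * 0"
    by (rule tendsto_mult[OF tendsto_const LIMSEQ_power_zero]) simp
  then have "(\<lambda>n. P sol t k - it (Suc n) t k) \<longlonglongrightarrow> 0"
    by (intro Lim_null_comparison[OF always_eventually, rule_format, OF le]) simp
  then have "(\<lambda>n. it (Suc n) t k) \<longlonglongrightarrow> P sol t k"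
    using tendsto_diff[OF tendsto_const[of "P sol t k"], of "\<lambda>n. P sol t k - it (Suc n) t k" 0] by simp
  moreover have "(\<lambda>n. it (Suc n) t k) \<longlonglongrightarrow> sol t k" by (rule LIMSEQ_Suc[OF it_tendsto[OF t]])
  ultimately show "sol t k = P sol t k" by (rule LIMSEQ_unique[symmetric])
qed

section \<open>Properties of the solution\<close>

text \<open>\<open>adm\<close> only speaks of regularity \<open>\<beta>\<close>; one application of
  the fixed-point map lifts the bound to \<open>\<alpha>\<close>.\<close>

lemma sol_ball: "t \<in> {0<..S} \<Longrightarrow> bnd \<alpha> (sol t) (t powr (- \<eta>))"
  using P_ball[OF sol_adm, of t \<alpha>] sol_fixed[of t] by simp

lemma sol_mild: "mild_sol \<rho>0 \<rho> \<alpha> \<eta> chi \<zeta> Z S sol"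
  unfolding mild_sol_iff in_Ceta_def
proof (intro conjI ballI allI sol_fixed)
  have M: "0 \<le> (1::real)" "0 \<le> \<gamma>" "3 * \<gamma> < 1" using gamma_bounds par by auto
  show "(\<lambda>s. heat (t - s) (force chi (U sol) s) k) integrable_on {0..t}" if "t \<in> {0<..S}" for t k
    by (rule adm_integrable[OF sol_adm M that])
  have "contb \<alpha> {0<..S} (P sol)" by (rule P_contb[OF sol_adm M])
  then have "contb \<alpha> {0<..S} sol" unfolding contb_def by (simp add: sol_fixed[symmetric])
  then show "cont_C \<rho>0 \<rho> \<alpha> {0<..S} sol"
    by (rule contb_cont_C) (use P_in_C[OF sol_adm] sol_fixed in auto)
  show "bdd_above ((\<lambda>t. min (t powr \<eta>) 1 * besov_norm \<rho>0 \<rho> \<alpha> (sol t)) ` {0<..S})"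
  proof (rule bdd_aboveI2)
    fix t assume t: "t \<in> {0<..S}"
    have "besov_norm \<rho>0 \<rho> \<alpha> (sol t) \<le> t powr (- \<eta>)" by (rule bnd_besov(2)[OF sol_ball[OF t]])
    moreover have "0 \<le> besov_norm \<rho>0 \<rho> \<alpha> (sol t)"
      by (rule bnd_nonneg[OF besov_bnd[OF bnd_besov(1)[OF sol_ball[OF t]]]])
    ultimately have "min (t powr \<eta>) 1 * besov_norm \<rho>0 \<rho> \<alpha> (sol t) \<le> t powr \<eta> * t powr (- \<eta>)"
      by (intro mult_mono) auto
    also have "\<dots> = 1" using t by (simp add: powr_add[symmetric])
    finally show "min (t powr \<eta>) 1 * besov_norm \<rho>0 \<rho> \<alpha> (sol t) \<le> 1" .
  qed
qed

lemma sol_norm: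
  assumes t: "t \<in> {0<..S}"
  shows "t powr \<eta> * besov_norm \<rho>0 \<rho> \<alpha> (sol t) \<le> 1"
proof -
  have "t powr \<eta> * besov_norm \<rho>0 \<rho> \<alpha> (sol t) \<le> t powr \<eta> * t powr (- \<eta>)"
    by (intro mult_left_mono bnd_besov(2) sol_ball t) auto
  also have "\<dots> = 1" using t by (simp add: powr_add[symmetric])
  finally show ?thesis .
qed

lemma sol_unique:
  assumes v: "mild_sol \<rho>0 \<rho> \<alpha> \<eta> chi \<zeta> Z S v" and t: "t \<in> {0<..S}"
  shows "v t = sol t"
proof -
  have cont: "cont_C \<rho>0 \<rho> \<alpha> {0<..S} v" and bdd: "bdd_above ((\<lambda>t. min (t powr \<eta>) 1 * besov_norm \<rho>0 \<rho> \<alpha> (v t)) ` {0<..S})"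
    and fix': "\<And>t. t \<in> {0<..S} \<Longrightarrow> v t = P v t"
    using v unfolding mild_sol_iff in_Ceta_def by auto
  obtain B where B: "\<And>t. t \<in> {0<..S} \<Longrightarrow> min (t powr \<eta>) 1 * besov_norm \<rho>0 \<rho> \<alpha> (v t) \<le> B"
  proof -
    from bdd obtain B where "\<forall>x\<in>(\<lambda>t. min (t powr \<eta>) 1 * besov_norm \<rho>0 \<rho> \<alpha> (v t)) ` {0<..S}. x \<le> B"
      unfolding bdd_above_def by blast
    then show ?thesis using that by blast
  qed
  \<comment> \<open>\<open>2 * B\<close> because lowering the exponent from \<open>\<alpha>\<close>
    to \<open>\<beta>\<close> costs a factor 2; at least 1 so that \<open>sol\<close> lies in the
    same class by \<open>adm_mono\<close>.\<close>
  define M where "M = max 1 (2 * B)"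
  have "adm M \<eta> v"
    unfolding adm_def
  proof (intro conjI ballI)
    show "contb \<beta> {0<..S} v" by (rule contb_exponent[OF cont_C_contb[OF cont]]) (use beta_bounds in auto)
    fix t assume t: "t \<in> {0<..S}"
    have C: "in_C \<rho>0 \<rho> \<alpha> (v t)" using cont t unfolding cont_C_def by blast
    show "real_dist (v t)" by (rule in_C_real[OF C])
    have "t powr \<eta> \<le> 1" using t S par(8) by (intro powr_le1) auto
    then have "t powr \<eta> * besov_norm \<rho>0 \<rho> \<alpha> (v t) \<le> B" using B[OF t] by (simp add: min_def)
    then have "t powr \<eta> * besov_norm \<rho>0 \<rho> \<alpha> (v t) * t powr (- \<eta>) \<le> B * t powr (- \<eta>)" by (rule mult_right_mono) simp
    moreover have "t powr \<eta> * t powr (- \<eta>) = 1" using t by (simp add: powr_add[symmetric])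
    then have "t powr \<eta> * besov_norm \<rho>0 \<rho> \<alpha> (v t) * t powr (- \<eta>) = besov_norm \<rho>0 \<rho> \<alpha> (v t)"
      by (metis mult.commute mult.left_commute mult.right_neutral)
    ultimately have "2 * besov_norm \<rho>0 \<rho> \<alpha> (v t) \<le> 2 * B * t powr (- \<eta>)" by simp
    also have "\<dots> \<le> M * t powr (- \<eta>)" by (intro mult_right_mono) (auto simp: M_def)
    finally show "bnd \<beta> (v t) (M * t powr - \<eta>)"
      by (rule bnd_weaken[OF bnd_exponent[OF in_C_bnd[OF C]], rotated 2]) (use beta_bounds in auto)
  qed
  then show ?thesis
    by (rule unique[OF _ fix' adm_mono[OF sol_adm] sol_fixed _ t]) (auto simp: M_def)
qed

section \<open>Convergence to the initial datum\<close>

definition \<kappa> :: real where "\<kappa> = (\<beta> - \<alpha>0) / 2"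
text \<open>Power of \<open>t\<close> left in the Duhamel term in regularity
  \<open>\<alpha>0\<close> when the solution grows at the rate \<open>\<kappa>\<close>. It is
  positive because \<open>3 * \<beta> / 2 < \<alpha> < \<alpha>0 + 1/2\<close>.\<close>

definition e0 :: real where "e0 = 1/2 + \<alpha>0 - 3 * \<beta> / 2"

lemma e0: "0 < e0" and kappa_bounds: "0 < \<kappa>" "3 * \<kappa> < 1"
  using beta_bounds par by (auto simp: e0_def \<kappa>_def field_simps)

lemma duh_near:
  assumes w: "adm 1 \<gamma> w" and b: "\<And>s. s \<in> {0<..\<tau>} \<Longrightarrow> bnd \<beta> (w s) (K * s powr (- \<kappa>))" and K: "0 \<le> K"
    and \<tau>: "\<tau> \<le> S" and t: "t \<in> {0<..\<tau>}" and s: "- 1 \<le> \<sigma>" "\<sigma> < 1"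
  shows "bnd \<sigma> (duh (force chi (U w)) 0 t)
    (duh_const K \<kappa> \<sigma> t)"
proof (rule duh_force_bnd[OF beta_bounds(1)])
  show "contb \<beta> {0<..\<tau>} (U w)" by (rule contb_subset[OF adm_U(1)[OF w]]) (use \<tau> in auto)
  fix s assume s: "s \<in> {0<..\<tau>}"
  then have s': "s \<in> {0<..S}" using \<tau> by auto
  show "real_dist (U w s)" by (rule adm_U(2)[OF w s'])
  show "bnd \<beta> (U w s) (K * s powr (- \<kappa>) + 2 * z)" by (rule bnd_dadd[OF b[OF s] Z(2)[OF s']])
  show "(K * s powr (- \<kappa>) + 2 * z) ^ 3 \<le> KM K * s powr (- (3 * \<kappa>))"
    by (rule adm_K[OF K _ s']) (use kappa_bounds in simp)
qed (use kappa_bounds t \<tau> S s in auto)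

text \<open>The ball bound alone would leave the power
  \<open>1/2 - \<alpha>0 / 2 - 3 * \<gamma>\<close>, which can be negative for \<open>\<eta>\<close>
  near \<open>1/4\<close>. The better rate is propagated through the iterates on a short interval
  and passes to the limit.\<close>

lemma sol_near:
  "\<exists>\<tau> K. 0 < \<tau> \<and> \<tau> \<le> S \<and> 0 \<le> K \<and> (\<forall>t\<in>{0<..\<tau>}. bnd \<beta> (sol t) (K * t powr (- \<kappa>)))"
proof -
  \<comment> \<open>\<open>288 * R\<close> is the linear flow; the 1 is room for the Duhamel term,
    which \<open>\<tau>'\<close> makes small enough that \<open>K\<close> reproduces itself in the
    induction.\<close>
  define K where "K = 288 * R + 1"
  have K: "0 \<le> K" using R by (simp add: K_def)
  define Q where "Q = cH * \<bar>chi\<bar> * cN \<beta> * KM K * Beta (1 - 3 * \<kappa>) (1 - (1 + \<beta>) / 2)"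
  have "0 < Beta (1 - 3 * \<kappa>) (1 - (1 + \<beta>) / 2)" by (rule Beta_real_pos) (use kappa_bounds beta_bounds par in auto)
  then have Q: "0 \<le> Q" unfolding Q_def using cN_pos[OF beta_bounds(1)] KM_nonneg[OF K] by simp
  obtain \<tau>' where \<tau>': "\<tau>' > 0" "\<And>t. 0 < t \<Longrightarrow> t \<le> \<tau>' \<Longrightarrow> Q * t powr e0 \<le> 1"
    using powr_small[OF Q e0, of 1] by auto
  define \<tau> where "\<tau> = min S \<tau>'"
  have \<tau>: "0 < \<tau>" "\<tau> \<le> S" using S \<tau>' by (auto simp: \<tau>_def)
  have "\<forall>t\<in>{0<..\<tau>}. bnd \<beta> (it n t) (K * t powr (- \<kappa>))" for n
  proof (induction n)
    case 0
    then show ?case using bnd_zero K by (simp add: it_0)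
  next
    case (Suc n)
    show ?case
    proof
      fix t assume t: "t \<in> {0<..\<tau>}"
      have t01: "0 < t" "t \<le> 1" using t \<tau> S by auto
      have 1: "bnd \<beta> (heat t \<zeta>) (288 * t powr (- (\<beta> - \<alpha>0) / 2) * R)"
        by (rule bnd_heat[OF zeta(2) t01]) (use beta_bounds par in auto)
      have 2: "bnd \<beta> (duh (force chi (U (it n))) 0 t)
        (duh_const K \<kappa> \<beta> t)"
        by (rule duh_near[OF it_adm _ K \<tau>(2) t]) (use Suc beta_bounds par in auto)
      have "1 - (1 + \<beta>) / 2 - 3 * \<kappa> = e0 + - \<kappa>" by (simp add: e0_def \<kappa>_def field_simps)
      then have "t powr (1 - (1 + \<beta>) / 2 - 3 * \<kappa>) = t powr e0 * t powr (- \<kappa>)"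
        by (simp only: powr_add)
      then have "duh_const K \<kappa> \<beta> t
         = Q * t powr e0 * t powr (- \<kappa>)" by (simp add: Q_def)
      also have "\<dots> \<le> 1 * t powr (- \<kappa>)"
        using \<tau>'(2)[of t] t by (intro mult_right_mono) (auto simp: \<tau>_def)
      finally have 3: "duh_const K \<kappa> \<beta> t \<le> t powr (- \<kappa>)"
        by simp
      have pe: "- (\<beta> - \<alpha>0) / 2 = - \<kappa>" by (simp add: \<kappa>_def field_simps)
      have "288 * t powr (- (\<beta> - \<alpha>0) / 2) * R + t powr (- \<kappa>) = K * t powr (- \<kappa>)"
        unfolding pe by (simp add: K_def algebra_simps)
      then show "bnd \<beta> (it (Suc n) t) (K * t powr (- \<kappa>))"
        unfolding it_Suc Phi_def using bnd_dadd[OF 1 bnd_weaken[OF 2 3]] by simp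
    qed
  qed
  then have "bnd \<beta> (sol t) (K * t powr (- \<kappa>))" if "t \<in> {0<..\<tau>}" for t
    by (intro bnd_limit[OF it_tendsto]) (use that \<tau> in auto)
  then show ?thesis using \<tau> K by blast
qed

lemma sol_initial:
  assumes z0: "in_C \<rho>0 \<rho> \<alpha>0 \<zeta>"
  shows "((\<lambda>t. besov_norm \<rho>0 \<rho> \<alpha>0 (dsub (sol t) \<zeta>)) \<longlongrightarrow> 0) (at_right 0)"
proof (rule tendstoI)
  fix e :: real assume e: "e > 0"
  obtain \<tau> K where \<tau>: "0 < \<tau>" "\<tau> \<le> S" and K: "0 \<le> K" and b: "\<And>t. t \<in> {0<..\<tau>} \<Longrightarrow> bnd \<beta> (sol t) (K * t powr (- \<kappa>))"
    using sol_near by blast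
  define Q where "Q = cH * \<bar>chi\<bar> * cN \<beta> * KM K * Beta (1 - 3 * \<kappa>) (1 - (1 + \<alpha>0) / 2)"
  have "0 < Beta (1 - 3 * \<kappa>) (1 - (1 + \<alpha>0) / 2)" by (rule Beta_real_pos) (use kappa_bounds beta_bounds par in auto)
  then have Q: "0 \<le> Q" unfolding Q_def using cN_pos[OF beta_bounds(1)] KM_nonneg[OF K] by simp
  obtain \<tau>' where \<tau>': "\<tau>' > 0" "\<And>t. 0 < t \<Longrightarrow> t \<le> \<tau>' \<Longrightarrow> bnd \<alpha>0 (dsub (heat t \<zeta>) \<zeta>) (e / 4)"
    using heat_tendsto[OF z0 _ _, of "e / 4"] par e by auto
  obtain \<tau>'' where \<tau>'': "\<tau>'' > 0" "\<And>t. 0 < t \<Longrightarrow> t \<le> \<tau>'' \<Longrightarrow> Q * t powr e0 \<le> e / 4"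
    using powr_small[OF Q e0, of "e / 4"] e by auto
  define d where "d = Min {\<tau>, \<tau>', \<tau>''}"
  have d: "0 < d" using \<tau> \<tau>' \<tau>'' by (auto simp: d_def)
  have "dist (besov_norm \<rho>0 \<rho> \<alpha>0 (dsub (sol t) \<zeta>)) 0 < e" if t: "0 < t" "t < d" for t
  proof -
    have tt: "t \<in> {0<..\<tau>}" and tS: "t \<in> {0<..S}" using t \<tau> by (auto simp: d_def)
    have 1: "bnd \<alpha>0 (dsub (heat t \<zeta>) \<zeta>) (e / 4)" by (rule \<tau>'(2)) (use t in \<open>auto simp: d_def\<close>)
    have 2: "bnd \<alpha>0 (duh (force chi (U sol)) 0 t)
        (duh_const K \<kappa> \<alpha>0 t)"
      by (rule duh_near[OF sol_adm b K \<tau>(2) tt]) (use par in auto)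
    have "1 - (1 + \<alpha>0) / 2 - 3 * \<kappa> = e0" by (simp add: e0_def \<kappa>_def field_simps)
    then have "duh_const K \<kappa> \<alpha>0 t = Q * t powr e0"
      by (simp add: Q_def)
    also have "\<dots> \<le> e / 4" by (rule \<tau>''(2)) (use t in \<open>auto simp: d_def\<close>)
    finally have 3: "duh_const K \<kappa> \<alpha>0 t \<le> e / 4" .
    have eq: "dsub (sol t) \<zeta> = dadd (dsub (heat t \<zeta>) \<zeta>) (duh (force chi (U sol)) 0 t)"
      unfolding sol_fixed[OF tS] Phi_def by (simp add: dsub_def dadd_def algebra_simps)
    have b: "bnd \<alpha>0 (dsub (sol t) \<zeta>) (e / 4 + e / 4)"
      unfolding eq by (rule bnd_dadd[OF 1 bnd_weaken[OF 2 3]])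
    show ?thesis
      using bnd_besov(2)[OF b] bnd_nonneg[OF besov_bnd[OF bnd_besov(1)[OF b]]] e by simp
  qed
  then show "\<forall>\<^sub>F t in at_right 0. dist (besov_norm \<rho>0 \<rho> \<alpha>0 (dsub (sol t) \<zeta>)) 0 < e"
    unfolding eventually_at_right_field using d by (intro exI[of _ d]) auto
qed

end

theorem theorem3p4:
  fixes \<alpha>0 \<alpha> \<eta> chi T :: real and \<rho>0 \<rho> :: "real \<Rightarrow> real"
  assumes "- 1/2 < \<alpha>0" "\<alpha>0 < 0" "0 < \<alpha>" "\<alpha> < \<alpha>0 + 1/2"
    and "(\<alpha> - \<alpha>0) / 2 < \<eta>" "\<eta> < 1/4"
    and "dyadic_partition \<rho>0 \<rho>"
    and "T > 0"
  shows "\<exists>C>0. \<forall>(R::real) \<zeta> Z.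
     in_C \<rho>0 \<rho> \<alpha>0 \<zeta> \<and> cont_C \<rho>0 \<rho> \<alpha> {0..T} Z \<and> (\<forall>t\<in>{0..T}. Z t 0 = 0) \<and>
     R \<ge> 1 \<and>
     (SUP t\<in>{0..T}. besov_norm \<rho>0 \<rho> \<alpha> (Z t)) ^ 3 + besov_norm \<rho>0 \<rho> \<alpha>0 \<zeta> < R \<longrightarrow>
     (let \<theta> = min (\<eta> - (\<alpha> - \<alpha>0) / 2) (1/2 - 2 * \<eta>);
          Ts = min ((1 / (C * R)) powr (1 / \<theta>)) T
      in (\<exists>w. mild_sol \<rho>0 \<rho> \<alpha> \<eta> chi \<zeta> Z Ts w \<and>
              (\<forall>w'. mild_sol \<rho>0 \<rho> \<alpha> \<eta> chi \<zeta> Z Ts w' \<longrightarrow> (\<forall>t\<in>{0<..Ts}. w' t = w t)) \<and>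
              (\<forall>t\<in>{0<..Ts}. t powr \<eta> * besov_norm \<rho>0 \<rho> \<alpha> (w t) \<le> 1) \<and>
              ((\<lambda>t. besov_norm \<rho>0 \<rho> \<alpha>0 (dsub (w t) \<zeta>)) \<longlongrightarrow> 0) (at_right 0)))"
proof -
  obtain Lw where "lp \<rho>0 \<rho> Lw" using lp_exists[OF assms(7)] by blast
  then interpret ks \<rho>0 \<rho> Lw \<alpha>0 \<alpha> \<eta> chi
    using assms by (simp add: ks_def ks_axioms_def)
  show ?thesis
    unfolding Let_def \<theta>_def[symmetric]
  proof (intro exI[of _ C0] conjI allI impI)
    show "C0 > 0" using C0 by simp
    fix R \<zeta> Z
    define Ts where "Ts = min ((1 / (C0 * R)) powr (1 / \<theta>)) T"
    define z where "z = (SUP t\<in>{0..T}. besov_norm \<rho>0 \<rho> \<alpha> (Z t))"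
    assume *: "in_C \<rho>0 \<rho> \<alpha>0 \<zeta> \<and> cont_C \<rho>0 \<rho> \<alpha> {0..T} Z \<and> (\<forall>t\<in>{0..T}. Z t 0 = 0) \<and>
     R \<ge> 1 \<and> (SUP t\<in>{0..T}. besov_norm \<rho>0 \<rho> \<alpha> (Z t)) ^ 3 + besov_norm \<rho>0 \<rho> \<alpha>0 \<zeta> < R"
    then have z0: "in_C \<rho>0 \<rho> \<alpha>0 \<zeta>" and Zc: "cont_C \<rho>0 \<rho> \<alpha> {0..T} Z" and R: "R \<ge> 1"
      and le: "z ^ 3 + besov_norm \<rho>0 \<rho> \<alpha>0 \<zeta> < R"
      by (simp_all add: z_def)
    have ZC: "in_C \<rho>0 \<rho> \<alpha> (Z t)" if "t \<in> {0..T}" for t using Zc that unfolding cont_C_def by blast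
    have Zn: "besov_norm \<rho>0 \<rho> \<alpha> (Z t) \<le> z" if "t \<in> {0..T}" for t
      unfolding z_def by (rule cSUP_upper[OF that cont_C_bdd[OF Zc]])
    have zz: "0 \<le> z"
      using Zn[of 0] bnd_nonneg[OF in_C_bnd[OF ZC[of 0]]] assms(8) by simp
    have zn: "0 \<le> besov_norm \<rho>0 \<rho> \<alpha>0 \<zeta>" by (rule bnd_nonneg[OF in_C_bnd[OF z0]])
    have CR: "1 \<le> C0 * R" using mult_mono[of 1 C0 1 R] C0 R by simp
    interpret ks_data \<rho>0 \<rho> Lw \<alpha>0 \<alpha> \<eta> chi \<zeta> Z Ts R z
    proof
      show "real_dist \<zeta>" by (rule in_C_real[OF z0])
      show "bnd \<alpha>0 \<zeta> R" by (rule bnd_weaken[OF in_C_bnd[OF z0]]) (use le zz in \<open>smt (verit) zero_le_power\<close>)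
      show "0 \<le> z" "1 \<le> R" by fact+
      show "z ^ 3 \<le> R" using le zn by simp
      show "0 < Ts" using assms(8) CR by (auto simp: Ts_def)
      \<comment> \<open>The heat estimates hold for times up to one; \<open>C0 * R \<ge> 1\<close>
        guarantees this whatever the size of \<open>T\<close>.\<close>
      have "(1 / (C0 * R)) powr (1 / \<theta>) \<le> 1" using CR theta_pos by (intro powr_le1) auto
      then show "Ts \<le> 1" by (simp add: Ts_def)
      have "Ts powr \<theta> \<le> ((1 / (C0 * R)) powr (1 / \<theta>)) powr \<theta>"
        using \<open>0 < Ts\<close> theta_pos by (intro powr_mono2) (auto simp: Ts_def)
      also have "\<dots> = 1 / (C0 * R)" using theta_pos CR by (simp add: powr_powr)
      finally have "C0 * R * Ts powr \<theta> \<le> C0 * R * (1 / (C0 * R))" using CR by (intro mult_left_mono) auto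
      also have "C0 * R * (1 / (C0 * R)) \<le> 1" by simp
      finally show "C0 * R * Ts powr \<theta> \<le> 1" .
      have sub: "{0<..Ts} \<subseteq> {0..T}" by (auto simp: Ts_def)
      show "contb \<beta> {0<..Ts} Z"
        by (rule contb_exponent[OF contb_subset[OF cont_C_contb[OF Zc] sub]]) (use beta_bounds in auto)
      fix t assume "t \<in> {0<..Ts}"
      then have t: "t \<in> {0..T}" using sub by blast
      show "real_dist (Z t)" by (rule in_C_real[OF ZC[OF t]])
      show "bnd \<beta> (Z t) (2 * z)"
        by (rule bnd_exponent[OF bnd_weaken[OF in_C_bnd[OF ZC[OF t]] Zn[OF t]]]) (use beta_bounds in auto)
    qed
    show "\<exists>w. mild_sol \<rho>0 \<rho> \<alpha> \<eta> chi \<zeta> Z (min ((1 / (C0 * R)) powr (1 / \<theta>)) T) w \<and>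
       (\<forall>w'. mild_sol \<rho>0 \<rho> \<alpha> \<eta> chi \<zeta> Z (min ((1 / (C0 * R)) powr (1 / \<theta>)) T) w' \<longrightarrow>
          (\<forall>t\<in>{0<..min ((1 / (C0 * R)) powr (1 / \<theta>)) T}. w' t = w t)) \<and>
       (\<forall>t\<in>{0<..min ((1 / (C0 * R)) powr (1 / \<theta>)) T}. t powr \<eta> * besov_norm \<rho>0 \<rho> \<alpha> (w t) \<le> 1) \<and>
       ((\<lambda>t. besov_norm \<rho>0 \<rho> \<alpha>0 (dsub (w t) \<zeta>)) \<longlongrightarrow> 0) (at_right 0)"
      unfolding Ts_def[symmetric]
      using sol_mild sol_unique sol_norm sol_initial[OF z0] by blast
  qed
qed

end
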